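(* Suppose that $a\in C^+[0,T]$, $F\in C([0,T];L^2(\Omega))$ and $u_0\in H_0^1(\Omega)$. Then there exists a unique weak solution $u(x,t;a)$ (in the sense defined in the context) of the fractional diffusion equation $$^C\!D_t^{\alpha}u(x,t)-a(t)\mathcal{L}u(x,t)=F(x,t),\quad x\in\Omega,\ t\in(0,T];$$ $$u(x,t)=0,\quad (x,t)\in\partial\Omega\times(0,T];\qquad u(x,0)=u_0(x),\quad x\in\Omega,$$ with the spectral representation $$u(x,t;a)=\sum_{n=1}^\infty u_n(t;a)\phi_n(x),\quad (x,t)\in\Omega\times[0,T],$$ and for each $n\in\mathbb{N}^+$, $u_n(t;a)\in C[0,T]$ is the unique solution of the fractional ODE $$^C\!D_t^{\alpha}u_n(t;a)+\lambda_na(t)u_n(t;a)=F_n(t),\qquad u_n(0;a)=b_n,$$ with $^C\!D_t^{\alpha}u_n(t;a)\in C[0,T]$. Here $F_n(t)=(F(\cdot,t),\phi_n)$ and $b_n=(u_0,\phi_n)$.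
   Context: $T>0$, $\alpha\in(0,1)$, and $\Omega$ is a bounded and smooth subset of $\mathbb{R}^d$, $d\in\{1,2,3\}$, with $\partial\Omega$ of class $C^3$. The operator $-\mathcal{L}$ is a symmetric uniformly elliptic operator, $-\mathcal{L}u=-\sum_{i,j=1}^d(a^{ij}(x)u_{x_i})_{x_j}+c(x)u$, with $a^{ij},c\in C^2(\overline\Omega)$. Its eigensystem is $\{(\lambda_n,\phi_n):n\in\mathbb{N}^+\}$, with $0<\lambda_1\le\lambda_2\le\cdots$ (finite multiplicity possible), $\lambda_n\to\infty$, and $\{\phi_n:n\in\mathbb{N}^+\}\subset H^2(\Omega)\cap H_0^1(\Omega)$ an orthonormal basis of $L^2(\Omega)$. $(\cdot,\cdot)$ is the inner product in $L^2(\Omega)$. $C^+[0,T]=\{\psi\in C[0,T]:\psi(t)>0,\ t\in[0,T]\}$. $^C\!D_t^{\alpha}$ is the left-sided Djrbashian–Caputo derivative of order $\alpha$ with respect to time: $^C\!D_t^{\alpha}u(x,t)=\frac{1}{\Gamma(1-\alpha)}\int_0^t(t-\tau)^{-\alpha}\frac{d}{d\tau}u(x,\tau)\,d\tau$ (and likewise for functions of $t$ alone), where $\Gamma$ is the Gamma function. Weak solution: $u(x,t;a)$ is called a weak solution in $L^2(\Omega)$ of the fractional diffusion equation, corresponding to the coefficient $a(t)$, if $u(\cdot,t;a)\in H_0^1(\Omega)$ for $t\in(0,T]$ and, for any $\psi\in H^2(\Omega)\cap H_0^1(\Omega)$, $$({}^C\!D_t^{\alpha}u(x,t;a),\psi(x))-(a(t)\mathcal{L}u(x,t;a),\psi(x))=(F(x,t),\psi(x)),\quad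 t\in(0,T],$$ $$(u(x,0;a),\psi(x))=(u_0(x),\psi(x)).$$
   Formalization: The Caputo derivative is taken as the time derivative of the order 1−α fractional integral of f−f(0), since for merely continuous F solutions may be nowhere differentiable; in the weak form it acts on (u,ψ), and (Lu,ψ) is the bilinear-form pairing. *)

theory Defs
  imports "HOL-Analysis.Analysis"
begin

section \<open>The Djrbashian--Caputo derivative\<close>

text \<open>
  The formula \<open>1/\<Gamma>(1-\<alpha>) \<integral>\<^sub>0\<^sup>t (t-\<tau>)\<^sup>-\<^sup>\<alpha> f'(\<tau>) d\<tau>\<close> is read with \<open>f'\<close> the distributional derivative:
  the convolution of the kernel with \<open>f'\<close> is the derivative of the convolution of the kernel with
  \<open>f - f(0)\<close>. A pointwise \<open>f'\<close> would be too restrictive: for a source that is merely continuous in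
  time, the solutions of the fractional ODE below are in general only Hoelder continuous and may be
  nowhere differentiable. That the formula is recovered whenever \<open>f\<close> is absolutely continuous (and
  the integral is continuous in \<open>t\<close>) is proved in \<open>has_caputo_deriv_classical\<close>.
  Continuity of \<open>f\<close> on the closed interval, automatic for absolutely continuous \<open>f\<close>, is part of the
  notion; without it the value \<open>f(0)\<close> would be unrelated to \<open>f\<close> on \<open>(0,T]\<close>.
\<close>

definition caputo_potential :: "real \<Rightarrow> (real \<Rightarrow> real) \<Rightarrow> real \<Rightarrow> real" where
  "caputo_potential \<alpha> f t =
     1 / Gamma (1 - \<alpha>) * (LBINT \<tau>:{0..t}. (t - \<tau>) powr (- \<alpha>) * (f \<tau> - f 0))"

definition has_caputo_deriv :: "real \<Rightarrow> real \<Rightarrow> (real \<Rightarrow> real) \<Rightarrow> (real \<Rightarrow> real) \<Rightarrow> real set \<Rightarrow> bool" where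
  "has_caputo_deriv \<alpha> T f D S \<longleftrightarrow>
     continuous_on {0..T} f \<and>
     (\<forall>t\<in>S. (caputo_potential \<alpha> f has_real_derivative D t) (at t within {0..T}))"

lemma caputo_fubini:
  fixes f' :: "real \<Rightarrow> real"
  assumes \<alpha>: "0 < \<alpha>" "\<alpha> < 1" and s: "0 \<le> s"
    and f': "set_integrable lborel {0..s} f'"
  defines "G \<equiv> \<lambda>r. LBINT \<tau>:{0..r}. (r - \<tau>) powr (- \<alpha>) * f' \<tau>"
  shows "set_integrable lborel {0..s} G"
    and "(LBINT r:{0..s}. G r) =
         (LBINT z:{0..s}. (s - z) powr (- \<alpha>) * (LBINT \<tau>:{0..z}. f' \<tau>))"
proof -
  define \<phi> where "\<phi> = (\<lambda>x. indicator {0..s} x * f' x)"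
  define k where "k = (\<lambda>z. indicator {0..s} z * z powr (- \<alpha>))"
  define H where "H = (\<lambda>(z, r). indicator {0..s} r * (k z * \<phi> (r - z)))"
  have \<phi>_int: "integrable lborel \<phi>"
    using f' by (simp add: \<phi>_def set_integrable_def)
  then have [measurable]: "\<phi> \<in> borel_measurable borel"
    by simp
  have [measurable]: "k \<in> borel_measurable borel"
    unfolding k_def by measurable
  have "(\<lambda>z. z powr (- \<alpha>)) integrable_on {0..s}"
    using \<alpha> s by (intro integrable_on_powr_from_0) auto
  then have "(\<lambda>z. z powr (- \<alpha>)) absolutely_integrable_on {0..s}"
    by (subst absolutely_integrable_on_iff_nonneg) auto
  then have k_int: "integrable lborel k"
    unfolding k_def set_integrable_def
    by (subst (asm) integrable_completion) auto
  have shift_int: "integrable lborel (\<lambda>r. \<phi> (r - z))" for z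
    using lborel_integrable_real_affine[OF \<phi>_int, of 1 "- z"] by simp
  have shift_eq: "(LINT r|lborel. \<bar>\<phi> (r - z)\<bar>) = (LINT r|lborel. \<bar>\<phi> r\<bar>)" for z
    using lborel_integral_real_affine[of 1 "\<lambda>x. \<bar>\<phi> x\<bar>" "- z"] by simp
  have conv_int: "integrable (lborel \<Otimes>\<^sub>M lborel) (\<lambda>(z, r). k z * \<phi> (r - z))"
  proof (rule lborel_pair.Fubini_integrable)
    show "(\<lambda>(z, r). k z * \<phi> (r - z)) \<in> borel_measurable (lborel \<Otimes>\<^sub>M lborel)"
      by measurable
    show "integrable lborel (\<lambda>z. LINT r|lborel. norm (case (z, r) of (z, r) \<Rightarrow> k z * \<phi> (r - z)))"
      using k_int by (simp add: abs_mult shift_eq)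
    show "AE z in lborel. integrable lborel (\<lambda>r. case (z, r) of (z, r) \<Rightarrow> k z * \<phi> (r - z))"
      using shift_int by simp
  qed
  have H_int: "integrable (lborel \<Otimes>\<^sub>M lborel) H"
    by (rule Bochner_Integration.integrable_bound[OF conv_int])
       (auto simp: H_def indicator_def split: prod.splits)
  have inner_r: "(LINT z|lborel. H (z, r)) = indicator {0..s} r * G r" for r
  proof -
    have "G r = (LINT \<tau>|lborel. indicator {0..r} \<tau> * ((r - \<tau>) powr (- \<alpha>) * f' \<tau>))"
      by (simp add: G_def set_lebesgue_integral_def)
    also have "\<dots> = (LINT z|lborel. indicator {0..r} (r - z) * (z powr (- \<alpha>) * f' (r - z)))"
      using lborel_integral_real_affine[of "-1" "\<lambda>\<tau>. indicator {0..r} \<tau> * ((r - \<tau>) powr (- \<alpha>) * f' \<tau>)" r]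
      by simp
    finally have G: "G r = (LINT z|lborel. indicator {0..r} (r - z) * (z powr (- \<alpha>) * f' (r - z)))" .
    show ?thesis
    proof (cases "r \<in> {0..s}")
      case True
      then have "(\<lambda>z. H (z, r)) = (\<lambda>z. indicator {0..r} (r - z) * (z powr (- \<alpha>) * f' (r - z)))"
        by (auto simp: H_def k_def \<phi>_def indicator_def fun_eq_iff)
      with True G show ?thesis by simp
    qed (simp add: H_def)
  qed
  have inner_z: "(LINT r|lborel. H (z, r)) =
      indicator {0..s} z * (z powr (- \<alpha>) * (LBINT \<tau>:{0..s - z}. f' \<tau>))" for z
  proof (cases "z \<in> {0..s}")
    case True
    have "(LINT r|lborel. H (z, r)) = (LINT r|lborel. z powr (- \<alpha>) * (indicator {0..s - z} (r - z) * f' (r - z)))"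
      using True by (intro Bochner_Integration.integral_cong)
        (auto simp: H_def k_def \<phi>_def indicator_def)
    also have "\<dots> = z powr (- \<alpha>) * (LINT r|lborel. indicator {0..s - z} (r - z) * f' (r - z))"
      by simp
    also have "(LINT r|lborel. indicator {0..s - z} (r - z) * f' (r - z)) = (LBINT \<tau>:{0..s - z}. f' \<tau>)"
      using lborel_integral_real_affine[of 1 "\<lambda>x. indicator {0..s - z} x * f' x" "- z"]
      by (simp add: set_lebesgue_integral_def)
    finally show ?thesis using True by simp
  qed (simp add: H_def k_def)
  have "integrable lborel (\<lambda>r. LINT z|lborel. H (z, r))"
    using lborel_pair.integrable_snd[of "\<lambda>z r. H (z, r)"] H_int by simp
  then show "set_integrable lborel {0..s} G"
    by (simp add: inner_r set_integrable_def)
  have "(LBINT r:{0..s}. G r) = (LINT r|lborel. LINT z|lborel. H (z, r))"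
    by (simp add: inner_r set_lebesgue_integral_def)
  also have "\<dots> = (LINT z|lborel. LINT r|lborel. H (z, r))"
    using lborel_pair.Fubini_integral[of "\<lambda>z r. H (z, r)"] H_int by simp
  also have "\<dots> = (LINT z|lborel. indicator {0..s} z * (z powr (- \<alpha>) * (LBINT \<tau>:{0..s - z}. f' \<tau>)))"
    by (simp add: inner_z)
  also have "\<dots> = (LBINT z:{0..s}. (s - z) powr (- \<alpha>) * (LBINT \<tau>:{0..z}. f' \<tau>))"
  proof -
    have ind: "indicator {0..s} (s - z) = (indicator {0..s} z :: real)" for z
      by (auto simp: indicator_def)
    show ?thesis
      using lborel_integral_real_affine[of "-1"
        "\<lambda>z. indicator {0..s} z * (z powr (- \<alpha>) * (LBINT \<tau>:{0..s - z}. f' \<tau>))" s]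
      by (simp add: set_lebesgue_integral_def ind)
  qed
  finally show "(LBINT r:{0..s}. G r) =
         (LBINT z:{0..s}. (s - z) powr (- \<alpha>) * (LBINT \<tau>:{0..z}. f' \<tau>))" .
qed

lemma has_caputo_deriv_classical:
  fixes f f' :: "real \<Rightarrow> real"
  assumes \<alpha>: "0 < \<alpha>" "\<alpha> < 1" and S: "S \<subseteq> {0..T}"
    and f': "set_integrable lborel {0..T} f'"
    and f: "\<And>t. t \<in> {0..T} \<Longrightarrow> f t = f 0 + (LBINT \<tau>:{0..t}. f' \<tau>)"
  defines "D \<equiv> \<lambda>t. 1 / Gamma (1 - \<alpha>) * (LBINT \<tau>:{0..t}. (t - \<tau>) powr (- \<alpha>) * f' \<tau>)"
  assumes cont: "\<And>t. t \<in> S \<Longrightarrow> continuous (at t within {0..T}) D"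
  shows "has_caputo_deriv \<alpha> T f D S"
  unfolding has_caputo_deriv_def
proof (intro conjI ballI)
  have sub: "set_integrable lborel {0..t} f'" if "t \<in> {0..T}" for t
    by (rule set_integrable_subset[OF f']) (use that in auto)
  have f'_HK: "f' integrable_on {0..T}"
    using set_borel_integral_eq_integral(1)[OF f'] .
  have "continuous_on {0..T} (\<lambda>t. f 0 + integral {0..t} f')"
    by (intro continuous_intros indefinite_integral_continuous_1 f'_HK)
  then show "continuous_on {0..T} f"
    by (rule continuous_on_eq) (simp add: f[symmetric] sub set_borel_integral_eq_integral(2)[symmetric])
  fix t assume t: "t \<in> S"
  with S have t': "t \<in> {0..T}" by auto
  define G where "G = (\<lambda>r. LBINT \<tau>:{0..r}. (r - \<tau>) powr (- \<alpha>) * f' \<tau>)"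
  have pot: "caputo_potential \<alpha> f s = integral {0..s} D" if s: "s \<in> {0..T}" for s
  proof -
    from s have s0: "0 \<le> s" by simp
    have G: "set_integrable lborel {0..s} G" "(LBINT r:{0..s}. G r) =
         (LBINT z:{0..s}. (s - z) powr (- \<alpha>) * (LBINT \<tau>:{0..z}. f' \<tau>))"
      using caputo_fubini[OF \<alpha> s0 sub[OF s]] by (simp_all add: G_def)
    have "integral {0..s} D = 1 / Gamma (1 - \<alpha>) * integral {0..s} G"
      by (simp add: D_def G_def)
    also have "integral {0..s} G = (LBINT r:{0..s}. G r)"
      using set_borel_integral_eq_integral(2)[OF G(1)] by simp
    also have "\<dots> = (LBINT z:{0..s}. (s - z) powr (- \<alpha>) * (f z - f 0))"
    proof -
      have "(LBINT \<tau>:{0..z}. f' \<tau>) = f z - f 0" if "z \<in> {0..s}" for z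
        using f[of z] that s by simp
      then show ?thesis
        unfolding G(2) by (intro set_lebesgue_integral_cong) auto
    qed
    finally show ?thesis by (simp add: caputo_potential_def)
  qed
  have "0 \<le> T" using t' by auto
  then have "set_integrable lborel {0..T} G"
    using caputo_fubini(1)[OF \<alpha> _ f'] by (simp add: G_def)
  then have "G integrable_on {0..T}"
    by (rule set_borel_integral_eq_integral(1))
  then have "D integrable_on {0..T}"
    unfolding D_def G_def by (rule integrable_on_mult_right)
  then have "((\<lambda>s. integral {0..s} D) has_vector_derivative D t) (at t within {0..T})"
    using integral_has_vector_derivative_continuous_at[of D 0 T t "{}"] t' cont[OF t] by simp
  then have "((\<lambda>s. integral {0..s} D) has_real_derivative D t) (at t within {0..T})"
    by (simp add: has_real_derivative_iff_has_vector_derivative)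
  then show "(caputo_potential \<alpha> f has_real_derivative D t) (at t within {0..T})"
    by (rule has_field_derivative_transform_within[OF _ zero_less_one t']) (simp add: pot)
qed

text \<open>
  Both \<open>y\<close> and its Caputo derivative are in \<open>C[0,T]\<close>. The value of the latter at \<open>0\<close> is the one-sided
  derivative of the potential; for \<open>D\<close> continuous it is forced by the values on \<open>(0,T]\<close>.
\<close>

definition frac_ode_solution ::
  "real \<Rightarrow> real \<Rightarrow> (real \<Rightarrow> real) \<Rightarrow> real \<Rightarrow> (real \<Rightarrow> real) \<Rightarrow> real \<Rightarrow> (real \<Rightarrow> real) \<Rightarrow> bool" where
  "frac_ode_solution \<alpha> T a lam f b y \<longleftrightarrow>
     continuous_on {0..T} y \<and> y 0 = b \<and>
     (\<exists>D. has_caputo_deriv \<alpha> T y D {0..T} \<and> continuous_on {0..T} D \<and>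
          (\<forall>t\<in>{0..T}. D t + lam * a t * y t = f t))"


section \<open>Classical smoothness\<close>

definition partial_deriv :: "'d::finite \<Rightarrow> (real^'d \<Rightarrow> real) \<Rightarrow> real^'d \<Rightarrow> real" where
  "partial_deriv i f x = frechet_derivative f (at x) (axis i 1)"

text \<open>\<open>Ck_on k S\<close> is meant for open \<open>S\<close>.\<close>

primrec Ck_on :: "nat \<Rightarrow> (real^'d::finite) set \<Rightarrow> (real^'d \<Rightarrow> real) \<Rightarrow> bool" where
  "Ck_on 0 S f \<longleftrightarrow> continuous_on S f"
| "Ck_on (Suc k) S f \<longleftrightarrow>
     (\<forall>x\<in>S. f differentiable (at x)) \<and> (\<forall>i. Ck_on k S (partial_deriv i f))"

text \<open>
  \<open>C\<^sup>k\<close> up to the boundary of the open set \<open>S\<close>: all partial derivatives of order at most \<open>k\<close> exist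
  in \<open>S\<close> and extend continuously to the closure. The values of \<open>f\<close> outside \<open>S\<close> are irrelevant.
\<close>

primrec Ck_closure :: "nat \<Rightarrow> (real^'d::finite) set \<Rightarrow> (real^'d \<Rightarrow> real) \<Rightarrow> bool" where
  "Ck_closure 0 S f \<longleftrightarrow> (\<exists>g. continuous_on (closure S) g \<and> (\<forall>x\<in>S. g x = f x))"
| "Ck_closure (Suc k) S f \<longleftrightarrow>
     (\<exists>g. continuous_on (closure S) g \<and> (\<forall>x\<in>S. g x = f x)) \<and>
     (\<forall>x\<in>S. f differentiable (at x)) \<and> (\<forall>i. Ck_closure k S (partial_deriv i f))"

text \<open>
  The boundary is \<open>C\<^sup>k\<close> if near each of its points, after an orthogonal change of coordinates \<open>Q\<close>,
  the set is the part above the graph of a \<open>C\<^sup>k\<close> function \<open>\<gamma>\<close> of the coordinates other than \<open>m\<close>;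
  \<open>\<gamma>\<close> is given on the whole space and required not to depend on the \<open>m\<close>-th coordinate.
\<close>

definition Ck_boundary :: "nat \<Rightarrow> (real^'d::finite) set \<Rightarrow> bool" where
  "Ck_boundary k \<Omega> \<longleftrightarrow>
     (\<forall>p\<in>frontier \<Omega>. \<exists>r>0. \<exists>(Q :: real^'d \<Rightarrow> real^'d) m \<gamma>.
        orthogonal_transformation Q \<and> Ck_on k UNIV \<gamma> \<and>
        (\<forall>x y. (\<forall>i. i \<noteq> m \<longrightarrow> x $ i = y $ i) \<longrightarrow> \<gamma> x = \<gamma> y) \<and>
        \<Omega> \<inter> ball p r = {x \<in> ball p r. \<gamma> (Q x) < Q x $ m})"


section \<open>\<open>L\<^sup>2\<close> and Sobolev spaces\<close>

text \<open>Elements of these spaces are represented by functions; equality is equality a.e. on \<open>\<Omega>\<close>.\<close>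

definition L2_space :: "(real^'d::finite) set \<Rightarrow> (real^'d \<Rightarrow> real) set" where
  "L2_space \<Omega> = {f \<in> borel_measurable (lebesgue_on \<Omega>). integrable (lebesgue_on \<Omega>) (\<lambda>x. (f x)\<^sup>2)}"

definition L2_inner :: "(real^'d::finite) set \<Rightarrow> (real^'d \<Rightarrow> real) \<Rightarrow> (real^'d \<Rightarrow> real) \<Rightarrow> real" where
  "L2_inner \<Omega> f g = (LINT x|lebesgue_on \<Omega>. f x * g x)"

definition L2_norm :: "(real^'d::finite) set \<Rightarrow> (real^'d \<Rightarrow> real) \<Rightarrow> real" where
  "L2_norm \<Omega> f = sqrt (L2_inner \<Omega> f f)"

definition test_function :: "(real^'d::finite) set \<Rightarrow> (real^'d \<Rightarrow> real) \<Rightarrow> bool" where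
  "test_function \<Omega> \<eta> \<longleftrightarrow>
     (\<forall>k. Ck_on k UNIV \<eta>) \<and> compact (closure {x. \<eta> x \<noteq> 0}) \<and> closure {x. \<eta> x \<noteq> 0} \<subseteq> \<Omega>"

definition has_weak_partial ::
  "(real^'d::finite) set \<Rightarrow> 'd \<Rightarrow> (real^'d \<Rightarrow> real) \<Rightarrow> (real^'d \<Rightarrow> real) \<Rightarrow> bool" where
  "has_weak_partial \<Omega> i f g \<longleftrightarrow>
     f \<in> L2_space \<Omega> \<and> g \<in> L2_space \<Omega> \<and>
     (\<forall>\<eta>. test_function \<Omega> \<eta> \<longrightarrow> L2_inner \<Omega> f (partial_deriv i \<eta>) = - L2_inner \<Omega> g \<eta>)"

text \<open>A representative; for open \<open>\<Omega>\<close> it is unique a.e. on \<open>\<Omega>\<close>.\<close>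

definition weak_partial :: "(real^'d::finite) set \<Rightarrow> 'd \<Rightarrow> (real^'d \<Rightarrow> real) \<Rightarrow> real^'d \<Rightarrow> real" where
  "weak_partial \<Omega> i f = (SOME g. has_weak_partial \<Omega> i f g)"

text \<open>\<open>H_space k \<Omega>\<close> is the Sobolev space \<open>H\<^sup>k(\<Omega>)\<close>.\<close>

primrec H_space :: "nat \<Rightarrow> (real^'d::finite) set \<Rightarrow> (real^'d \<Rightarrow> real) set" where
  "H_space 0 \<Omega> = L2_space \<Omega>"
| "H_space (Suc k) \<Omega> = {f \<in> L2_space \<Omega>. \<forall>i. \<exists>g \<in> H_space k \<Omega>. has_weak_partial \<Omega> i f g}"

text \<open>The closure of the test functions in \<open>H\<^sup>1(\<Omega>)\<close>.\<close>

definition H1_0 :: "(real^'d::finite) set \<Rightarrow> (real^'d \<Rightarrow> real) set" where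
  "H1_0 \<Omega> = {f \<in> H_space 1 \<Omega>. \<exists>\<eta> :: nat \<Rightarrow> real^'d \<Rightarrow> real.
      (\<forall>k. test_function \<Omega> (\<eta> k)) \<and>
      (\<lambda>k. L2_norm \<Omega> (\<lambda>x. \<eta> k x - f x)) \<longlonglongrightarrow> 0 \<and>
      (\<forall>i. (\<lambda>k. L2_norm \<Omega> (\<lambda>x. partial_deriv i (\<eta> k) x - weak_partial \<Omega> i f x)) \<longlonglongrightarrow> 0)}"


section \<open>The elliptic operator and its eigensystem\<close>

definition symmetric_uniformly_elliptic ::
  "(real^'d::finite) set \<Rightarrow> ('d \<Rightarrow> 'd \<Rightarrow> real^'d \<Rightarrow> real) \<Rightarrow> bool" where
  "symmetric_uniformly_elliptic \<Omega> A \<longleftrightarrow>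
     (\<forall>i j. \<forall>x\<in>\<Omega>. A i j x = A j i x) \<and>
     (\<exists>\<theta>>0. \<forall>x\<in>\<Omega>. \<forall>\<xi> :: real^'d. \<theta> * (norm \<xi>)\<^sup>2 \<le> (\<Sum>i\<in>UNIV. \<Sum>j\<in>UNIV. A i j x * \<xi> $ i * \<xi> $ j))"

text \<open>\<open>elliptic_op\<close> is \<open>\<L>\<close>, for arguments in \<open>H\<^sup>2(\<Omega>)\<close> and coefficients in \<open>C\<^sup>1\<close> up to the boundary.\<close>

definition elliptic_op ::
  "(real^'d::finite) set \<Rightarrow> ('d \<Rightarrow> 'd \<Rightarrow> real^'d \<Rightarrow> real) \<Rightarrow> (real^'d \<Rightarrow> real) \<Rightarrow>
   (real^'d \<Rightarrow> real) \<Rightarrow> real^'d \<Rightarrow> real" where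
  "elliptic_op \<Omega> A c u x =
     (\<Sum>i\<in>UNIV. \<Sum>j\<in>UNIV. weak_partial \<Omega> j (\<lambda>y. A i j y * weak_partial \<Omega> i u y) x) - c x * u x"

text \<open>
  The pairing \<open>(\<L>u, \<psi>)\<close> for \<open>u\<close> in \<open>H\<^sup>1\<close> and \<open>\<psi>\<close> in \<open>H\<^sup>1\<^sub>0\<close>. For \<open>u\<close> in \<open>H\<^sup>2\<close> it is the
  \<open>L\<^sup>2\<close> inner product of \<open>elliptic_op \<Omega> A c u\<close> and \<open>\<psi>\<close>; for a \<open>u\<close> that is only in \<open>H\<^sup>1\<close>, \<open>\<L>u\<close> is a
  distribution and the pairing is given by the bilinear form.
\<close>

definition elliptic_pairing ::
  "(real^'d::finite) set \<Rightarrow> ('d \<Rightarrow> 'd \<Rightarrow> real^'d \<Rightarrow> real) \<Rightarrow> (real^'d \<Rightarrow> real) \<Rightarrow>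
   (real^'d \<Rightarrow> real) \<Rightarrow> (real^'d \<Rightarrow> real) \<Rightarrow> real" where
  "elliptic_pairing \<Omega> A c u \<psi> =
     - (LINT x|lebesgue_on \<Omega>.
          (\<Sum>i\<in>UNIV. \<Sum>j\<in>UNIV. A i j x * weak_partial \<Omega> i u x * weak_partial \<Omega> j \<psi> x) + c x * u x * \<psi> x)"

definition L2_sums :: "(real^'d::finite) set \<Rightarrow> (nat \<Rightarrow> real^'d \<Rightarrow> real) \<Rightarrow> (real^'d \<Rightarrow> real) \<Rightarrow> bool" where
  "L2_sums \<Omega> g f \<longleftrightarrow> (\<lambda>N. L2_norm \<Omega> (\<lambda>x. f x - (\<Sum>n=1..N. g n x))) \<longlonglongrightarrow> 0"

definition L2_orthonormal_basis :: "(real^'d::finite) set \<Rightarrow> (nat \<Rightarrow> real^'d \<Rightarrow> real) \<Rightarrow> bool" where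
  "L2_orthonormal_basis \<Omega> \<phi> \<longleftrightarrow>
     (\<forall>n\<ge>1. \<phi> n \<in> L2_space \<Omega>) \<and>
     (\<forall>n\<ge>1. \<forall>m\<ge>1. L2_inner \<Omega> (\<phi> n) (\<phi> m) = (if n = m then 1 else 0)) \<and>
     (\<forall>f\<in>L2_space \<Omega>. L2_sums \<Omega> (\<lambda>n x. L2_inner \<Omega> f (\<phi> n) * \<phi> n x) f)"

text \<open>Indices start at \<open>1\<close>; the values of \<open>lam\<close> and \<open>\<phi>\<close> at \<open>0\<close> are irrelevant.\<close>

definition eigensystem ::
  "(real^'d::finite) set \<Rightarrow> ('d \<Rightarrow> 'd \<Rightarrow> real^'d \<Rightarrow> real) \<Rightarrow> (real^'d \<Rightarrow> real) \<Rightarrow>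
   (nat \<Rightarrow> real) \<Rightarrow> (nat \<Rightarrow> real^'d \<Rightarrow> real) \<Rightarrow> bool" where
  "eigensystem \<Omega> A c lam \<phi> \<longleftrightarrow>
     0 < lam 1 \<and> (\<forall>n\<ge>1. lam n \<le> lam (Suc n)) \<and> filterlim lam at_top sequentially \<and>
     (\<forall>n\<ge>1. \<phi> n \<in> H_space 2 \<Omega> \<inter> H1_0 \<Omega>) \<and>
     (\<forall>n\<ge>1. AE x in lebesgue_on \<Omega>. - elliptic_op \<Omega> A c (\<phi> n) x = lam n * \<phi> n x) \<and>
     L2_orthonormal_basis \<Omega> \<phi>"


section \<open>Weak solutions\<close>

definition continuous_into_L2 ::
  "real \<Rightarrow> (real^'d::finite) set \<Rightarrow> (real \<Rightarrow> real^'d \<Rightarrow> real) \<Rightarrow> bool" where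
  "continuous_into_L2 T \<Omega> F \<longleftrightarrow>
     (\<forall>t\<in>{0..T}. F t \<in> L2_space \<Omega> \<and>
        ((\<lambda>s. L2_norm \<Omega> (\<lambda>x. F s x - F t x)) \<longlongrightarrow> 0) (at t within {0..T}))"

text \<open>
  \<open>u t x\<close> is the value at time \<open>t\<close> and position \<open>x\<close>. Since the test function does not depend on time,
  \<open>(\<^sup>CD\<^sub>t\<^sup>\<alpha> u(t), \<psi>)\<close> is the Caputo derivative of \<open>t \<mapsto> (u(t), \<psi>)\<close>. For a merely continuous source
  neither \<open>\<^sup>CD\<^sub>t\<^sup>\<alpha> u(t)\<close> nor \<open>\<L>u(t)\<close> need be in \<open>L\<^sup>2(\<Omega>)\<close> for every \<open>t\<close>, so both terms are
  read as pairings.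
\<close>

definition weak_solution ::
  "real \<Rightarrow> real \<Rightarrow> (real^'d::finite) set \<Rightarrow> ('d \<Rightarrow> 'd \<Rightarrow> real^'d \<Rightarrow> real) \<Rightarrow> (real^'d \<Rightarrow> real) \<Rightarrow>
   (real \<Rightarrow> real) \<Rightarrow> (real \<Rightarrow> real^'d \<Rightarrow> real) \<Rightarrow> (real^'d \<Rightarrow> real) \<Rightarrow> (real \<Rightarrow> real^'d \<Rightarrow> real) \<Rightarrow> bool" where
  "weak_solution \<alpha> T \<Omega> A c a F u0 u \<longleftrightarrow>
     u 0 \<in> L2_space \<Omega> \<and> (\<forall>t\<in>{0<..T}. u t \<in> H1_0 \<Omega>) \<and>
     (\<forall>\<psi> \<in> H_space 2 \<Omega> \<inter> H1_0 \<Omega>.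
        (\<exists>D. has_caputo_deriv \<alpha> T (\<lambda>t. L2_inner \<Omega> (u t) \<psi>) D {0<..T} \<and>
             (\<forall>t\<in>{0<..T}. D t - a t * elliptic_pairing \<Omega> A c (u t) \<psi> = L2_inner \<Omega> (F t) \<psi>)) \<and>
        L2_inner \<Omega> (u 0) \<psi> = L2_inner \<Omega> u0 \<psi>)"

end

theory Submission
  imports Defs
begin

text \<open>
  In the eigenbasis the problem decouples into the fractional ODEs for the \<open>u\<^sub>n\<close>, and these are equivalent
  to the Volterra equations \<open>u\<^sub>n = b\<^sub>n + I\<^sup>\<alpha>(F\<^sub>n - \<lambda>\<^sub>n a u\<^sub>n)\<close>, which have a unique continuous solution
  (Picard iteration in an exponentially weighted norm). No Mittag-Leffler function is needed: Alikhanov's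
  inequality \<open>\<partial>\<^sup>\<alpha>(u\<^sup>2) \<le> 2 u \<partial>\<^sup>\<alpha>u\<close>, Young's inequality and \<open>a \<ge> q > 0\<close> give
  \<open>\<lambda>\<^sub>n u\<^sub>n\<^sup>2 \<le> \<lambda>\<^sub>n b\<^sub>n\<^sup>2 + I\<^sup>\<alpha>(F\<^sub>n\<^sup>2) / (2 q)\<close>. Summed over \<open>n\<close> and combined with the Garding inequality,
  this bounds the partial sums of \<open>\<Sum>u\<^sub>n(t) \<phi>\<^sub>n\<close> in \<open>H\<^sup>1\<close>, uniformly in \<open>t\<close>, so that they converge in \<open>H\<^sup>1\<^sub>0\<close>.

  Testing with \<open>\<psi>\<close> in \<open>H\<^sup>2 \<inter> H\<^sup>1\<^sub>0\<close> and using \<open>(\<L>u, \<psi>) = (u, \<L>\<psi>)\<close>, the Volterra equations sum to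
  \<open>(u, \<psi>) = (u\<^sub>0, \<psi>) + I\<^sup>\<alpha>(a (u, \<L>\<psi>) + (F, \<psi>))\<close> with uniform convergence in time, which is the weak
  formulation. Conversely, testing a weak solution with \<open>\<phi>\<^sub>n\<close> shows that its coefficients solve the
  fractional ODEs, whence uniqueness.
\<close>

section \<open>Fractional integrals\<close>

text \<open>The u_n have a continuous Caputo derivative but may be nowhere differentiable, so
  Alikhanov's inequality, whose proof integrates by parts against the ordinary derivative, cannot be
  applied to them directly. It is proved for I^\<alpha> of a polynomial, a finite sum of powers s^(i
  + \<alpha>) and hence smooth away from 0, then integrated and carried to continuous densities by
  uniform convergence; the integrated form contains no derivative that the limit could destroy.
  Garding's inequality enters because \<open>c\<close> may be negative: the form controls the
  gradient only up to a multiple of the squared L2 norm, and \<open>lam 1 > 0\<close> absorbs that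
  multiple on eigenfunction sums. When the weak formulation is summed, no continuity of u in time is
  known yet. Convergence is uniform in t because Parseval's remainder is a bound on
  \<open>u t\<close> or \<open>F t\<close> times a tail of the fixed functions \<open>\<psi>\<close>
  and \<open>\<L> \<psi>\<close>. Moving \<open>\<L>\<close> onto \<open>\<psi>\<close> requires
  weak derivatives of \<open>A i j\<close> times a derivative of \<open>\<psi>\<close>, with
  \<open>A i j\<close> only C^2; this is where mollification enters.\<close>

text \<open>Carries closed forms of gauge integrals (Beta, Gamma) over to \<open>lborel\<close>, the
  setting of \<open>frac_int\<close>: nonnegativity makes gauge integrability absolute.\<close>

lemma lborel_of_nonneg_has_integral:
  fixes f :: "real \<Rightarrow> real"
  assumes [measurable]: "f \<in> borel_measurable borel" and f: "(f has_integral I) {a..b}"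
    and nn: "\<And>s. s \<in> {a..b} \<Longrightarrow> 0 \<le> f s"
  shows "set_integrable lborel {a..b} f" and "(LBINT s:{a..b}. f s) = I"
proof -
  have "f absolutely_integrable_on {a..b}"
    using f nn by (intro nonnegative_absolutely_integrable_1) (auto simp: integrable_on_def)
  then show 1: "set_integrable lborel {a..b} f"
    unfolding set_integrable_def by (subst (asm) integrable_completion) auto
  show "(LBINT s:{a..b}. f s) = I"
    using set_borel_integral_eq_integral(2)[OF 1] f by auto
qed

text \<open>The Beta integral under the substitution s = t x.\<close>

lemma has_integral_powr_convolution:
  fixes a b t :: real
  assumes a: "0 < a" and b: "0 < b" and t: "0 < t"
  shows "((\<lambda>s. (t - s) powr (a - 1) * s powr (b - 1)) has_integral t powr (a + b - 1) * Beta a b) {0..t}"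
proof -
  have "((\<lambda>x. ((1/t) *\<^sub>R x + 0) powr (b - 1) * (1 - ((1/t) *\<^sub>R x + 0)) powr (a - 1)) has_integral
      (1 / (\<bar>1/t\<bar> ^ DIM(real))) *\<^sub>R Beta b a) ((\<lambda>x. (1 / (1/t)) *\<^sub>R x + -((1 / (1/t)) *\<^sub>R 0)) ` cbox 0 1)"
    using has_integral_Beta_real[OF b a] t
    by (intro has_integral_affinity[where f = "\<lambda>x. x powr (b - 1) * (1 - x) powr (a - 1)"]) auto
  moreover have "(*) t ` {0..1} = {0..t}"
    using image_mult_atLeastAtMost[of t 0 1] t by simp
  ultimately have "((\<lambda>x. (x / t) powr (b - 1) * (1 - x / t) powr (a - 1)) has_integral t * Beta b a) {0..t}"
    using t by simp
  \<comment> \<open>This factor undoes the division by t inside the two powers, whose exponents sum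
    to a + b - 2.\<close>
  then have "((\<lambda>x. t powr (a + b - 2) * ((x / t) powr (b - 1) * (1 - x / t) powr (a - 1)))
      has_integral t powr (a + b - 2) * (t * Beta b a)) {0..t}"
    by (rule has_integral_mult_right)
  moreover have "t powr (a + b - 2) * (t * Beta b a) = t powr (a + b - 1) * Beta a b"
    using t by (simp add: Beta_commute powr_diff powr_add power2_eq_square field_simps)
  ultimately have *: "((\<lambda>x. t powr (a + b - 2) * ((x / t) powr (b - 1) * (1 - x / t) powr (a - 1)))
      has_integral t powr (a + b - 1) * Beta a b) {0..t}" by simp
  show ?thesis
  proof (rule has_integral_eq[OF _ *])
    fix x assume x: "x \<in> {0..t}"
    have "1 - x / t = (t - x) / t" using t by (simp add: field_simps)
    then have "(x / t) powr (b - 1) * (1 - x / t) powr (a - 1) =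
        x powr (b - 1) / t powr (b - 1) * ((t - x) powr (a - 1) / t powr (a - 1))"
      using x t by (simp add: powr_divide)
    moreover have "t powr (a + b - 2) = t powr (b - 1) * t powr (a - 1)"
      by (simp add: powr_add[symmetric] add.commute)
    ultimately show "t powr (a + b - 2) * ((x / t) powr (b - 1) * (1 - x / t) powr (a - 1)) =
        (t - x) powr (a - 1) * x powr (b - 1)"
      using t by simp
  qed
qed

section \<open>Riemann-Liouville integrals: linearity, monotonicity, bounds\<close>

text \<open>The Riemann-Liouville integral I^\<alpha>. Its order is not confined to (0,1): order 1
  is the ordinary integral, and orders add up in \<open>frac_int_semigroup\<close>.\<close>

definition frac_int :: "real \<Rightarrow> (real \<Rightarrow> real) \<Rightarrow> real \<Rightarrow> real" where
  "frac_int \<alpha> g t = 1 / Gamma \<alpha> * (LBINT s:{0..t}. (t - s) powr (\<alpha> - 1) * g s)"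

lemma caputo_potential_eq_frac_int: "caputo_potential \<alpha> f t = frac_int (1 - \<alpha>) (\<lambda>s. f s - f 0) t"
  by (simp add: caputo_potential_def frac_int_def)

lemma frac_int_0 [simp]: "frac_int \<alpha> g 0 = 0"
proof -
  have "(LBINT s:{0..0}. (0 - s) powr (\<alpha> - 1) * g s) = (LBINT s:{0..0::real}. 0)"
    by (intro set_lebesgue_integral_cong) auto
  then show ?thesis by (simp add: frac_int_def)
qed

text \<open>The point s = 0 is left out as a null set. This matters because \<open>s powr 0\<close>
  and derivatives of fractional integrals obey their intended formulas only for s > 0.\<close>

lemma frac_int_cong:
  assumes "\<And>s. 0 < s \<Longrightarrow> s \<le> t \<Longrightarrow> f s = g s"
  shows "frac_int \<alpha> f t = frac_int \<alpha> g t"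
proof -
  have "(LBINT s:{0..t}. (t - s) powr (\<alpha> - 1) * f s) = (LBINT s:{0..t}. (t - s) powr (\<alpha> - 1) * g s)"
    unfolding set_lebesgue_integral_def
    by (rule integral_discrete_difference[where X = "{0}"]) (use assms in \<open>auto simp: indicator_def\<close>)
  then show ?thesis by (simp add: frac_int_def)
qed

text \<open>The power rule of fractional calculus, from the Beta integral. Exponents between -1 and
  0 are included because the derivative of I^\<alpha> of a polynomial can behave like s^(\<alpha> -
  1) at 0.\<close>

lemma set_integrable_frac_kernel_powr:
  fixes \<alpha> \<gamma> t :: real
  assumes "0 < \<alpha>" "-1 < \<gamma>" "0 < t"
  shows "set_integrable lborel {0..t} (\<lambda>s. (t - s) powr (\<alpha> - 1) * s powr \<gamma>)"
    and "frac_int \<alpha> (\<lambda>s. s powr \<gamma>) t = Gamma (\<gamma> + 1) / Gamma (\<gamma> + 1 + \<alpha>) * t powr (\<gamma> + \<alpha>)"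
proof -
  have *: "((\<lambda>s. (t - s) powr (\<alpha> - 1) * s powr \<gamma>) has_integral t powr (\<alpha> + \<gamma>) * Beta \<alpha> (\<gamma> + 1)) {0..t}"
    using has_integral_powr_convolution[of \<alpha> "\<gamma> + 1" t] assms by (simp add: add.assoc)
  note L = lborel_of_nonneg_has_integral[OF _ *]
  show "set_integrable lborel {0..t} (\<lambda>s. (t - s) powr (\<alpha> - 1) * s powr \<gamma>)"
    by (rule L) auto
  have "(LBINT s:{0..t}. (t - s) powr (\<alpha> - 1) * s powr \<gamma>) = t powr (\<alpha> + \<gamma>) * Beta \<alpha> (\<gamma> + 1)"
    by (rule L) auto
  moreover have "Gamma \<alpha> \<noteq> 0"
    using Gamma_real_pos[OF assms(1)] by simp
  ultimately show "frac_int \<alpha> (\<lambda>s. s powr \<gamma>) t = Gamma (\<gamma> + 1) / Gamma (\<gamma> + 1 + \<alpha>) * t powr (\<gamma> + \<alpha>)"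
    by (simp add: frac_int_def Beta_def field_simps add_ac)
qed

lemma set_integrable_frac_kernel:
  fixes \<alpha> t :: real
  assumes "0 < \<alpha>"
  shows "set_integrable lborel {0..t} (\<lambda>s. (t - s) powr (\<alpha> - 1))"
proof (cases "0 < t")
  case True
  \<comment> \<open>In HOL \<open>s powr 0\<close> is 1 except at s = 0, where it is 0.\<close>
  have "set_integrable lborel {0..t} (\<lambda>s. (t - s) powr (\<alpha> - 1) * s powr 0)"
    using set_integrable_frac_kernel_powr(1)[of \<alpha> 0 t] assms True by simp
  then show ?thesis
    unfolding set_integrable_def
    by (rule iffD1[OF integrable_discrete_difference[where X = "{0}"], rotated -1]) auto
next
  case False
  have "integrable lborel (\<lambda>s. indicator {0..t} s *\<^sub>R (t - s) powr (\<alpha> - 1)) \<longleftrightarrow> integrable lborel (\<lambda>s::real. 0::real)"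
    by (rule integrable_discrete_difference[where X = "{0}"]) (use False in \<open>auto simp: indicator_def\<close>)
  then show ?thesis by (simp add: set_integrable_def)
qed

text \<open>A non-integrable integrand has Bochner integral 0, so additivity and monotonicity carry
  this side condition. Continuity could not take its place: derivatives that blow up at 0 are
  integrated too.\<close>

definition frac_integrable :: "real \<Rightarrow> (real \<Rightarrow> real) \<Rightarrow> real \<Rightarrow> bool" where
  "frac_integrable \<alpha> g t \<longleftrightarrow> set_integrable lborel {0..t} (\<lambda>s. (t - s) powr (\<alpha> - 1) * g s)"

lemma frac_integrable_continuous:
  fixes \<alpha> t :: real
  assumes "0 < \<alpha>" and g: "continuous_on {0..t} g"
  shows "frac_integrable \<alpha> g t"
proof -
  obtain B where "\<forall>y\<in>g ` {0..t}. norm y \<le> B"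
    using compact_imp_bounded[OF compact_continuous_image[OF g compact_Icc]] unfolding bounded_iff by auto
  then have B: "\<bar>g s\<bar> \<le> B" if "s \<in> {0..t}" for s
    using that by auto
  have m: "set_borel_measurable lborel {0..t} g"
    using borel_measurable_continuous_on_indicator[OF _ g] by (simp add: set_borel_measurable_def)
  have m': "set_borel_measurable lborel {0..t} (\<lambda>s. (t - s) powr (\<alpha> - 1) * g s)"
  proof -
    have "(\<lambda>s. (t - s) powr (\<alpha> - 1) * (indicator {0..t} s *\<^sub>R g s)) \<in> borel_measurable lborel"
      using m unfolding set_borel_measurable_def by (intro borel_measurable_times) auto
    then show ?thesis
      unfolding set_borel_measurable_def by (simp add: mult_ac)
  qed
  show ?thesis
    unfolding frac_integrable_def
  proof (rule set_integrable_bound[of _ _ "\<lambda>s. B * (t - s) powr (\<alpha> - 1)", OF _ m'])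
    show "set_integrable lborel {0..t} (\<lambda>s. B * (t - s) powr (\<alpha> - 1))"
      using set_integrable_frac_kernel[OF assms(1)] by simp
    show "AE s in lborel. s \<in> {0..t} \<longrightarrow> norm ((t - s) powr (\<alpha> - 1) * g s) \<le> norm (B * (t - s) powr (\<alpha> - 1))"
    proof (intro AE_I2 impI)
      fix s assume s: "s \<in> {0..t}"
      show "norm ((t - s) powr (\<alpha> - 1) * g s) \<le> norm (B * (t - s) powr (\<alpha> - 1))"
        using order_trans[OF B[OF s] abs_ge_self[of B]] by (simp add: abs_mult mult.commute mult_right_mono)
    qed
  qed
qed

lemma frac_integrable_powr:
  assumes "0 < \<alpha>" "-1 < \<gamma>" "0 < t"
  shows "frac_integrable \<alpha> (\<lambda>s. s powr \<gamma>) t"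
  using set_integrable_frac_kernel_powr(1)[OF assms] by (simp add: frac_integrable_def)

lemma frac_integrable_cong:
  assumes "\<And>s. 0 < s \<Longrightarrow> s \<le> t \<Longrightarrow> f s = g s"
  shows "frac_integrable \<alpha> f t = frac_integrable \<alpha> g t"
  unfolding frac_integrable_def set_integrable_def
  by (rule integrable_discrete_difference[where X = "{0}"]) (use assms in \<open>auto simp: indicator_def\<close>)

lemma frac_integrable_cmult:
  "frac_integrable \<alpha> f t \<Longrightarrow> frac_integrable \<alpha> (\<lambda>s. c * f s) t"
  using set_integrable_mult_right[of c lborel "{0..t}" "\<lambda>s. (t - s) powr (\<alpha> - 1) * f s"]
  by (simp add: frac_integrable_def mult.left_commute)

lemma frac_int_cmult: "frac_int \<alpha> (\<lambda>s. c * f s) t = c * frac_int \<alpha> f t"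
  by (simp add: frac_int_def mult.left_commute)

lemma frac_integrable_add:
  assumes "frac_integrable \<alpha> f t" "frac_integrable \<alpha> g t"
  shows "frac_integrable \<alpha> (\<lambda>s. f s + g s) t"
  using set_integral_add(1)[OF assms[unfolded frac_integrable_def]]
  by (simp add: frac_integrable_def distrib_left)

lemma frac_int_add:
  assumes "frac_integrable \<alpha> f t" "frac_integrable \<alpha> g t"
  shows "frac_int \<alpha> (\<lambda>s. f s + g s) t = frac_int \<alpha> f t + frac_int \<alpha> g t"
  using set_integral_add(2)[OF assms[unfolded frac_integrable_def]]
  by (simp add: frac_int_def distrib_left add_divide_distrib)

lemma frac_integrable_diff:
  assumes "frac_integrable \<alpha> f t" "frac_integrable \<alpha> g t"
  shows "frac_integrable \<alpha> (\<lambda>s. f s - g s) t"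
  using frac_integrable_add[OF assms(1) frac_integrable_cmult[OF assms(2), of "-1"]] by simp

lemma frac_int_diff:
  assumes "frac_integrable \<alpha> f t" "frac_integrable \<alpha> g t"
  shows "frac_int \<alpha> (\<lambda>s. f s - g s) t = frac_int \<alpha> f t - frac_int \<alpha> g t"
  using frac_int_add[OF assms(1) frac_integrable_cmult[OF assms(2), of "-1"]] frac_int_cmult[of \<alpha> "-1" g t]
  by simp

lemma frac_int_sum:
  assumes "finite I" "\<And>i. i \<in> I \<Longrightarrow> frac_integrable \<alpha> (f i) t"
  shows "frac_integrable \<alpha> (\<lambda>s. \<Sum>i\<in>I. f i s) t \<and>
    frac_int \<alpha> (\<lambda>s. \<Sum>i\<in>I. f i s) t = (\<Sum>i\<in>I. frac_int \<alpha> (f i) t)"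
  using assms
proof (induction I)
  case empty
  then show ?case by (simp add: frac_integrable_def frac_int_def set_integrable_def)
qed (simp add: frac_integrable_add frac_int_add)

lemma frac_int_mono:
  assumes "0 < \<alpha>" "frac_integrable \<alpha> f t" "frac_integrable \<alpha> g t"
    and le: "\<And>s. 0 < s \<Longrightarrow> s \<le> t \<Longrightarrow> f s \<le> g s"
  shows "frac_int \<alpha> f t \<le> frac_int \<alpha> g t"
proof -
  have "(LBINT s:{0..t}. (t - s) powr (\<alpha> - 1) * f s) \<le> (LBINT s:{0..t}. (t - s) powr (\<alpha> - 1) * g s)"
  proof (rule set_integral_mono_AE[OF assms(2,3)[unfolded frac_integrable_def]])
    have "AE s in lborel. s \<noteq> (0::real)"
      by (rule AE_lborel_singleton)
    then show "AE s\<in>{0..t} in lborel. (t - s) powr (\<alpha> - 1) * f s \<le> (t - s) powr (\<alpha> - 1) * g s"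
      by eventually_elim (use le in \<open>auto intro!: mult_left_mono\<close>)
  qed
  then show ?thesis
    using Gamma_real_pos[OF assms(1)] by (simp add: frac_int_def divide_right_mono)
qed

lemma frac_int_const:
  assumes "0 < \<alpha>" "0 \<le> t"
  shows "frac_int \<alpha> (\<lambda>s. c) t = c * t powr \<alpha> / Gamma (\<alpha> + 1)"
proof (cases "t = 0")
  case False
  have "frac_int \<alpha> (\<lambda>s. c) t = c * frac_int \<alpha> (\<lambda>s. s powr 0) t"
    by (subst frac_int_cmult[symmetric], rule frac_int_cong) auto
  then show ?thesis
    using set_integrable_frac_kernel_powr(2)[of \<alpha> 0 t] False assms by (simp add: add.commute)
qed simp

text \<open>Comparison with the constants B and -B. The bound does not depend on t, so uniform
  limits pass through I^\<alpha>.\<close>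

lemma frac_int_abs_le:
  assumes \<alpha>: "0 < \<alpha>" and t: "t \<in> {0..T}" and g: "continuous_on {0..T} g"
    and B: "\<And>s. s \<in> {0..T} \<Longrightarrow> \<bar>g s\<bar> \<le> B"
  shows "\<bar>frac_int \<alpha> g t\<bar> \<le> B * (T powr \<alpha> / Gamma (\<alpha> + 1))"
proof -
  have gt: "continuous_on {0..t} g"
    by (rule continuous_on_subset[OF g]) (use t in auto)
  note int = frac_integrable_continuous[OF \<alpha> continuous_on_const] frac_integrable_continuous[OF \<alpha> gt]
  have "frac_int \<alpha> g t \<le> frac_int \<alpha> (\<lambda>s. B) t"
    using B t by (intro frac_int_mono \<alpha> int) (auto simp: abs_le_iff)
  moreover have "frac_int \<alpha> (\<lambda>s. - B) t \<le> frac_int \<alpha> g t"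
  proof (intro frac_int_mono \<alpha> int)
    fix s assume "0 < s" "s \<le> t"
    then have "\<bar>g s\<bar> \<le> B" using t by (intro B) auto
    then show "- B \<le> g s" by simp
  qed
  moreover have "0 \<le> B"
    using B[OF t] by linarith
  then have "B * t powr \<alpha> / Gamma (\<alpha> + 1) \<le> B * T powr \<alpha> / Gamma (\<alpha> + 1)"
    using t \<alpha> Gamma_real_pos[of "\<alpha> + 1"] by (intro divide_right_mono mult_left_mono powr_mono2) auto
  ultimately show ?thesis
    using t by (simp add: frac_int_const[OF \<alpha>] abs_le_iff)
qed

lemma frac_int_diff_abs_le:
  assumes \<alpha>: "0 < \<alpha>" and t: "t \<in> {0..T}" and f: "continuous_on {0..T} f" and g: "continuous_on {0..T} g"
    and B: "\<And>s. s \<in> {0..T} \<Longrightarrow> \<bar>f s - g s\<bar> \<le> B"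
  shows "\<bar>frac_int \<alpha> f t - frac_int \<alpha> g t\<bar> \<le> B * (T powr \<alpha> / Gamma (\<alpha> + 1))"
proof -
  have "frac_integrable \<alpha> f t" "frac_integrable \<alpha> g t"
    by (intro frac_integrable_continuous \<alpha> continuous_on_subset[OF f] continuous_on_subset[OF g], use t in auto)+
  then show ?thesis
    using frac_int_abs_le[OF \<alpha> t continuous_on_diff[OF f g] B] by (simp add: frac_int_diff)
qed

lemma uniform_limit_frac_int:
  assumes \<alpha>: "0 < \<alpha>" and f: "\<And>k. continuous_on {0..T} (f k)" and g: "continuous_on {0..T} g"
    and lim: "uniform_limit {0..T} f g sequentially"
  shows "uniform_limit {0..T} (\<lambda>k. frac_int \<alpha> (f k)) (frac_int \<alpha> g) sequentially"
proof (rule uniform_limitI)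
  fix e :: real assume e: "0 < e"
  \<comment> \<open>The summand 1 keeps K positive even if \<open>T powr \<alpha>\<close> is 0 and
    makes the final estimate strict.\<close>
  define K where "K = T powr \<alpha> / Gamma (\<alpha> + 1) + 1"
  have K: "0 < K"
    using Gamma_real_pos[of "\<alpha> + 1"] \<alpha> by (auto simp: K_def intro!: add_nonneg_pos)
  have "\<forall>\<^sub>F k in sequentially. \<forall>s\<in>{0..T}. dist (f k s) (g s) < e / K"
    using uniform_limitD[OF lim, of "e / K"] e K by simp
  then show "\<forall>\<^sub>F k in sequentially. \<forall>t\<in>{0..T}. dist (frac_int \<alpha> (f k) t) (frac_int \<alpha> g t) < e"
  proof eventually_elim
    case (elim k)
    show ?case
    proof
      fix t assume t: "t \<in> {0..T}"
      have "\<bar>frac_int \<alpha> (f k) t - frac_int \<alpha> g t\<bar> \<le> e / K * (T powr \<alpha> / Gamma (\<alpha> + 1))"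
        using elim by (intro frac_int_diff_abs_le \<alpha> t f g) (auto simp: dist_real_def less_imp_le)
      also have "\<dots> < e / K * K"
        unfolding K_def[symmetric] using e K by (intro mult_strict_left_mono) (auto simp: K_def)
      finally show "dist (frac_int \<alpha> (f k) t) (frac_int \<alpha> g t) < e"
        using K by (simp add: dist_real_def)
    qed
  qed
qed

text \<open>
  Identities and inequalities for \<open>frac_int\<close> of continuous functions are verified on polynomials, where they reduce to
  Beta integrals, and extended by uniform approximation.
\<close>

lemma polynomial_uniform_limit:
  fixes g :: "real \<Rightarrow> real"
  assumes "continuous_on {0..T} g"
  obtains a N where "uniform_limit {0..T} (\<lambda>k x. \<Sum>i\<le>N k. a k i * x ^ i) g sequentially"
proof -
  have "\<exists>a n. \<forall>x\<in>{0..T}. \<bar>g x - (\<Sum>i\<le>n. a i * x ^ i)\<bar> < inverse (Suc k)" for k :: nat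
  proof -
    obtain p where p: "real_polynomial_function p" "\<And>x. x \<in> {0..T} \<Longrightarrow> \<bar>g x - p x\<bar> < inverse (Suc k)"
      using Stone_Weierstrass_real_polynomial_function[OF compact_Icc assms, of "inverse (Suc k)"] by auto
    obtain a n where "p = (\<lambda>x. \<Sum>i\<le>n. a i * x ^ i)"
      using p(1) by (auto simp: real_polynomial_function_iff_sum)
    with p(2) show ?thesis by blast
  qed
  then obtain a N where aN: "\<And>k x. x \<in> {0..T} \<Longrightarrow> \<bar>g x - (\<Sum>i\<le>N k. a k i * x ^ i)\<bar> < inverse (Suc k)"
    by metis
  have "uniform_limit {0..T} (\<lambda>k x. \<Sum>i\<le>N k. a k i * x ^ i) g sequentially"
  proof (rule uniform_limitI)
    fix e :: real assume "0 < e"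
    then have "\<forall>\<^sub>F k in sequentially. inverse (real (Suc k)) < e"
      using LIMSEQ_inverse_real_of_nat by (rule order_tendstoD(2)[rotated])
    then show "\<forall>\<^sub>F k in sequentially. \<forall>x\<in>{0..T}. dist (\<Sum>i\<le>N k. a k i * x ^ i) (g x) < e"
      by eventually_elim (auto simp: dist_real_def abs_minus_commute intro: order.strict_trans[OF aN])
  qed
  then show ?thesis by (rule that)
qed

lemma frac_int_power:
  assumes "0 < \<alpha>" "0 \<le> t"
  shows "frac_int \<alpha> (\<lambda>s. s ^ i) t = Gamma (real i + 1) / Gamma (real i + 1 + \<alpha>) * t powr (real i + \<alpha>)"
proof (cases "t = 0")
  case False
  have "frac_int \<alpha> (\<lambda>s. s ^ i) t = frac_int \<alpha> (\<lambda>s. s powr real i) t"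
    by (rule frac_int_cong) (simp add: powr_realpow)
  then show ?thesis
    using set_integrable_frac_kernel_powr(2)[of \<alpha> "real i" t] False assms by simp
qed (use assms in simp)

lemma frac_int_polynomial:
  assumes "0 < \<alpha>" "0 \<le> t"
  shows "frac_int \<alpha> (\<lambda>s. \<Sum>i\<le>n. a i * s ^ i) t =
    (\<Sum>i\<le>n. a i * (Gamma (real i + 1) / Gamma (real i + 1 + \<alpha>)) * t powr (real i + \<alpha>))"
proof -
  have "frac_int \<alpha> (\<lambda>s. \<Sum>i\<le>n. a i * s ^ i) t = (\<Sum>i\<le>n. frac_int \<alpha> (\<lambda>s. a i * s ^ i) t)"
    using assms by (intro conjunct2[OF frac_int_sum] frac_integrable_continuous) (auto intro!: continuous_intros)
  then show ?thesis
    by (simp add: frac_int_cmult frac_int_power[OF assms] mult.assoc)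
qed

section \<open>Continuity and the semigroup law\<close>

text \<open>For a polynomial the fractional integral is an explicit sum of powers with positive
  exponents, hence continuous, and uniform limits preserve this.\<close>

lemma continuous_on_frac_int:
  assumes \<alpha>: "0 < \<alpha>" and g: "continuous_on {0..T} g"
  shows "continuous_on {0..T} (frac_int \<alpha> g)"
proof -
  obtain a N where lim: "uniform_limit {0..T} (\<lambda>k x. \<Sum>i\<le>N k. a k i * x ^ i) g sequentially"
    using polynomial_uniform_limit[OF g] .
  have "uniform_limit {0..T} (\<lambda>k. frac_int \<alpha> (\<lambda>x. \<Sum>i\<le>N k. a k i * x ^ i)) (frac_int \<alpha> g) sequentially"
    by (intro uniform_limit_frac_int \<alpha> g lim continuous_intros)
  then show ?thesis
  proof (rule uniform_limit_theorem[rotated])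
    have "continuous_on {0..T} (frac_int \<alpha> (\<lambda>x. \<Sum>i\<le>N k. a k i * x ^ i))" for k
    proof (rule continuous_on_eq)
      show "continuous_on {0..T} (\<lambda>t. \<Sum>i\<le>N k. a k i * (Gamma (real i + 1) / Gamma (real i + 1 + \<alpha>)) * t powr (real i + \<alpha>))"
        using \<alpha> by (intro continuous_intros continuous_on_powr') auto
    qed (simp add: frac_int_polynomial[OF \<alpha>])
    then show "\<forall>\<^sub>F k in sequentially. continuous_on {0..T} (frac_int \<alpha> (\<lambda>x. \<Sum>i\<le>N k. a k i * x ^ i))"
      by simp
  qed simp
qed

text \<open>On a monomial both sides are the same Gamma quotient times a power: the factor
  \<open>Gamma (real i + 1 + \<alpha>)\<close> left by the inner integral cancels in the outer one.
  This takes the place of Fubini's theorem for the two kernels.\<close>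

lemma frac_int_semigroup:
  assumes \<alpha>: "0 < \<alpha>" and \<beta>: "0 < \<beta>" and g: "continuous_on {0..T} g" and t: "t \<in> {0..T}"
  shows "frac_int \<beta> (frac_int \<alpha> g) t = frac_int (\<alpha> + \<beta>) g t"
proof -
  obtain a N where lim: "uniform_limit {0..T} (\<lambda>k x. \<Sum>i\<le>N k. a k i * x ^ i) g sequentially"
    using polynomial_uniform_limit[OF g] .
  define p where "p = (\<lambda>k x. \<Sum>i\<le>N k. a k i * x ^ i)"
  have p: "continuous_on {0..T} (p k)" for k
    unfolding p_def by (intro continuous_intros)
  have lim: "uniform_limit {0..T} p g sequentially"
    using lim by (simp add: p_def)
  have "uniform_limit {0..T} (\<lambda>k. frac_int \<beta> (frac_int \<alpha> (p k))) (frac_int \<beta> (frac_int \<alpha> g)) sequentially"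
    by (intro uniform_limit_frac_int continuous_on_frac_int \<alpha> \<beta> g p lim)
  then have 1: "(\<lambda>k. frac_int \<beta> (frac_int \<alpha> (p k)) t) \<longlonglongrightarrow> frac_int \<beta> (frac_int \<alpha> g) t"
    using t by (rule tendsto_uniform_limitI)
  have "uniform_limit {0..T} (\<lambda>k. frac_int (\<alpha> + \<beta>) (p k)) (frac_int (\<alpha> + \<beta>) g) sequentially"
    using \<alpha> \<beta> by (intro uniform_limit_frac_int g p lim) simp
  then have 2: "(\<lambda>k. frac_int (\<alpha> + \<beta>) (p k) t) \<longlonglongrightarrow> frac_int (\<alpha> + \<beta>) g t"
    using t by (rule tendsto_uniform_limitI)
  have "frac_int \<beta> (frac_int \<alpha> (p k)) t = frac_int (\<alpha> + \<beta>) (p k) t" for k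
  proof (cases "t = 0")
    case False
    with t have t0: "0 < t" by simp
    let ?c = "\<lambda>i. a k i * (Gamma (real i + 1) / Gamma (real i + 1 + \<alpha>))"
    have "frac_int \<beta> (frac_int \<alpha> (p k)) t = frac_int \<beta> (\<lambda>s. \<Sum>i\<le>N k. ?c i * s powr (real i + \<alpha>)) t"
      unfolding p_def by (rule frac_int_cong) (simp add: frac_int_polynomial[OF \<alpha>])
    also have "\<dots> = (\<Sum>i\<le>N k. frac_int \<beta> (\<lambda>s. ?c i * s powr (real i + \<alpha>)) t)"
      using \<alpha> \<beta> t0 by (intro conjunct2[OF frac_int_sum] frac_integrable_cmult frac_integrable_powr) auto
    also have "\<dots> = (\<Sum>i\<le>N k. a k i * (Gamma (real i + 1) / Gamma (real i + 1 + (\<alpha> + \<beta>))) * t powr (real i + (\<alpha> + \<beta>)))"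
    proof (rule sum.cong)
      fix i
      have "Gamma (1 + (\<alpha> + real i)) \<noteq> 0"
        by (rule less_imp_neq[OF Gamma_real_pos, symmetric]) (use \<alpha> in simp)
      then show "frac_int \<beta> (\<lambda>s. ?c i * s powr (real i + \<alpha>)) t =
          a k i * (Gamma (real i + 1) / Gamma (real i + 1 + (\<alpha> + \<beta>))) * t powr (real i + (\<alpha> + \<beta>))"
        using set_integrable_frac_kernel_powr(2)[of \<beta> "real i + \<alpha>" t] \<alpha> \<beta> t0
        unfolding frac_int_cmult by (simp add: add_ac)
    qed simp
    also have "\<dots> = frac_int (\<alpha> + \<beta>) (p k) t"
      unfolding p_def using \<alpha> \<beta> t0 by (simp add: frac_int_polynomial)
    finally show ?thesis .
  qed simp
  then show ?thesis
    using LIMSEQ_unique[OF 1] 2 by simp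
qed

lemma frac_int_1: "frac_int 1 g t = (LBINT s:{0..t}. g s)"
proof -
  \<comment> \<open>At s = t the kernel is \<open>0 powr 0\<close>, which is 0 in HOL and not
    1.\<close>
  have "(LBINT s:{0..t}. (t - s) powr (1 - 1) * g s) = (LBINT s:{0..t}. g s)"
    unfolding set_lebesgue_integral_def
    by (rule integral_discrete_difference[where X = "{t}"]) (auto simp: indicator_def)
  then show ?thesis by (simp add: frac_int_def)
qed

lemma frac_int_1_has_real_derivative:
  assumes g: "continuous_on {0..T} g" and t: "t \<in> {0..T}"
  shows "(frac_int 1 g has_real_derivative g t) (at t within {0..T})"
proof -
  have "((\<lambda>s. integral {0..s} g) has_real_derivative g t) (at t within {0..T})"
    using integral_has_vector_derivative[OF g t] by (simp add: has_real_derivative_iff_has_vector_derivative)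
  then show ?thesis
  proof (rule has_field_derivative_transform_within[OF _ zero_less_one t])
    fix s assume "s \<in> {0..T}"
    then have "set_integrable lborel {0..s} g"
      by (intro borel_integrable_atLeastAtMost' continuous_on_subset[OF g]) auto
    then show "integral {0..s} g = frac_int 1 g s"
      by (simp add: frac_int_1 set_borel_integral_eq_integral(2))
  qed
qed


text \<open>Integrate by parts in \<open>(t - s)\<^sup>-\<^sup>\<alpha> (v s - v t) v' s\<close>: the boundary term at \<open>s = t\<close> vanishes and the
  remaining integrand is nonpositive.\<close>

lemma frac_int_mult_derivative_le:
  fixes v v' :: "real \<Rightarrow> real"
  assumes \<alpha>: "0 < \<alpha>" "\<alpha> < 1" and t: "0 < t"
    and cont: "continuous_on {0..t} v"
    and deriv: "\<And>s. 0 < s \<Longrightarrow> (v has_real_derivative v' s) (at s)"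
    and int: "frac_integrable (1 - \<alpha>) (\<lambda>s. (v s - v t) * v' s) t"
  shows "frac_int (1 - \<alpha>) (\<lambda>s. (v s - v t) * v' s) t \<le> 0"
proof -
  define f where "f = (\<lambda>s. (t - s) powr (- \<alpha>) * ((v s - v t) * v' s))"
  \<comment> \<open>Half the kernel times (v - v t)^2. Its derivative is f plus a nonnegative term
    from the derivative of the kernel.\<close>
  define \<Phi> where "\<Phi> = (\<lambda>s. (t - s) powr (- \<alpha>) * (v s - v t)\<^sup>2 / 2)"
  have f: "set_integrable lborel {0..t} f"
    using int by (simp add: frac_integrable_def f_def)
  then have f_int: "f integrable_on {0..t}"
    by (rule set_borel_integral_eq_integral(1))
  have le: "integral {0..r} f \<le> \<Phi> r" if r: "0 < r" "r < t" for r
  proof -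
    have 1: "((\<lambda>s. (t - s) powr (- \<alpha>) * ((v s - v t) * v' s) + \<alpha> / 2 * (t - s) powr (- \<alpha> - 1) * (v s - v t)\<^sup>2)
        has_integral \<Phi> r - \<Phi> 0) {0..r}"
    \<comment> \<open>v need not be differentiable at 0; r < t keeps away from the singularity of
      the kernel.\<close>
    proof (rule fundamental_theorem_of_calculus_interior)
      show "continuous_on {0..r} \<Phi>"
        unfolding \<Phi>_def using r
        by (intro continuous_intros continuous_on_powr' continuous_on_subset[OF cont]) auto
      fix s assume s: "s \<in> {0<..<r}"
      have D1: "((\<lambda>s. (t - s) powr (- \<alpha>)) has_real_derivative \<alpha> * (t - s) powr (- \<alpha> - 1)) (at s)"
        using s r by (auto intro!: derivative_eq_intros simp: powr_diff)
      have D2: "((\<lambda>s. (v s - v t)\<^sup>2) has_real_derivative 2 * (v s - v t) * v' s) (at s)"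
        using s by (auto intro!: derivative_eq_intros deriv)
      have "(\<Phi> has_real_derivative
          (t - s) powr (- \<alpha>) * ((v s - v t) * v' s) + \<alpha> / 2 * (t - s) powr (- \<alpha> - 1) * (v s - v t)\<^sup>2) (at s)"
        unfolding \<Phi>_def using DERIV_cdivide[OF DERIV_mult[OF D1 D2], of 2]
        by (rule DERIV_cong) (simp add: field_simps)
      then show "(\<Phi> has_vector_derivative
          (t - s) powr (- \<alpha>) * ((v s - v t) * v' s) + \<alpha> / 2 * (t - s) powr (- \<alpha> - 1) * (v s - v t)\<^sup>2) (at s)"
        by (simp add: has_real_derivative_iff_has_vector_derivative)
    qed (use r in simp)
    have 2: "(f has_integral integral {0..r} f) {0..r}"
      using integrable_on_subinterval[OF f_int] r by (intro integrable_integral) auto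
    have "integral {0..r} f \<le> \<Phi> r - \<Phi> 0"
      by (rule has_integral_le[OF 2 1]) (use \<alpha> in \<open>simp add: f_def\<close>)
    also have "\<dots> \<le> \<Phi> r" by (simp add: \<Phi>_def)
    finally show ?thesis .
  qed
  have "((\<lambda>r. integral {0..r} f) \<longlongrightarrow> integral {0..t} f) (at t within {0..t})"
    using indefinite_integral_continuous_1[OF f_int] t by (simp add: continuous_on_def)
  then have 1: "((\<lambda>r. integral {0..r} f) \<longlongrightarrow> integral {0..t} f) (at_left t)"
    using t at_within_Icc_at_left[of 0 t] by simp
  \<comment> \<open>Near t the difference v s - v t is of order t - s, so \<Phi> is of order (t -
    s)^(2 - \<alpha>) and tends to 0.\<close>
  have T1: "((\<lambda>s. (v s - v t) / (s - t)) \<longlongrightarrow> v' t) (at_left t)"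
    using deriv[OF t] unfolding has_field_derivative_iff by (rule filterlim_mono) (auto simp: at_le)
  have T2: "((\<lambda>s. (t - s) powr (2 - \<alpha>)) \<longlongrightarrow> (t - t) powr (2 - \<alpha>)) (at_left t)"
  proof (rule tendsto_powr')
    show "((\<lambda>s. t - s) \<longlongrightarrow> t - t) (at_left t)"
      by (intro tendsto_intros)
    show "t - t \<noteq> 0 \<or> 0 < 2 - \<alpha> \<and> (\<forall>\<^sub>F s in at_left t. 0 \<le> t - s)"
      using \<alpha> by (auto intro!: eventually_at_leftI[OF _ t])
  qed (rule tendsto_const)
  have "((\<lambda>s. 1 / 2 * (t - s) powr (2 - \<alpha>) * ((v s - v t) / (s - t))\<^sup>2) \<longlongrightarrow> 1 / 2 * (t - t) powr (2 - \<alpha>) * (v' t)\<^sup>2) (at_left t)"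
    by (rule tendsto_mult[OF tendsto_mult[OF tendsto_const T2] tendsto_power[OF T1]])
  moreover have "\<forall>\<^sub>F s in at_left t. 1 / 2 * (t - s) powr (2 - \<alpha>) * ((v s - v t) / (s - t))\<^sup>2 = \<Phi> s"
  proof (rule eventually_at_leftI[OF _ t])
    fix s assume "s \<in> {0<..<t}"
    then have s: "0 < t - s" by simp
    have "(t - s) powr (2 - \<alpha>) = (t - s)\<^sup>2 * (t - s) powr (- \<alpha>)"
      using s by (simp add: powr_diff powr_minus field_simps powr_numeral)
    moreover have "(s - t)\<^sup>2 = (t - s)\<^sup>2" by (simp add: power2_commute)
    ultimately show "1 / 2 * (t - s) powr (2 - \<alpha>) * ((v s - v t) / (s - t))\<^sup>2 = \<Phi> s"
      using s by (simp add: \<Phi>_def power_divide)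
  qed
  ultimately have 2: "(\<Phi> \<longlongrightarrow> 0) (at_left t)"
    by (simp add: filterlim_cong)
  have "integral {0..t} f \<le> 0"
    by (rule tendsto_le[OF _ 2 1]) (auto intro!: eventually_at_leftI[OF _ t] le)
  moreover have "frac_int (1 - \<alpha>) (\<lambda>s. (v s - v t) * v' s) t = 1 / Gamma (1 - \<alpha>) * integral {0..t} f"
    using set_borel_integral_eq_integral(2)[OF f] by (simp add: frac_int_def f_def)
  ultimately show ?thesis
    using Gamma_real_pos[of "1 - \<alpha>"] \<alpha> by (simp add: divide_nonpos_pos)
qed

text \<open>Term by term from the power rule: \<open>w'\<close> is the derivative of the sum w of
  the c_i t^(\<beta>_i), I^(1 - \<alpha>) w' is the classical Caputo derivative of w, and I^\<alpha>
  of that returns w because w vanishes at 0. It serves both v = I^\<alpha> p and v^2 for a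
  polynomial p.\<close>

lemma frac_int_caputo_powr:
  assumes \<alpha>: "0 < \<alpha>" "\<alpha> < 1" and I: "finite I" and \<beta>: "\<And>i. i \<in> I \<Longrightarrow> \<alpha> \<le> \<beta> i"
    and w': "\<And>s. 0 < s \<Longrightarrow> w' s = (\<Sum>i\<in>I. c i * \<beta> i * s powr (\<beta> i - 1))"
  shows "0 < t \<Longrightarrow> frac_integrable (1 - \<alpha>) w' t"
    and "0 < t \<Longrightarrow> frac_int (1 - \<alpha>) w' t = (\<Sum>i\<in>I. c i * (Gamma (\<beta> i + 1) / Gamma (\<beta> i + 1 - \<alpha>)) * t powr (\<beta> i - \<alpha>))"
    and "0 < t \<Longrightarrow> frac_integrable \<alpha> (frac_int (1 - \<alpha>) w') t"
    and "0 \<le> t \<Longrightarrow> frac_int \<alpha> (frac_int (1 - \<alpha>) w') t = (\<Sum>i\<in>I. c i * t powr \<beta> i)"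
proof -
  note S1 = frac_int_sum[OF I, of "1 - \<alpha>" "\<lambda>i s. c i * \<beta> i * s powr (\<beta> i - 1)"]
  have int: "frac_integrable (1 - \<alpha>) (\<lambda>s. c i * \<beta> i * s powr (\<beta> i - 1)) t" if "0 < t" "i \<in> I" for i t
    using \<beta>[OF that(2)] \<alpha> that by (intro frac_integrable_cmult frac_integrable_powr) auto
  have cong: "frac_integrable (1 - \<alpha>) w' t = frac_integrable (1 - \<alpha>) (\<lambda>s. \<Sum>i\<in>I. c i * \<beta> i * s powr (\<beta> i - 1)) t"
    "frac_int (1 - \<alpha>) w' t = frac_int (1 - \<alpha>) (\<lambda>s. \<Sum>i\<in>I. c i * \<beta> i * s powr (\<beta> i - 1)) t" for t
    using w' by (intro frac_integrable_cong frac_int_cong; simp)+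
  show "frac_integrable (1 - \<alpha>) w' t" if "0 < t" for t
    using S1[OF int[OF that]] by (simp add: cong)
  have val: "frac_int (1 - \<alpha>) w' t = (\<Sum>i\<in>I. c i * (Gamma (\<beta> i + 1) / Gamma (\<beta> i + 1 - \<alpha>)) * t powr (\<beta> i - \<alpha>))" if t: "0 < t" for t
  proof -
    have "frac_int (1 - \<alpha>) w' t = (\<Sum>i\<in>I. frac_int (1 - \<alpha>) (\<lambda>s. c i * \<beta> i * s powr (\<beta> i - 1)) t)"
      using S1[OF int[OF t]] by (simp add: cong)
    also have "\<dots> = (\<Sum>i\<in>I. c i * (Gamma (\<beta> i + 1) / Gamma (\<beta> i + 1 - \<alpha>)) * t powr (\<beta> i - \<alpha>))"
    proof (rule sum.cong)
      fix i assume i: "i \<in> I"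
      have "frac_int (1 - \<alpha>) (\<lambda>s. s powr (\<beta> i - 1)) t = Gamma (\<beta> i) / Gamma (\<beta> i + 1 - \<alpha>) * t powr (\<beta> i - \<alpha>)"
        using set_integrable_frac_kernel_powr(2)[of "1 - \<alpha>" "\<beta> i - 1" t] \<beta>[OF i] \<alpha> t
        by (simp add: algebra_simps)
      moreover have "Gamma (\<beta> i + 1) = \<beta> i * Gamma (\<beta> i)"
        using \<beta>[OF i] \<alpha> by (intro Gamma_plus1) (auto dest: nonpos_Ints_nonpos)
      ultimately show "frac_int (1 - \<alpha>) (\<lambda>s. c i * \<beta> i * s powr (\<beta> i - 1)) t =
          c i * (Gamma (\<beta> i + 1) / Gamma (\<beta> i + 1 - \<alpha>)) * t powr (\<beta> i - \<alpha>)"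
        unfolding frac_int_cmult by simp
    qed simp
    finally show ?thesis .
  qed
  show "0 < t \<Longrightarrow> frac_int (1 - \<alpha>) w' t = (\<Sum>i\<in>I. c i * (Gamma (\<beta> i + 1) / Gamma (\<beta> i + 1 - \<alpha>)) * t powr (\<beta> i - \<alpha>))"
    by (rule val)
  note S2 = frac_int_sum[OF I, of \<alpha> "\<lambda>i t. c i * (Gamma (\<beta> i + 1) / Gamma (\<beta> i + 1 - \<alpha>)) * t powr (\<beta> i - \<alpha>)"]
  have int2: "frac_integrable \<alpha> (\<lambda>t. c i * (Gamma (\<beta> i + 1) / Gamma (\<beta> i + 1 - \<alpha>)) * t powr (\<beta> i - \<alpha>)) t" if "0 < t" "i \<in> I" for i t
    using \<beta>[OF that(2)] \<alpha> that by (intro frac_integrable_cmult frac_integrable_powr) auto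
  have cong2: "frac_integrable \<alpha> (frac_int (1 - \<alpha>) w') t = frac_integrable \<alpha> (\<lambda>t. \<Sum>i\<in>I. c i * (Gamma (\<beta> i + 1) / Gamma (\<beta> i + 1 - \<alpha>)) * t powr (\<beta> i - \<alpha>)) t"
    "frac_int \<alpha> (frac_int (1 - \<alpha>) w') t = frac_int \<alpha> (\<lambda>t. \<Sum>i\<in>I. c i * (Gamma (\<beta> i + 1) / Gamma (\<beta> i + 1 - \<alpha>)) * t powr (\<beta> i - \<alpha>)) t" for t
    using val by (intro frac_integrable_cong frac_int_cong; simp)+
  show "0 < t \<Longrightarrow> frac_integrable \<alpha> (frac_int (1 - \<alpha>) w') t"
    using S2[OF int2] by (simp add: cong2)
  show "frac_int \<alpha> (frac_int (1 - \<alpha>) w') t = (\<Sum>i\<in>I. c i * t powr \<beta> i)" if "0 \<le> t"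
  proof (cases "t = 0")
    case True
    then show ?thesis by simp
  next
    case False
    with that have t: "0 < t" by simp
    have "frac_int \<alpha> (frac_int (1 - \<alpha>) w') t = (\<Sum>i\<in>I. frac_int \<alpha> (\<lambda>t. c i * (Gamma (\<beta> i + 1) / Gamma (\<beta> i + 1 - \<alpha>)) * t powr (\<beta> i - \<alpha>)) t)"
      using S2[OF int2[OF t]] by (simp add: cong2)
    also have "\<dots> = (\<Sum>i\<in>I. c i * t powr \<beta> i)"
    proof (rule sum.cong)
      fix i assume i: "i \<in> I"
      have "0 < Gamma (\<beta> i + 1)" "0 < Gamma (\<beta> i + 1 - \<alpha>)"
        using \<beta>[OF i] \<alpha> by (auto intro!: Gamma_real_pos)
      moreover have "frac_int \<alpha> (\<lambda>s. s powr (\<beta> i - \<alpha>)) t = Gamma (\<beta> i + 1 - \<alpha>) / Gamma (\<beta> i + 1) * t powr \<beta> i"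
        using set_integrable_frac_kernel_powr(2)[of \<alpha> "\<beta> i - \<alpha>" t] \<beta>[OF i] \<alpha> t
        by (simp add: algebra_simps)
      ultimately show "frac_int \<alpha> (\<lambda>t. c i * (Gamma (\<beta> i + 1) / Gamma (\<beta> i + 1 - \<alpha>)) * t powr (\<beta> i - \<alpha>)) t = c i * t powr \<beta> i"
        unfolding frac_int_cmult by simp
    qed simp
    finally show ?thesis .
  qed
qed

text \<open>Here v = I^\<alpha> p has the classical Caputo derivative p, and v^2 is again a sum of
  powers. Writing (v r - v s) v' r as half of (v^2)' r minus v s times v' r turns
  \<open>frac_int_mult_derivative_le\<close> into Alikhanov's inequality at s, which I^\<alpha> then
  integrates.\<close>

lemma frac_int_square_le_polynomial:
  fixes a :: "nat \<Rightarrow> real" and n :: nat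
  assumes \<alpha>: "0 < \<alpha>" "\<alpha> < 1" and t: "0 \<le> t"
  defines "p \<equiv> \<lambda>s. \<Sum>i\<le>n. a i * s ^ i"
  shows "(frac_int \<alpha> p t)\<^sup>2 \<le> 2 * frac_int \<alpha> (\<lambda>s. frac_int \<alpha> p s * p s) t"
proof (cases "t = 0")
  case False
  with t have t: "0 < t" by simp
  define c where "c = (\<lambda>i. a i * (Gamma (real i + 1) / Gamma (real i + 1 + \<alpha>)))"
  define \<beta> where "\<beta> = (\<lambda>i. real i + \<alpha>)"
  define v where "v = (\<lambda>s. \<Sum>i\<le>n. c i * s powr \<beta> i)"
  define v' where "v' = (\<lambda>s. \<Sum>i\<le>n. c i * \<beta> i * s powr (\<beta> i - 1))"
  have v: "frac_int \<alpha> p s = v s" if "0 \<le> s" for s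
    using frac_int_polynomial[OF \<alpha>(1) that] by (simp add: p_def v_def c_def \<beta>_def)
  have deriv: "(v has_real_derivative v' s) (at s)" if "0 < s" for s
    unfolding v_def v'_def using that by (auto intro!: derivative_eq_intros sum.cong simp: mult_ac)
  have cont_v: "continuous_on {0..s} v" for s
    unfolding v_def using \<alpha> by (intro continuous_intros continuous_on_powr') (auto simp: \<beta>_def)
  have cont_p: "continuous_on {0..s} p" for s
    unfolding p_def by (intro continuous_intros)
  note V' = frac_int_caputo_powr[OF \<alpha>, of "{..n}" \<beta> v' c]
  have V'int: "frac_integrable (1 - \<alpha>) v' s" if "0 < s" for s
    using \<alpha> that by (intro V'(1)) (auto simp: \<beta>_def v'_def)
  have p: "frac_int (1 - \<alpha>) v' s = p s" if "0 < s" for s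
  proof -
    have "frac_int (1 - \<alpha>) v' s = (\<Sum>i\<le>n. c i * (Gamma (\<beta> i + 1) / Gamma (\<beta> i + 1 - \<alpha>)) * s powr (\<beta> i - \<alpha>))"
      using \<alpha> that by (intro V'(2)) (auto simp: \<beta>_def v'_def)
    also have "\<dots> = p s"
      unfolding p_def
    proof (rule sum.cong)
      fix i
      have "0 < Gamma (1 + real i)" "0 < Gamma (real i + 1 + \<alpha>)"
        by (rule Gamma_real_pos, use \<alpha> in simp)+
      then show "c i * (Gamma (\<beta> i + 1) / Gamma (\<beta> i + 1 - \<alpha>)) * s powr (\<beta> i - \<alpha>) = a i * s ^ i"
        using that by (simp add: c_def \<beta>_def powr_realpow add_ac Gamma_fact)
    qed simp
    finally show ?thesis .
  qed
  \<comment> \<open>Coefficients, and below exponents, of v^2, indexed by pairs.\<close>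
  define C where "C = (\<lambda>(i, j). c i * c j)"
  define B where "B = (\<lambda>(i, j). \<beta> i + \<beta> j)"
  have w': "2 * v s * v' s = (\<Sum>k\<in>{..n}\<times>{..n}. C k * B k * s powr (B k - 1))" if "0 < s" for s
  proof -
    have "v s * v' s = (\<Sum>(i, j)\<in>{..n}\<times>{..n}. c i * c j * \<beta> j * s powr (\<beta> i + \<beta> j - 1))"
      unfolding v_def v'_def sum_product sum.cartesian_product
      by (intro sum.cong) (auto simp: powr_add[symmetric] algebra_simps)
    \<comment> \<open>Exchanging i and j gives a copy with the factor \<beta> i; the two copies add
      up to the factor \<beta> i + \<beta> j that differentiating a power of v^2 produces.\<close>
    moreover have "\<dots> = (\<Sum>(i, j)\<in>{..n}\<times>{..n}. c i * c j * \<beta> i * s powr (\<beta> i + \<beta> j - 1))"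
      unfolding sum.cartesian_product[symmetric]
      by (subst sum.swap) (intro sum.cong refl, simp add: add.commute mult_ac)
    ultimately have "2 * (v s * v' s) = (\<Sum>(i, j)\<in>{..n}\<times>{..n}. c i * c j * \<beta> j * s powr (\<beta> i + \<beta> j - 1)) +
        (\<Sum>(i, j)\<in>{..n}\<times>{..n}. c i * c j * \<beta> i * s powr (\<beta> i + \<beta> j - 1))"
      by simp
    also have "\<dots> = (\<Sum>k\<in>{..n}\<times>{..n}. C k * B k * s powr (B k - 1))"
      unfolding sum.distrib[symmetric] by (intro sum.cong) (auto simp: C_def B_def algebra_simps)
    finally show ?thesis by (simp add: mult.assoc)
  qed
  note W' = frac_int_caputo_powr[OF \<alpha>, of "{..n}\<times>{..n}" B "\<lambda>s. 2 * v s * v' s" C]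
  have B: "\<alpha> \<le> B k" for k
    using \<alpha> by (cases k) (simp add: B_def \<beta>_def)
  have W'int: "frac_integrable (1 - \<alpha>) (\<lambda>s. 2 * v s * v' s) s" if "0 < s" for s
    using that by (intro W'(1) B w') auto
  have le: "frac_int (1 - \<alpha>) (\<lambda>s. 2 * v s * v' s) s \<le> 2 * (v s * p s)" if s: "0 < s" for s
  proof -
    have *: "(\<lambda>r. (v r - v s) * v' r) = (\<lambda>r. 1 / 2 * (2 * v r * v' r) - v s * v' r)"
      by (auto simp: algebra_simps)
    have i: "frac_integrable (1 - \<alpha>) (\<lambda>r. 1 / 2 * (2 * v r * v' r)) s" "frac_integrable (1 - \<alpha>) (\<lambda>r. v s * v' r) s"
      by (rule frac_integrable_cmult[OF W'int[OF s]], rule frac_integrable_cmult[OF V'int[OF s]])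
    have "frac_int (1 - \<alpha>) (\<lambda>r. (v r - v s) * v' r) s \<le> 0"
    proof (rule frac_int_mult_derivative_le[OF \<alpha> s cont_v deriv])
      show "frac_integrable (1 - \<alpha>) (\<lambda>r. (v r - v s) * v' r) s"
        unfolding * by (rule frac_integrable_diff[OF i])
    qed
    then show ?thesis
      unfolding * frac_int_diff[OF i] frac_int_cmult using p[OF s] by simp
  qed
  have "(v t)\<^sup>2 = (\<Sum>k\<in>{..n}\<times>{..n}. C k * t powr B k)"
    unfolding power2_eq_square v_def sum_product sum.cartesian_product
    by (intro sum.cong) (auto simp: C_def B_def powr_add mult_ac)
  also have "\<dots> = frac_int \<alpha> (frac_int (1 - \<alpha>) (\<lambda>s. 2 * v s * v' s)) t"
    using t by (intro W'(4)[symmetric] B w') auto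
  also have "\<dots> \<le> frac_int \<alpha> (\<lambda>s. 2 * (v s * p s)) t"
  proof (rule frac_int_mono[OF \<alpha>(1)])
    show "frac_integrable \<alpha> (frac_int (1 - \<alpha>) (\<lambda>s. 2 * v s * v' s)) t"
      using t by (intro W'(3) B w') auto
    show "frac_integrable \<alpha> (\<lambda>s. 2 * (v s * p s)) t"
      by (intro frac_integrable_continuous \<alpha> continuous_intros cont_v cont_p)
  qed (rule le)
  also have "\<dots> = 2 * frac_int \<alpha> (\<lambda>s. frac_int \<alpha> p s * p s) t"
    unfolding frac_int_cmult by (intro arg_cong[where f = "(*) 2"] frac_int_cong) (simp add: v)
  finally show ?thesis
    using v t by simp
qed simp

text \<open>The integrated form of Alikhanov's inequality \<open>\<partial>\<^sup>\<alpha>(v\<^sup>2) \<le> 2 v \<partial>\<^sup>\<alpha>v\<close>, for \<open>\<partial>\<^sup>\<alpha>v = g\<close> merely continuous.\<close>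

lemma frac_int_square_le:
  assumes \<alpha>: "0 < \<alpha>" "\<alpha> < 1" and g: "continuous_on {0..T} g" and t: "t \<in> {0..T}"
  shows "(frac_int \<alpha> g t)\<^sup>2 \<le> 2 * frac_int \<alpha> (\<lambda>s. frac_int \<alpha> g s * g s) t"
proof -
  obtain a N where lim: "uniform_limit {0..T} (\<lambda>k x. \<Sum>i\<le>N k. a k i * x ^ i) g sequentially"
    using polynomial_uniform_limit[OF g] .
  define p where "p = (\<lambda>k x. \<Sum>i\<le>N k. a k i * x ^ i)"
  have p: "continuous_on {0..T} (p k)" for k
    unfolding p_def by (intro continuous_intros)
  have lim: "uniform_limit {0..T} p g sequentially"
    using lim by (simp add: p_def)
  note J = uniform_limit_frac_int[OF \<alpha>(1) p g lim]
  note Jg = continuous_on_frac_int[OF \<alpha>(1) g] and Jp = continuous_on_frac_int[OF \<alpha>(1) p]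
  have "uniform_limit {0..T} (\<lambda>k s. frac_int \<alpha> (p k) s * p k s) (\<lambda>s. frac_int \<alpha> g s * g s) sequentially"
    by (intro uniform_lim_mult J lim compact_imp_bounded compact_continuous_image Jg g compact_Icc)
  then have "uniform_limit {0..T} (\<lambda>k. frac_int \<alpha> (\<lambda>s. frac_int \<alpha> (p k) s * p k s))
      (frac_int \<alpha> (\<lambda>s. frac_int \<alpha> g s * g s)) sequentially"
    by (intro uniform_limit_frac_int \<alpha> continuous_intros Jg Jp g p)
  note 1 = tendsto_uniform_limitI[OF this t]
  show ?thesis
  proof (rule LIMSEQ_le)
    show "(\<lambda>k. (frac_int \<alpha> (p k) t)\<^sup>2) \<longlonglongrightarrow> (frac_int \<alpha> g t)\<^sup>2"
      by (intro tendsto_intros tendsto_uniform_limitI[OF J t])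
    show "(\<lambda>k. 2 * frac_int \<alpha> (\<lambda>s. frac_int \<alpha> (p k) s * p k s) t) \<longlonglongrightarrow> 2 * frac_int \<alpha> (\<lambda>s. frac_int \<alpha> g s * g s) t"
      by (intro tendsto_intros 1)
    show "\<exists>K. \<forall>k\<ge>K. (frac_int \<alpha> (p k) t)\<^sup>2 \<le> 2 * frac_int \<alpha> (\<lambda>s. frac_int \<alpha> (p k) s * p k s) t"
      using frac_int_square_le_polynomial[OF \<alpha>, of t] t by (auto simp: p_def)
  qed
qed


section \<open>Volterra equations and the fractional ODE\<close>

text \<open>The substitution x = \<kappa> (t - s) gives \<kappa>^(-\<alpha>) exp(\<kappa> t) times
  an incomplete Gamma integral, which is at most \<open>Gamma \<alpha>\<close>. The factor
  \<kappa>^(-\<alpha>), small for large \<kappa>, is the source of the contraction.\<close>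

lemma frac_int_exp_le:
  assumes \<alpha>: "0 < \<alpha>" and \<kappa>: "0 < \<kappa>" and t: "0 \<le> t"
  shows "frac_int \<alpha> (\<lambda>s. exp (\<kappa> * s)) t \<le> \<kappa> powr (- \<alpha>) * exp (\<kappa> * t)"
proof -
  define g where "g = (\<lambda>x. x powr (\<alpha> - 1) / exp x)"
  have g: "(g has_integral Gamma \<alpha>) {0..}"
    unfolding g_def by (rule Gamma_integral_real[OF \<alpha>])
  then have gi: "g integrable_on {0..\<kappa> * t}"
    by (intro integrable_on_subinterval[where S = "{0..}"]) (auto simp: integrable_on_def)
  have le: "integral {0..\<kappa> * t} g \<le> Gamma \<alpha>"
    unfolding integral_unique[OF g, symmetric] by (rule integral_subset_le) (use g gi in \<open>auto simp: g_def integrable_on_def\<close>)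
  have img: "(\<lambda>x. (1 / - \<kappa>) *\<^sub>R x + - ((1 / - \<kappa>) *\<^sub>R (\<kappa> * t))) ` cbox 0 (\<kappa> * t) = {0..t}"
    using image_affinity_atLeastAtMost[of "1 / - \<kappa>" t 0 "\<kappa> * t"] \<kappa> t by (simp add: field_simps)
  have "((\<lambda>x. g (- \<kappa> *\<^sub>R x + \<kappa> * t)) has_integral (1 / \<bar>- \<kappa>\<bar> ^ DIM(real)) *\<^sub>R integral {0..\<kappa> * t} g)
      ((\<lambda>x. (1 / - \<kappa>) *\<^sub>R x + - ((1 / - \<kappa>) *\<^sub>R (\<kappa> * t))) ` cbox 0 (\<kappa> * t))"
    using gi \<kappa> by (intro has_integral_affinity) auto
  then have "((\<lambda>x. g (\<kappa> * (t - x))) has_integral integral {0..\<kappa> * t} g / \<kappa>) {0..t}"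
    unfolding img using \<kappa> by (simp add: algebra_simps)
  then have "((\<lambda>x. \<kappa> powr (1 - \<alpha>) * exp (\<kappa> * t) * g (\<kappa> * (t - x))) has_integral
      \<kappa> powr (1 - \<alpha>) * exp (\<kappa> * t) * (integral {0..\<kappa> * t} g / \<kappa>)) {0..t}"
    by (rule has_integral_mult_right)
  then have *: "((\<lambda>s. (t - s) powr (\<alpha> - 1) * exp (\<kappa> * s)) has_integral
      \<kappa> powr (1 - \<alpha>) * exp (\<kappa> * t) * (integral {0..\<kappa> * t} g / \<kappa>)) {0..t}"
  proof (rule has_integral_eq[rotated])
    fix s assume s: "s \<in> {0..t}"
    have "\<kappa> powr (1 - \<alpha>) * \<kappa> powr (\<alpha> - 1) = 1"
      using \<kappa> by (simp add: powr_add[symmetric])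
    moreover have "(\<kappa> * (t - s)) powr (\<alpha> - 1) = \<kappa> powr (\<alpha> - 1) * (t - s) powr (\<alpha> - 1)"
      by (rule powr_mult)
    moreover have "exp (\<kappa> * (t - s)) = exp (\<kappa> * t) / exp (\<kappa> * s)"
      by (simp add: right_diff_distrib exp_diff)
    ultimately show "\<kappa> powr (1 - \<alpha>) * exp (\<kappa> * t) * g (\<kappa> * (t - s)) = (t - s) powr (\<alpha> - 1) * exp (\<kappa> * s)"
      unfolding g_def by simp
  qed
  have "(LBINT s:{0..t}. (t - s) powr (\<alpha> - 1) * exp (\<kappa> * s)) = \<kappa> powr (1 - \<alpha>) * exp (\<kappa> * t) * (integral {0..\<kappa> * t} g / \<kappa>)"
    by (rule lborel_of_nonneg_has_integral[OF _ *]) auto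
  also have "\<dots> = \<kappa> powr (- \<alpha>) * exp (\<kappa> * t) * integral {0..\<kappa> * t} g"
    using \<kappa> by (simp add: powr_diff powr_minus field_simps)
  also have "\<dots> \<le> \<kappa> powr (- \<alpha>) * exp (\<kappa> * t) * Gamma \<alpha>"
    using le by (intro mult_left_mono) auto
  finally show ?thesis
    using Gamma_real_pos[OF \<alpha>] by (simp add: frac_int_def divide_simps mult_ac)
qed

lemma continuous_on_Icc_bounded:
  fixes g :: "real \<Rightarrow> real"
  assumes "continuous_on {a..b} g"
  obtains B where "0 \<le> B" "\<And>s. s \<in> {a..b} \<Longrightarrow> \<bar>g s\<bar> \<le> B"
proof -
  obtain B where B: "\<forall>y\<in>g ` {a..b}. norm y \<le> B"
    using compact_imp_bounded[OF compact_continuous_image[OF assms compact_Icc]] unfolding bounded_iff by auto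
  show ?thesis
  proof (rule that[of "max B 0"])
    fix s assume "s \<in> {a..b}"
    then have "\<bar>g s\<bar> \<le> B" using B by auto
    then show "\<bar>g s\<bar> \<le> max B 0" by simp
  qed simp
qed

text \<open>For the weight exp(-\<kappa> s) the operator norm is at most B \<kappa>^(-\<alpha>),
  with B a bound on |m|, by \<open>frac_int_exp_le\<close>. A large \<kappa> makes this 1/2 on the
  whole interval, however long.\<close>

lemma frac_int_contraction:
  fixes T :: real
  assumes \<alpha>: "0 < \<alpha>" and m: "continuous_on {0..T} m"
  obtains \<kappa> where "0 < \<kappa>"
    "\<And>w M t. \<lbrakk>continuous_on {0..T} w; \<And>s. s \<in> {0..T} \<Longrightarrow> \<bar>w s\<bar> \<le> M * exp (\<kappa> * s); t \<in> {0..T}\<rbrakk>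
      \<Longrightarrow> \<bar>frac_int \<alpha> (\<lambda>s. m s * w s) t\<bar> \<le> M / 2 * exp (\<kappa> * t)"
proof -
  obtain B where B0: "0 \<le> B" and B: "\<And>s. s \<in> {0..T} \<Longrightarrow> \<bar>m s\<bar> \<le> B"
    using continuous_on_Icc_bounded[OF m] by blast
  \<comment> \<open>Solves \<kappa>^\<alpha> = 2 (B + 1); the added 1 keeps \<kappa> positive when B
    = 0.\<close>
  define \<kappa> where "\<kappa> = (2 * (B + 1)) powr (1 / \<alpha>)"
  have \<kappa>: "0 < \<kappa>" using B0 by (simp add: \<kappa>_def)
  have "\<kappa> powr (- \<alpha>) = 1 / (2 * (B + 1))"
    using \<alpha> B0 by (simp add: \<kappa>_def powr_powr powr_minus inverse_eq_divide)
  then have "B * \<kappa> powr (- \<alpha>) = B / (2 * (B + 1))" by simp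
  also have "\<dots> \<le> 1 / 2"
    using B0 by (simp add: field_simps)
  finally have B\<kappa>: "B * \<kappa> powr (- \<alpha>) \<le> 1 / 2" .
  show ?thesis
  proof (rule that[OF \<kappa>])
    fix w M t
    assume w: "continuous_on {0..T} w" and M: "\<And>s. s \<in> {0..T} \<Longrightarrow> \<bar>w s\<bar> \<le> M * exp (\<kappa> * s)" and t: "t \<in> {0..T}"
    have M0: "0 \<le> M"
    proof -
      have "0 \<le> M * exp (\<kappa> * t)" using M[OF t] by linarith
      then show ?thesis by (simp add: zero_le_mult_iff)
    qed
    have sub: "{0..t} \<subseteq> {0..T}" using t by auto
    have i: "frac_integrable \<alpha> (\<lambda>s. m s * w s) t" "frac_integrable \<alpha> (\<lambda>s. c * exp (\<kappa> * s)) t" for c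
      by (intro frac_integrable_continuous \<alpha> continuous_intros continuous_on_subset[OF w sub] continuous_on_subset[OF m sub])+
    have mw: "\<bar>m s * w s\<bar> \<le> B * M * exp (\<kappa> * s)" if "0 < s" "s \<le> t" for s
      using mult_mono[OF B[of s] M[of s] B0] that t by (simp add: abs_mult mult.assoc)
    have "frac_int \<alpha> (\<lambda>s. m s * w s) t \<le> frac_int \<alpha> (\<lambda>s. B * M * exp (\<kappa> * s)) t"
      by (intro frac_int_mono \<alpha> i order_trans[OF abs_ge_self mw])
    moreover have "frac_int \<alpha> (\<lambda>s. (- (B * M)) * exp (\<kappa> * s)) t \<le> frac_int \<alpha> (\<lambda>s. m s * w s) t"
    proof (intro frac_int_mono \<alpha> i)
      fix s assume "0 < s" "s \<le> t"
      from mw[OF this] show "(- (B * M)) * exp (\<kappa> * s) \<le> m s * w s" by (simp add: abs_le_iff)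
    qed
    ultimately have "\<bar>frac_int \<alpha> (\<lambda>s. m s * w s) t\<bar> \<le> B * M * frac_int \<alpha> (\<lambda>s. exp (\<kappa> * s)) t"
      unfolding frac_int_cmult by (simp add: abs_le_iff)
    also have "\<dots> \<le> B * M * (\<kappa> powr (- \<alpha>) * exp (\<kappa> * t))"
      using t M0 B0 by (intro mult_left_mono frac_int_exp_le \<alpha> \<kappa>) auto
    also have "\<dots> = (B * \<kappa> powr (- \<alpha>)) * (M * exp (\<kappa> * t))"
      by (simp add: mult_ac)
    also have "\<dots> \<le> 1 / 2 * (M * exp (\<kappa> * t))"
      by (rule mult_right_mono[OF B\<kappa>]) (use M0 in simp)
    finally show "\<bar>frac_int \<alpha> (\<lambda>s. m s * w s) t\<bar> \<le> M / 2 * exp (\<kappa> * t)" by simp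
  qed
qed

text \<open>The Picard iterates start at 0, so the first increment is h; the later ones halve in the
  weighted norm, and the telescoping series of increments converges uniformly.\<close>

lemma frac_volterra_exists:
  assumes \<alpha>: "0 < \<alpha>" and m: "continuous_on {0..T} m" and h: "continuous_on {0..T} h"
  obtains u where "continuous_on {0..T} u" "\<And>t. t \<in> {0..T} \<Longrightarrow> u t = h t - frac_int \<alpha> (\<lambda>s. m s * u s) t"
proof -
  obtain \<kappa> where \<kappa>: "0 < \<kappa>" and contr: "\<And>w M t. \<lbrakk>continuous_on {0..T} w; \<And>s. s \<in> {0..T} \<Longrightarrow> \<bar>w s\<bar> \<le> M * exp (\<kappa> * s); t \<in> {0..T}\<rbrakk>
      \<Longrightarrow> \<bar>frac_int \<alpha> (\<lambda>s. m s * w s) t\<bar> \<le> M / 2 * exp (\<kappa> * t)"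
    using frac_int_contraction[OF \<alpha> m] by blast
  define U where "U = rec_nat (\<lambda>_. 0) (\<lambda>_ u t. h t - frac_int \<alpha> (\<lambda>s. m s * u s) t)"
  have U0: "U 0 = (\<lambda>_. 0)" and US: "U (Suc k) = (\<lambda>t. h t - frac_int \<alpha> (\<lambda>s. m s * U k s) t)" for k
    by (simp_all add: U_def)
  have U: "continuous_on {0..T} (U k)" for k
    by (induction k) (auto simp: U0 US intro!: continuous_intros continuous_on_frac_int \<alpha> m h)
  obtain H where H0: "0 \<le> H" and H: "\<And>s. s \<in> {0..T} \<Longrightarrow> \<bar>h s\<bar> \<le> H"
    using continuous_on_Icc_bounded[OF h] by blast
  have diff: "\<bar>U (Suc k) s - U k s\<bar> \<le> H * (1 / 2) ^ k * exp (\<kappa> * s)" if "s \<in> {0..T}" for k s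
    using that
  proof (induction k arbitrary: s)
    case 0
    have "1 \<le> exp (\<kappa> * s)" using 0 \<kappa> by simp
    then have "H * 1 \<le> H * exp (\<kappa> * s)" using H0 by (intro mult_left_mono) auto
    then show ?case using H[OF 0] by (simp add: US U0 frac_int_def)
  next
    case (Suc k)
    have sub: "{0..s} \<subseteq> {0..T}" using Suc.prems by auto
    have int: "frac_integrable \<alpha> (\<lambda>s. m s * U k s) s" for k
      by (intro frac_integrable_continuous \<alpha> continuous_intros continuous_on_subset[OF U sub] continuous_on_subset[OF m sub])
    have US': "U (Suc k) s = h s - frac_int \<alpha> (\<lambda>s. m s * U k s) s" for k
      by (simp add: US)
    have "U (Suc (Suc k)) s - U (Suc k) s = - frac_int \<alpha> (\<lambda>s. m s * (U (Suc k) s - U k s)) s"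
      unfolding right_diff_distrib frac_int_diff[OF int int] using US'[of "Suc k"] US'[of k] by linarith
    also have "\<bar>\<dots>\<bar> \<le> (H * (1 / 2) ^ k) / 2 * exp (\<kappa> * s)"
      unfolding abs_minus_cancel by (intro contr continuous_intros U Suc.IH Suc.prems)
    finally show ?case by simp
  qed
  define u where "u = (\<lambda>s. \<Sum>k. U (Suc k) s - U k s)"
  have "uniform_limit {0..T} (\<lambda>n s. \<Sum>k<n. U (Suc k) s - U k s) u sequentially"
    unfolding u_def
  proof (rule Weierstrass_m_test)
    fix k s assume s: "s \<in> {0..T}"
    \<comment> \<open>On a bounded interval the weight is at most exp(\<kappa> T), which makes the
      weighted bound uniform.\<close>
    then have "H * (1 / 2) ^ k * exp (\<kappa> * s) \<le> H * (1 / 2) ^ k * exp (\<kappa> * T)"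
      using \<kappa> H0 by (intro mult_left_mono) auto
    with diff[OF s, of k] show "norm (U (Suc k) s - U k s) \<le> H * (1 / 2) ^ k * exp (\<kappa> * T)" by simp
  qed (intro summable_mult summable_mult2 summable_geometric, simp)
  moreover have "(\<Sum>k<n. U (Suc k) s - U k s) = U n s" for n s
    using sum_lessThan_telescope[of "\<lambda>k. U k s" n] by (simp add: U0)
  ultimately have lim: "uniform_limit {0..T} U u sequentially" by simp
  have u: "continuous_on {0..T} u"
    by (rule uniform_limit_theorem[OF _ lim]) (auto simp: U)
  show ?thesis
  proof (rule that[OF u])
    fix t assume t: "t \<in> {0..T}"
    have "uniform_limit {0..T} (\<lambda>k s. m s * U k s) (\<lambda>s. m s * u s) sequentially"
      by (intro uniform_lim_mult uniform_limit_const lim compact_imp_bounded compact_continuous_image u m compact_Icc)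
    then have "uniform_limit {0..T} (\<lambda>k. frac_int \<alpha> (\<lambda>s. m s * U k s)) (frac_int \<alpha> (\<lambda>s. m s * u s)) sequentially"
      by (intro uniform_limit_frac_int \<alpha> continuous_intros U u m)
    from tendsto_uniform_limitI[OF this t]
    have "(\<lambda>k. U (Suc k) t) \<longlonglongrightarrow> h t - frac_int \<alpha> (\<lambda>s. m s * u s) t"
      unfolding US by (intro tendsto_intros)
    moreover have "(\<lambda>k. U (Suc k) t) \<longlonglongrightarrow> u t"
      using tendsto_uniform_limitI[OF lim t] by (rule LIMSEQ_Suc)
    ultimately show "u t = h t - frac_int \<alpha> (\<lambda>s. m s * u s) t"
      by (rule LIMSEQ_unique[symmetric])
  qed
qed

text \<open>The difference of two solutions is minus its own Volterra image, so its weighted bound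
  can be halved arbitrarily often.\<close>

lemma frac_volterra_unique:
  assumes \<alpha>: "0 < \<alpha>" and m: "continuous_on {0..T} m"
    and u: "continuous_on {0..T} u" "\<And>t. t \<in> {0..T} \<Longrightarrow> u t = h t - frac_int \<alpha> (\<lambda>s. m s * u s) t"
    and v: "continuous_on {0..T} v" "\<And>t. t \<in> {0..T} \<Longrightarrow> v t = h t - frac_int \<alpha> (\<lambda>s. m s * v s) t"
    and t: "t \<in> {0..T}"
  shows "u t = v t"
proof -
  obtain \<kappa> where \<kappa>: "0 < \<kappa>" and contr: "\<And>w M t. \<lbrakk>continuous_on {0..T} w; \<And>s. s \<in> {0..T} \<Longrightarrow> \<bar>w s\<bar> \<le> M * exp (\<kappa> * s); t \<in> {0..T}\<rbrakk>
      \<Longrightarrow> \<bar>frac_int \<alpha> (\<lambda>s. m s * w s) t\<bar> \<le> M / 2 * exp (\<kappa> * t)"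
    using frac_int_contraction[OF \<alpha> m] by blast
  define w where "w = (\<lambda>s. u s - v s)"
  have w: "continuous_on {0..T} w"
    unfolding w_def by (intro continuous_intros u v)
  have w_eq: "w s = - frac_int \<alpha> (\<lambda>s. m s * w s) s" if s: "s \<in> {0..T}" for s
  proof -
    have sub: "{0..s} \<subseteq> {0..T}" using s by auto
    have "frac_integrable \<alpha> (\<lambda>s. m s * u s) s" "frac_integrable \<alpha> (\<lambda>s. m s * v s) s"
      by (intro frac_integrable_continuous \<alpha> continuous_intros continuous_on_subset[OF m sub]
        continuous_on_subset[OF u(1) sub] continuous_on_subset[OF v(1) sub])+
    then show ?thesis
      unfolding w_def right_diff_distrib using u(2)[OF s] v(2)[OF s] by (simp add: frac_int_diff)
  qed
  obtain M where M0: "0 \<le> M" and M: "\<And>s. s \<in> {0..T} \<Longrightarrow> \<bar>w s\<bar> \<le> M"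
    using continuous_on_Icc_bounded[OF w] by blast
  have "\<bar>w s\<bar> \<le> M * (1 / 2) ^ k * exp (\<kappa> * s)" if "s \<in> {0..T}" for k s
    using that
  proof (induction k arbitrary: s)
    case 0
    have "1 \<le> exp (\<kappa> * s)" using 0 \<kappa> by simp
    then have "M * 1 \<le> M * exp (\<kappa> * s)" using M0 by (intro mult_left_mono) auto
    then show ?case using M[OF 0] by simp
  next
    case (Suc k)
    have "\<bar>w s\<bar> \<le> (M * (1 / 2) ^ k) / 2 * exp (\<kappa> * s)"
      unfolding w_eq[OF Suc.prems] abs_minus_cancel by (intro contr w Suc.IH Suc.prems)
    then show ?case by simp
  qed
  note bnd = this[OF t]
  have "(\<lambda>k. M * (1 / 2) ^ k * exp (\<kappa> * t)) \<longlonglongrightarrow> M * 0 * exp (\<kappa> * t)"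
    by (intro tendsto_intros) simp
  then have "\<bar>w t\<bar> \<le> M * 0 * exp (\<kappa> * t)"
    by (rule LIMSEQ_le_const) (use bnd in auto)
  then show ?thesis by (simp add: w_def)
qed

text \<open>Alikhanov's inequality is applied to v = u - b, which starts at 0; adding b^2 + 2 b v
  gives u^2 \<le> b^2 + 2 I^\<alpha>(u g). Then u g \<le> f^2 / (4 \<mu> q), and multiplying by
  \<mu> cancels the 1 / \<mu>. The constant 1 / (2 q) is thus the same for all eigenvalues, as
  summing over the modes requires.\<close>

lemma frac_volterra_square_le:
  assumes \<alpha>: "0 < \<alpha>" "\<alpha> < 1" and a: "continuous_on {0..T} a" "\<And>t. t \<in> {0..T} \<Longrightarrow> q \<le> a t" and q: "0 < q"
    and \<mu>: "0 < \<mu>" and f: "continuous_on {0..T} f" and u: "continuous_on {0..T} u"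
    and eq: "\<And>t. t \<in> {0..T} \<Longrightarrow> u t = b + frac_int \<alpha> (\<lambda>s. f s - \<mu> * a s * u s) t"
    and t: "t \<in> {0..T}"
  shows "\<mu> * (u t)\<^sup>2 \<le> \<mu> * b\<^sup>2 + 1 / (2 * q) * frac_int \<alpha> (\<lambda>s. (f s)\<^sup>2) t"
proof -
  define g where "g = (\<lambda>s. f s - \<mu> * a s * u s)"
  define v where "v = frac_int \<alpha> g"
  have g: "continuous_on {0..T} g"
    unfolding g_def by (intro continuous_intros a f u)
  have v: "continuous_on {0..T} v"
    unfolding v_def by (rule continuous_on_frac_int[OF \<alpha>(1) g])
  have uv: "u s = b + v s" if "s \<in> {0..T}" for s
    using eq[OF that] by (simp add: v_def g_def)
  have int: "frac_integrable \<alpha> w t" if "continuous_on {0..T} w" for w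
    by (intro frac_integrable_continuous \<alpha> continuous_on_subset[OF that]) (use t in auto)
  have "(v t)\<^sup>2 \<le> 2 * frac_int \<alpha> (\<lambda>s. v s * g s) t"
    unfolding v_def by (rule frac_int_square_le[OF \<alpha> g t])
  then have "(u t)\<^sup>2 \<le> b\<^sup>2 + 2 * (b * v t + frac_int \<alpha> (\<lambda>s. v s * g s) t)"
    by (simp add: uv[OF t] power2_sum)
  also have "b * v t + frac_int \<alpha> (\<lambda>s. v s * g s) t = frac_int \<alpha> (\<lambda>s. b * g s + v s * g s) t"
    by (subst frac_int_add) (auto simp: frac_int_cmult v_def[symmetric] intro!: int continuous_intros g v)
  also have "\<dots> \<le> frac_int \<alpha> (\<lambda>s. 1 / (4 * \<mu> * q) * (f s)\<^sup>2) t"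
  proof (intro frac_int_mono \<alpha> int continuous_intros g v f)
    fix s assume "0 < s" "s \<le> t"
    then have s: "s \<in> {0..T}" using t by auto
    have "b * g s + v s * g s = f s * u s - \<mu> * a s * (u s)\<^sup>2"
      using uv[OF s] by (simp add: g_def algebra_simps power2_eq_square)
    also have "\<dots> \<le> f s * u s - \<mu> * q * (u s)\<^sup>2"
      using a(2)[OF s] \<mu> by (simp add: mult_left_mono mult_right_mono)
    also have "\<dots> \<le> 1 / (4 * \<mu> * q) * (f s)\<^sup>2"
    proof -
      \<comment> \<open>The maximum of f u - \<mu> q u^2 over u is attained at u = f / (2 \<mu> q),
        where this square vanishes.\<close>
      have "0 \<le> (f s - 2 * \<mu> * q * u s)\<^sup>2" by simp
      then have "4 * \<mu> * q * (f s * u s - \<mu> * q * (u s)\<^sup>2) \<le> (f s)\<^sup>2"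
        by (simp add: power2_diff algebra_simps power2_eq_square)
      then show ?thesis using \<mu> q by (simp add: field_simps)
    qed
    finally show "b * g s + v s * g s \<le> 1 / (4 * \<mu> * q) * (f s)\<^sup>2" .
  qed
  finally have "(u t)\<^sup>2 \<le> b\<^sup>2 + 1 / (2 * \<mu> * q) * frac_int \<alpha> (\<lambda>s. (f s)\<^sup>2) t"
    unfolding frac_int_cmult by simp
  then have "\<mu> * (u t)\<^sup>2 \<le> \<mu> * (b\<^sup>2 + 1 / (2 * \<mu> * q) * frac_int \<alpha> (\<lambda>s. (f s)\<^sup>2) t)"
    using \<mu> by (intro mult_left_mono) auto
  then show ?thesis using \<mu> by (simp add: distrib_left)
qed

section \<open>Caputo derivatives as inverses of fractional integrals\<close>

text \<open>By the semigroup law the Caputo potential is I^(1 - \<alpha>) I^\<alpha> D = I^1 D,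
  whose derivative is D.\<close>

lemma has_caputo_deriv_frac_int:
  assumes \<alpha>: "0 < \<alpha>" "\<alpha> < 1" and D: "continuous_on {0..T} D"
    and y: "\<And>t. t \<in> {0..T} \<Longrightarrow> y t = b + frac_int \<alpha> D t"
  shows "has_caputo_deriv \<alpha> T y D {0..T}"
  unfolding has_caputo_deriv_def
proof (intro conjI ballI)
  have "continuous_on {0..T} (\<lambda>t. b + frac_int \<alpha> D t)"
    by (intro continuous_intros continuous_on_frac_int \<alpha> D)
  then show "continuous_on {0..T} y"
    by (rule continuous_on_eq) (simp add: y)
  fix t assume t: "t \<in> {0..T}"
  show "(caputo_potential \<alpha> y has_real_derivative D t) (at t within {0..T})"
  proof (rule has_field_derivative_transform_within[OF frac_int_1_has_real_derivative[OF D t] zero_less_one t])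
    fix s assume s: "s \<in> {0..T}"
    have "caputo_potential \<alpha> y s = frac_int (1 - \<alpha>) (frac_int \<alpha> D) s"
      unfolding caputo_potential_eq_frac_int
      by (rule frac_int_cong) (use s in \<open>auto simp: y\<close>)
    then show "frac_int 1 D s = caputo_potential \<alpha> y s"
      using frac_int_semigroup[of \<alpha> "1 - \<alpha>" T D s] \<alpha> D s by simp
  qed
qed

text \<open>Abel inversion. I^(1 - \<alpha>)(y - y 0) and I^1 D have the same derivative in the
  interior and both vanish at 0, so I^(1 - \<alpha>) annihilates w = y - y 0 - I^\<alpha> D.
  Applying I^\<alpha> gives I^1 w = 0, and differentiation gives w = 0. The Caputo derivative is
  prescribed on (0,T] only, as in the weak formulation.\<close>

lemma caputo_deriv_imp_frac_int:
  assumes \<alpha>: "0 < \<alpha>" "\<alpha> < 1" and T: "0 < T" and D: "continuous_on {0..T} D"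
    and y: "has_caputo_deriv \<alpha> T y D {0<..T}" and t: "t \<in> {0..T}"
  shows "y t = y 0 + frac_int \<alpha> D t"
proof -
  have yc: "continuous_on {0..T} y"
    using y by (simp add: has_caputo_deriv_def)
  define w where "w = (\<lambda>s. (y s - y 0) - frac_int \<alpha> D s)"
  have JD: "continuous_on {0..T} (frac_int \<alpha> D)"
    by (rule continuous_on_frac_int[OF \<alpha>(1) D])
  have y0: "continuous_on {0..T} (\<lambda>s. y s - y 0)"
    by (intro continuous_intros yc)
  have w: "continuous_on {0..T} w"
    unfolding w_def by (intro continuous_intros yc JD)
  have pot: "frac_int (1 - \<alpha>) (\<lambda>s. y s - y 0) r = frac_int 1 D r" if r: "r \<in> {0..T}" for r
  proof -
    have sub: "{0..r} \<subseteq> {0..T}" using r by auto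
    have "(D has_integral caputo_potential \<alpha> y r - caputo_potential \<alpha> y 0) {0..r}"
    proof (rule fundamental_theorem_of_calculus_interior)
      show "continuous_on {0..r} (caputo_potential \<alpha> y)"
        unfolding caputo_potential_eq_frac_int[abs_def]
        using \<alpha> by (intro continuous_on_subset[OF continuous_on_frac_int[OF _ y0] sub]) auto
      fix s assume s: "s \<in> {0<..<r}"
      then have "(caputo_potential \<alpha> y has_real_derivative D s) (at s within {0..T})"
        using y r by (auto simp: has_caputo_deriv_def)
      moreover have "at s within {0..T} = at s"
        using s r by (intro at_within_Icc_at) auto
      ultimately show "(caputo_potential \<alpha> y has_vector_derivative D s) (at s)"
        by (simp add: has_real_derivative_iff_has_vector_derivative)
    qed (use r in simp)
    moreover have "set_integrable lborel {0..r} D"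
      by (intro borel_integrable_atLeastAtMost' continuous_on_subset[OF D sub])
    ultimately show ?thesis
      by (simp add: caputo_potential_eq_frac_int frac_int_1 set_borel_integral_eq_integral(2) integral_unique)
  qed
  have zero: "frac_int 1 w r = 0" if r: "r \<in> {0..T}" for r
  proof -
    have "frac_int (1 - \<alpha>) w s = 0" if s: "0 < s" "s \<le> r" for s
    proof -
      have sT: "s \<in> {0..T}" and sub: "{0..s} \<subseteq> {0..T}" using s r by auto
      have "frac_int (1 - \<alpha>) w s = frac_int (1 - \<alpha>) (\<lambda>s. y s - y 0) s - frac_int (1 - \<alpha>) (frac_int \<alpha> D) s"
        unfolding w_def using \<alpha>
        by (intro frac_int_diff frac_integrable_continuous continuous_on_subset[OF y0 sub] continuous_on_subset[OF JD sub]) auto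
      also have "frac_int (1 - \<alpha>) (frac_int \<alpha> D) s = frac_int 1 D s"
        using frac_int_semigroup[of \<alpha> "1 - \<alpha>" T D s] \<alpha> D sT by simp
      finally show ?thesis using pot[OF sT] by simp
    qed
    then have "frac_int \<alpha> (frac_int (1 - \<alpha>) w) r = frac_int \<alpha> (\<lambda>_. 0) r"
      by (intro frac_int_cong)
    moreover have "frac_int \<alpha> (\<lambda>_. 0) r = 0" by (simp add: frac_int_def)
    ultimately show ?thesis
      using frac_int_semigroup[of "1 - \<alpha>" \<alpha> T w r] \<alpha> w r by simp
  qed
  have "((\<lambda>_. 0) has_real_derivative w t) (at t within {0..T})"
    by (rule has_field_derivative_transform_within[OF frac_int_1_has_real_derivative[OF w t] zero_less_one t]) (rule zero)
  moreover have "((\<lambda>_. 0) has_real_derivative 0) (at t within {0..T})"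
    by (rule DERIV_const)
  \<comment> \<open>Derivatives within [0,T] are unique, at the end points too, because 0 <
    T.\<close>
  ultimately have "w t = 0"
    using vector_derivative_unique_within_closed_interval[of 0 T t "\<lambda>_. 0::real" "w t" 0] T t
    by (simp add: has_real_derivative_iff_has_vector_derivative)
  then show ?thesis by (simp add: w_def)
qed

lemma frac_ode_solution_iff:
  assumes \<alpha>: "0 < \<alpha>" "\<alpha> < 1" and T: "0 < T" and a: "continuous_on {0..T} a" and f: "continuous_on {0..T} f"
  shows "frac_ode_solution \<alpha> T a \<mu> f b y \<longleftrightarrow>
    continuous_on {0..T} y \<and> (\<forall>t\<in>{0..T}. y t = b + frac_int \<alpha> (\<lambda>s. f s - \<mu> * a s * y s) t)"
proof (intro iffI conjI ballI)
  assume sol: "frac_ode_solution \<alpha> T a \<mu> f b y"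
  then obtain D where D: "has_caputo_deriv \<alpha> T y D {0..T}" "continuous_on {0..T} D" "\<And>t. t \<in> {0..T} \<Longrightarrow> D t + \<mu> * a t * y t = f t"
    and y0: "y 0 = b" by (auto simp: frac_ode_solution_def)
  show "continuous_on {0..T} y" using sol by (simp add: frac_ode_solution_def)
  fix t assume t: "t \<in> {0..T}"
  have "y t = y 0 + frac_int \<alpha> D t"
    by (rule caputo_deriv_imp_frac_int[OF \<alpha> T D(2) _ t]) (use D(1) in \<open>auto simp: has_caputo_deriv_def\<close>)
  also have "frac_int \<alpha> D t = frac_int \<alpha> (\<lambda>s. f s - \<mu> * a s * y s) t"
  proof (rule frac_int_cong)
    fix s assume "0 < s" "s \<le> t"
    then show "D s = f s - \<mu> * a s * y s" using D(3)[of s] t by simp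
  qed
  finally show "y t = b + frac_int \<alpha> (\<lambda>s. f s - \<mu> * a s * y s) t" by (simp add: y0)
next
  assume *: "continuous_on {0..T} y \<and> (\<forall>t\<in>{0..T}. y t = b + frac_int \<alpha> (\<lambda>s. f s - \<mu> * a s * y s) t)"
  have D: "continuous_on {0..T} (\<lambda>s. f s - \<mu> * a s * y s)"
    using * by (intro continuous_intros f a) auto
  have "has_caputo_deriv \<alpha> T y (\<lambda>s. f s - \<mu> * a s * y s) {0..T}"
    by (rule has_caputo_deriv_frac_int[OF \<alpha> D]) (use * in auto)
  moreover have "y 0 = b" using * T by simp
  ultimately show "frac_ode_solution \<alpha> T a \<mu> f b y"
    unfolding frac_ode_solution_def using * D by (intro conjI exI[of _ "\<lambda>s. f s - \<mu> * a s * y s"]) auto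
qed


lemma frac_ode_solution_exists:
  assumes \<alpha>: "0 < \<alpha>" "\<alpha> < 1" and T: "0 < T" and a: "continuous_on {0..T} a" and f: "continuous_on {0..T} f"
  obtains y where "frac_ode_solution \<alpha> T a \<mu> f b y"
proof -
  have m: "continuous_on {0..T} (\<lambda>s. \<mu> * a s)" by (intro continuous_intros a)
  have h: "continuous_on {0..T} (\<lambda>t. b + frac_int \<alpha> f t)" by (intro continuous_intros continuous_on_frac_int \<alpha> f)
  obtain y where y: "continuous_on {0..T} y" "\<And>t. t \<in> {0..T} \<Longrightarrow> y t = b + frac_int \<alpha> f t - frac_int \<alpha> (\<lambda>s. \<mu> * a s * y s) t"
    using frac_volterra_exists[OF \<alpha>(1) m h] by blast
  have "y t = b + frac_int \<alpha> (\<lambda>s. f s - \<mu> * a s * y s) t" if t: "t \<in> {0..T}" for t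
  proof -
    have sub: "{0..t} \<subseteq> {0..T}" using t by auto
    have "frac_int \<alpha> (\<lambda>s. f s - \<mu> * a s * y s) t = frac_int \<alpha> f t - frac_int \<alpha> (\<lambda>s. \<mu> * a s * y s) t"
      by (intro frac_int_diff frac_integrable_continuous \<alpha> continuous_intros continuous_on_subset[OF f sub]
          continuous_on_subset[OF a sub] continuous_on_subset[OF y(1) sub])
    with y(2)[OF t] show ?thesis by simp
  qed
  then show ?thesis
    using y(1) by (intro that[of y]) (simp add: frac_ode_solution_iff[OF \<alpha> T a f])
qed

lemma frac_ode_solution_unique:
  assumes \<alpha>: "0 < \<alpha>" "\<alpha> < 1" and T: "0 < T" and a: "continuous_on {0..T} a" and f: "continuous_on {0..T} f"
    and y: "frac_ode_solution \<alpha> T a \<mu> f b y" and z: "frac_ode_solution \<alpha> T a \<mu> f b z" and t: "t \<in> {0..T}"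
  shows "y t = z t"
proof (rule frac_volterra_unique[OF \<alpha>(1) _ _ _ _ _ t])
  show "continuous_on {0..T} (\<lambda>s. \<mu> * a s)" by (intro continuous_intros a)
  have eq: "w t = (b + frac_int \<alpha> f t) - frac_int \<alpha> (\<lambda>s. \<mu> * a s * w s) t" and c: "continuous_on {0..T} w"
    if w: "frac_ode_solution \<alpha> T a \<mu> f b w" and t: "t \<in> {0..T}" for w t
  proof -
    have wc: "continuous_on {0..T} w" and w: "w t = b + frac_int \<alpha> (\<lambda>s. f s - \<mu> * a s * w s) t"
      using w t by (auto simp: frac_ode_solution_iff[OF \<alpha> T a f])
    show "continuous_on {0..T} w" by (rule wc)
    have sub: "{0..t} \<subseteq> {0..T}" using t by auto
    have "frac_int \<alpha> (\<lambda>s. f s - \<mu> * a s * w s) t = frac_int \<alpha> f t - frac_int \<alpha> (\<lambda>s. \<mu> * a s * w s) t"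
      by (intro frac_int_diff frac_integrable_continuous \<alpha> continuous_intros continuous_on_subset[OF f sub]
          continuous_on_subset[OF a sub] continuous_on_subset[OF wc sub])
    with w show "w t = (b + frac_int \<alpha> f t) - frac_int \<alpha> (\<lambda>s. \<mu> * a s * w s) t" by simp
  qed
  show "continuous_on {0..T} y" "continuous_on {0..T} z" using c[OF y t] c[OF z t] by auto
  show "y t = (b + frac_int \<alpha> f t) - frac_int \<alpha> (\<lambda>s. \<mu> * a s * y s) t" if "t \<in> {0..T}" for t by (rule eq[OF y that])
  show "z t = (b + frac_int \<alpha> f t) - frac_int \<alpha> (\<lambda>s. \<mu> * a s * z s) t" if "t \<in> {0..T}" for t by (rule eq[OF z that])
qed


section \<open>Mollification\<close>

lemma sum_axis_mult:
  fixes g :: "'d::finite \<Rightarrow> real"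
  shows "(\<Sum>j\<in>UNIV. axis i 1 $ j * g j) = g i"
proof -
  have "axis i 1 $ j * g j = (if j = i then g j else 0)" for j
    by (simp add: axis_def)
  then show ?thesis by simp
qed

lemma has_derivative_partial_deriv:
  fixes f :: "real^'d::finite \<Rightarrow> real"
  assumes "f differentiable (at x)"
  shows "(f has_derivative (\<lambda>h. \<Sum>i\<in>UNIV. h $ i * partial_deriv i f x)) (at x)"
proof -
  have f: "(f has_derivative frechet_derivative f (at x)) (at x)"
    using assms by (simp add: frechet_derivative_works)
  interpret linear "frechet_derivative f (at x)"
    using f by (rule has_derivative_linear)
  have "frechet_derivative f (at x) h = (\<Sum>i\<in>UNIV. h $ i * partial_deriv i f x)" for h
  proof -
    have "frechet_derivative f (at x) h = frechet_derivative f (at x) (\<Sum>i\<in>UNIV. h $ i *\<^sub>R axis i 1)"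
      using basis_expansion[of h] by (simp add: scalar_mult_eq_scaleR)
    then show ?thesis
      by (simp add: sum scale partial_deriv_def)
  qed
  then have "frechet_derivative f (at x) = (\<lambda>h. \<Sum>i\<in>UNIV. h $ i * partial_deriv i f x)"
    by (rule ext)
  with f show ?thesis by simp
qed

lemma partial_deriv_eqI:
  assumes "(f has_derivative f') (at x)"
  shows "partial_deriv i f x = f' (axis i 1)"
  using frechet_derivative_at[OF assms] by (simp add: partial_deriv_def)

lemma partial_deriv_mult:
  fixes f g :: "real^'d::finite \<Rightarrow> real"
  assumes f: "f differentiable (at x)" and g: "g differentiable (at x)"
  shows "partial_deriv i (\<lambda>x. f x * g x) x = partial_deriv i f x * g x + f x * partial_deriv i g x"
proof -
  have "((\<lambda>x. f x * g x) has_derivative (\<lambda>h. f x * frechet_derivative g (at x) h + frechet_derivative f (at x) h * g x)) (at x)"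
    using f g by (intro has_derivative_mult) (simp_all add: frechet_derivative_works)
  from partial_deriv_eqI[OF this] show ?thesis by (simp add: partial_deriv_def add.commute)
qed

lemma partial_deriv_add:
  fixes f g :: "real^'d::finite \<Rightarrow> real"
  assumes f: "f differentiable (at x)" and g: "g differentiable (at x)"
  shows "partial_deriv i (\<lambda>x. f x + g x) x = partial_deriv i f x + partial_deriv i g x"
proof -
  have "((\<lambda>x. f x + g x) has_derivative (\<lambda>h. frechet_derivative f (at x) h + frechet_derivative g (at x) h)) (at x)"
    using f g by (intro has_derivative_add) (simp_all add: frechet_derivative_works)
  from partial_deriv_eqI[OF this] show ?thesis by (simp add: partial_deriv_def)
qed

lemma partial_deriv_transform:
  assumes "open X" "x \<in> X" "\<And>y. y \<in> X \<Longrightarrow> f y = g y" "f differentiable (at x)"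
  shows "partial_deriv i f x = partial_deriv i g x"
  using frechet_derivative_transform_within_open[OF assms(4,1,2,3)] by (simp add: partial_deriv_def)

text \<open>\<open>Ck_on (Suc k)\<close> does not list continuity of f itself; at the bottom of the
  recursion it comes from differentiability.\<close>

lemma Ck_on_Suc_imp: "Ck_on (Suc k) S f \<Longrightarrow> Ck_on k S f"
proof (induction k arbitrary: f)
  case 0
  then show ?case
    by (auto intro!: continuous_at_imp_continuous_on differentiable_imp_continuous_within)
next
  case (Suc k)
  then show ?case by simp
qed

lemma Ck_on_add:
  fixes f g :: "real^'d::finite \<Rightarrow> real"
  shows "Ck_on k UNIV f \<Longrightarrow> Ck_on k UNIV g \<Longrightarrow> Ck_on k UNIV (\<lambda>x. f x + g x)"
proof (induction k arbitrary: f g)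
  case (Suc k)
  then have "partial_deriv i (\<lambda>x. f x + g x) = (\<lambda>x. partial_deriv i f x + partial_deriv i g x)" for i
    by (auto simp: partial_deriv_add)
  with Suc show ?case by (auto intro!: Suc.IH)
qed (simp add: continuous_on_add)

lemma Ck_on_mult:
  fixes f g :: "real^'d::finite \<Rightarrow> real"
  shows "Ck_on k UNIV f \<Longrightarrow> Ck_on k UNIV g \<Longrightarrow> Ck_on k UNIV (\<lambda>x. f x * g x)"
proof (induction k arbitrary: f g)
  case (Suc k)
  then have "partial_deriv i (\<lambda>x. f x * g x) = (\<lambda>x. partial_deriv i f x * g x + f x * partial_deriv i g x)" for i
    by (auto simp: partial_deriv_mult)
  with Suc show ?case
    using Ck_on_Suc_imp[OF Suc.prems(1)] Ck_on_Suc_imp[OF Suc.prems(2)]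
    by (auto intro!: Ck_on_add Suc.IH)
qed (simp add: continuous_on_mult)

lemma Ck_on_const:
  fixes S :: "(real^'d::finite) set"
  shows "Ck_on k S (\<lambda>x. c)"
proof (induction k arbitrary: c)
  case (Suc k)
  have "partial_deriv i (\<lambda>x. c) = (\<lambda>x. 0)" for i :: 'd
    by (simp add: partial_deriv_def fun_eq_iff)
  then show ?case using Suc by simp
qed simp

lemma Ck_on_affine:
  fixes f :: "real^'d::finite \<Rightarrow> real"
  shows "Ck_on k UNIV f \<Longrightarrow> Ck_on k UNIV (\<lambda>x. f (x0 + s *\<^sub>R x))"
proof (induction k arbitrary: f)
  case 0
  then show ?case by (auto intro!: continuous_on_compose2[of UNIV f] continuous_intros)
next
  case (Suc k)
  have D: "((\<lambda>x. f (x0 + s *\<^sub>R x)) has_derivative (\<lambda>h. \<Sum>i\<in>UNIV. (s *\<^sub>R h) $ i * partial_deriv i f (x0 + s *\<^sub>R x))) (at x)" for x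
  proof (rule has_derivative_compose[of "\<lambda>x. x0 + s *\<^sub>R x"])
    show "((\<lambda>x. x0 + s *\<^sub>R x) has_derivative (*\<^sub>R) s) (at x)"
      by (auto intro!: derivative_eq_intros)
    show "(f has_derivative (\<lambda>h. \<Sum>i\<in>UNIV. h $ i * partial_deriv i f (x0 + s *\<^sub>R x))) (at (x0 + s *\<^sub>R x))"
      using Suc.prems by (intro has_derivative_partial_deriv) simp
  qed
  have "partial_deriv i (\<lambda>x. f (x0 + s *\<^sub>R x)) = (\<lambda>x. s * partial_deriv i f (x0 + s *\<^sub>R x))" for i
    using partial_deriv_eqI[OF D] by (simp add: fun_eq_iff mult.assoc sum_distrib_left[symmetric] sum_axis_mult)
  then show ?case
    using Suc D by (auto simp: differentiable_def intro!: Ck_on_mult Ck_on_const)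
qed

section \<open>Convolution and mollifiers\<close>

text \<open>Differentiation under the integral sign; the derivative falls on \<rho>, so continuity
  of \<zeta> suffices.\<close>

lemma
  fixes \<zeta> \<rho> :: "real^'d::finite \<Rightarrow> real" and a b :: "real^'d"
  assumes \<zeta>: "continuous_on UNIV \<zeta>" and \<rho>: "Ck_on (Suc 0) UNIV \<rho>"
  defines "C \<equiv> \<lambda>\<rho> x. integral (cbox a b) (\<lambda>z. \<zeta> z * \<rho> (x - z))"
  shows convolution_differentiable: "C \<rho> differentiable (at x)"
    and partial_deriv_convolution: "partial_deriv i (C \<rho>) x = C (partial_deriv i \<rho>) x"
proof -
  have cont: "continuous_on UNIV \<rho>" "continuous_on UNIV (partial_deriv i \<rho>)" for i
    using \<rho> Ck_on_Suc_imp[OF \<rho>] by auto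
  \<comment> \<open>The total derivative in x as a bounded linear map, the form in which
    \<open>leibniz_rule\<close> takes it.\<close>
  define fx where "fx = (\<lambda>x z. \<Sum>i\<in>UNIV. (\<zeta> z * partial_deriv i \<rho> (x - z)) *\<^sub>R blinfun_inner_left (axis i (1::real)))"
  have fx_apply: "blinfun_apply (fx x z) h = (\<Sum>i\<in>UNIV. h $ i * (\<zeta> z * partial_deriv i \<rho> (x - z)))" for x z h
    by (simp add: fx_def blinfun.sum_left blinfun.scaleR_left inner_axis mult.commute)
  have fx_cont: "continuous_on (UNIV \<times> cbox a b) (\<lambda>(x, z). fx x z)"
    unfolding fx_def case_prod_unfold
    by (intro continuous_intros continuous_on_compose2[OF \<zeta>] continuous_on_compose2[OF cont(2)]) auto
  have int: "(\<lambda>z. \<zeta> z * w (x - z)) integrable_on cbox a b" if "continuous_on UNIV w" for w x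
    by (intro integrable_continuous continuous_intros continuous_on_compose2[OF \<zeta>] continuous_on_compose2[OF that]) auto
  have fx_int: "fx x integrable_on cbox a b" for x
    unfolding fx_def
    by (intro integrable_continuous continuous_intros continuous_on_compose2[OF \<zeta>] continuous_on_compose2[OF cont(2)]) auto
  have "(C \<rho> has_derivative integral (cbox a b) (fx x)) (at x within UNIV)" for x
    unfolding C_def
  proof (rule leibniz_rule[OF _ int[OF cont(1)] fx_cont])
    fix x z
    have "((\<lambda>x. \<rho> (x - z)) has_derivative (\<lambda>h. \<Sum>i\<in>UNIV. h $ i * partial_deriv i \<rho> (x - z))) (at x)"
    proof (rule has_derivative_compose[of "\<lambda>x. x - z"])
      show "((\<lambda>x. x - z) has_derivative (\<lambda>h. h)) (at x)"
        by (auto intro!: derivative_eq_intros)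
      show "(\<rho> has_derivative (\<lambda>h. \<Sum>i\<in>UNIV. h $ i * partial_deriv i \<rho> (x - z))) (at (x - z))"
        using \<rho> by (intro has_derivative_partial_deriv) simp
    qed
    from has_derivative_mult_right[OF this, of "\<zeta> z"]
    show "((\<lambda>x. \<zeta> z * \<rho> (x - z)) has_derivative blinfun_apply (fx x z)) (at x within UNIV)"
      by (rule has_derivative_eq_rhs) (simp add: fx_apply fun_eq_iff sum_distrib_left mult_ac)
  qed auto
  then have D: "(C \<rho> has_derivative integral (cbox a b) (fx x)) (at x)" for x by simp
  then show "C \<rho> differentiable (at x)"
    unfolding differentiable_def by blast
  have "partial_deriv i (C \<rho>) x = integral (cbox a b) (\<lambda>z. blinfun_apply (fx x z) (axis i 1))"
    unfolding partial_deriv_eqI[OF D] by (rule blinfun_apply_integral[OF fx_int])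
  also have "\<dots> = C (partial_deriv i \<rho>) x"
    unfolding fx_apply C_def by (simp add: sum_axis_mult)
  finally show "partial_deriv i (C \<rho>) x = C (partial_deriv i \<rho>) x" .
qed

text \<open>The induction varies \<rho> and assumes it smooth, because each step replaces \<rho> by
  one of its partial derivatives.\<close>

lemma Ck_on_convolution:
  fixes \<zeta> \<rho> :: "real^'d::finite \<Rightarrow> real"
  assumes \<zeta>: "continuous_on UNIV \<zeta>"
  shows "(\<And>k. Ck_on k UNIV \<rho>) \<Longrightarrow> Ck_on k UNIV (\<lambda>x. integral (cbox a b) (\<lambda>z. \<zeta> z * \<rho> (x - z)))"
proof (induction k arbitrary: \<rho>)
  case 0
  show ?case
    using convolution_differentiable[OF \<zeta> 0[of "Suc 0"], of a b]
    by (auto intro!: continuous_at_imp_continuous_on differentiable_imp_continuous_within)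
next
  case (Suc k)
  have "partial_deriv i (\<lambda>x. integral (cbox a b) (\<lambda>z. \<zeta> z * \<rho> (x - z))) = (\<lambda>x. integral (cbox a b) (\<lambda>z. \<zeta> z * partial_deriv i \<rho> (x - z)))" for i
    using partial_deriv_convolution[OF \<zeta> Suc.prems[of "Suc 0"]] by blast
  moreover have "Ck_on k UNIV (partial_deriv i \<rho>)" for k i
    using Suc.prems[of "Suc k"] by simp
  ultimately show ?case
    using convolution_differentiable[OF \<zeta> Suc.prems[of "Suc 0"], of a b] Suc.IH by simp
qed

text \<open>One form puts derivatives on the mollifier and shows smoothness; the other puts them on
  the mollified function and shows approximation. The boxes contain the supports, so neither
  integral loses mass under z = x - y.\<close>

lemma convolution_flip:
  fixes \<zeta> \<rho> :: "'a::euclidean_space \<Rightarrow> real"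
  assumes \<zeta>: "\<And>z. z \<notin> cbox a b \<Longrightarrow> \<zeta> z = 0" and \<rho>: "\<And>y. y \<notin> cbox c d \<Longrightarrow> \<rho> y = 0"
  shows "integral (cbox a b) (\<lambda>z. \<zeta> z * \<rho> (x - z)) = integral (cbox c d) (\<lambda>y. \<rho> y * \<zeta> (x - y))"
proof -
  let ?f = "\<lambda>z. \<zeta> z * \<rho> (x - z)"
  have eq_UNIV: "integral S g = integral UNIV g" if "\<And>y. y \<notin> S \<Longrightarrow> g y = 0" for S and g :: "'a \<Rightarrow> real"
  proof -
    have "g = (\<lambda>y. if y \<in> S then g y else 0)" using that by auto
    then show ?thesis using integral_restrict_UNIV[of S g] by metis
  qed
  have "integral (cbox a b) ?f = integral (cbox (a - x) (b - x)) (?f \<circ> (+) x)"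
    using integral_shift_cbox_plus[of "a - x" "b - x" ?f x] by simp
  also have "\<dots> = integral (cbox (- (b - x)) (- (a - x))) (\<lambda>y. (?f \<circ> (+) x) (- y))"
    by (rule integral_reflect[symmetric])
  also have "\<dots> = integral (cbox (x - b) (x - a)) (\<lambda>y. \<rho> y * \<zeta> (x - y))"
    by (simp add: mult.commute)
  also have "\<dots> = integral UNIV (\<lambda>y. \<rho> y * \<zeta> (x - y))"
  proof (rule eq_UNIV)
    fix y assume "y \<notin> cbox (x - b) (x - a)"
    then have "x - y \<notin> cbox a b" by (auto simp: mem_box inner_diff_left) (metis add.commute le_diff_eq diff_le_eq)+
    then show "\<rho> y * \<zeta> (x - y) = 0" using \<zeta> by simp
  qed
  also have "\<dots> = integral (cbox c d) (\<lambda>y. \<rho> y * \<zeta> (x - y))"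
    by (rule eq_UNIV[symmetric]) (use \<rho> in simp)
  finally show ?thesis .
qed

text \<open>Heine-Cantor on the ball of radius R + 1, where R bounds K: with \<delta> at most 1,
  either both points lie in this ball or w vanishes at both.\<close>

lemma uniformly_continuous_compact_support:
  fixes w :: "'a::euclidean_space \<Rightarrow> real"
  assumes w: "continuous_on UNIV w" and K: "compact K" "\<And>x. x \<notin> K \<Longrightarrow> w x = 0" and e: "0 < e"
  obtains \<delta> where "0 < \<delta>" "\<And>x y. dist x y < \<delta> \<Longrightarrow> \<bar>w x - w y\<bar> < e"
proof -
  obtain R where R: "\<And>x. x \<in> K \<Longrightarrow> norm x \<le> R"
    using compact_imp_bounded[OF K(1)] by (auto simp: bounded_iff)
  have "uniformly_continuous_on (cball 0 (R + 1)) w"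
    by (intro compact_uniformly_continuous continuous_on_subset[OF w]) auto
  then obtain \<delta> where \<delta>: "0 < \<delta>" "\<And>x y. x \<in> cball 0 (R + 1) \<Longrightarrow> y \<in> cball 0 (R + 1) \<Longrightarrow> dist y x < \<delta> \<Longrightarrow> dist (w y) (w x) < e"
    using e unfolding uniformly_continuous_on_def by metis
  show ?thesis
  proof (rule that[of "min \<delta> 1"])
    fix x y :: 'a assume xy: "dist x y < min \<delta> 1"
    show "\<bar>w x - w y\<bar> < e"
    proof (cases "x \<in> K \<or> y \<in> K")
      case True
      have "norm x \<le> norm y + dist x y" "norm y \<le> norm x + dist x y"
        using norm_triangle_sub[of x y] norm_triangle_sub[of y x] by (auto simp: dist_norm norm_minus_commute)
      then have "x \<in> cball 0 (R + 1)" "y \<in> cball 0 (R + 1)"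
        using True R[of x] R[of y] xy by auto
      then show ?thesis using \<delta>(2)[of y x] xy by (simp add: dist_real_def)
    qed (use K(2) e in simp)
  qed (use \<delta> in simp)
qed

text \<open>Unit mass is taken over a box that contains the support, since the convolution lemmas
  integrate over boxes.\<close>

definition mollifier :: "real \<Rightarrow> (real^'d::finite \<Rightarrow> real) \<Rightarrow> bool" where
  "mollifier \<delta> \<rho> \<longleftrightarrow> (\<forall>k. Ck_on k UNIV \<rho>) \<and> (\<forall>y. 0 \<le> \<rho> y) \<and> (\<forall>y. \<rho> y \<noteq> 0 \<longrightarrow> norm y < \<delta>) \<and>
     integral (cbox (- \<delta> *\<^sub>R One) (\<delta> *\<^sub>R One)) \<rho> = 1"

lemma ball_subset_cbox_One:
  fixes y :: "'a::euclidean_space"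
  assumes "norm y < \<delta>"
  shows "y \<in> cbox (- \<delta> *\<^sub>R One) (\<delta> *\<^sub>R One)"
  using order.strict_trans1[OF Basis_le_norm assms] by (force simp: mem_box abs_less_iff)

text \<open>Rescaling the square of a nonzero test function avoids constructing a bump function.\<close>

lemma mollifier_exists:
  fixes \<eta> :: "real^'d::finite \<Rightarrow> real"
  assumes \<eta>: "test_function \<Omega> \<eta>" and x0: "\<eta> x0 \<noteq> 0" and \<delta>: "0 < \<delta>"
  obtains \<rho> :: "real^'d \<Rightarrow> real" where "mollifier \<delta> \<rho>"
proof -
  have "compact (closure {x. \<eta> x \<noteq> 0})" using \<eta> by (simp add: test_function_def)
  then have "bounded {x. \<eta> x \<noteq> 0}"
    using bounded_subset[OF compact_imp_bounded closure_subset] by blast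
  then obtain R where R: "norm x \<le> R" if "\<eta> x \<noteq> 0" for x
    by (auto simp: bounded_iff)
  have R0: "0 \<le> R" using order_trans[OF norm_ge_zero R[OF x0]] .
  \<comment> \<open>If x0 + s y lies in the support of \<eta>, then s |y| \<le> R + |x0| < s
    \<delta>; this scaling confines the bump to norm y < \<delta>.\<close>
  define s where "s = (R + norm x0 + 1) / \<delta>"
  have s: "0 < s" using R0 \<delta> by (simp add: s_def add_nonneg_pos)
  define \<rho>0 where "\<rho>0 = (\<lambda>y. \<eta> (x0 + s *\<^sub>R y) * \<eta> (x0 + s *\<^sub>R y))"
  have smooth: "Ck_on k UNIV \<rho>0" for k
    unfolding \<rho>0_def using \<eta> by (intro Ck_on_mult Ck_on_affine) (simp_all add: test_function_def)
  have supp: "norm y < \<delta>" if "\<rho>0 y \<noteq> 0" for y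
  proof -
    have "norm (x0 + s *\<^sub>R y) \<le> R" using that by (intro R) (auto simp: \<rho>0_def)
    moreover have "norm (s *\<^sub>R y) \<le> norm (x0 + s *\<^sub>R y) + norm x0"
      using norm_triangle_ineq4[of "x0 + s *\<^sub>R y" x0] by simp
    ultimately have "s * norm y < R + norm x0 + 1" using s by simp
    moreover have "s * \<delta> = R + norm x0 + 1" using \<delta> by (simp add: s_def)
    ultimately have "s * norm y < s * \<delta>" by simp
    then show ?thesis using s by simp
  qed
  let ?B = "cbox (- \<delta> *\<^sub>R One) (\<delta> *\<^sub>R One) :: (real^'d) set"
  define I where "I = integral ?B \<rho>0"
  have cont: "continuous_on ?B \<rho>0"
    using smooth[of 0] by (auto intro: continuous_on_subset)
  have I: "(\<rho>0 has_integral I) ?B"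
    unfolding I_def using cont by (intro integrable_integral integrable_continuous)
  have "0 \<le> I"
    by (rule has_integral_nonneg[OF I]) (simp add: \<rho>0_def)
  moreover have "I \<noteq> 0"
  proof
    assume "I = 0"
    \<comment> \<open>A nonnegative continuous function with integral 0 vanishes on the box, but
      \<rho>0 0 is the square of \<eta> x0.\<close>
    have "(0::real^'d) \<in> box (- \<delta> *\<^sub>R One) (\<delta> *\<^sub>R One)"
      using \<delta> by (simp add: mem_box)
    then have "\<rho>0 0 = 0"
      using I unfolding \<open>I = 0\<close> by (intro has_integral_0_cbox_imp_0[OF cont]) (auto simp: \<rho>0_def box_subset_cbox[THEN subsetD])
    then show False using x0 by (simp add: \<rho>0_def)
  qed
  ultimately have Ipos: "0 < I" by simp
  show ?thesis
  proof (rule that[of "\<lambda>y. 1 / I * \<rho>0 y"], unfold mollifier_def, intro conjI allI impI)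
    show "integral ?B (\<lambda>y. 1 / I * \<rho>0 y) = 1"
      using Ipos by (simp add: I_def)
    show "Ck_on k UNIV (\<lambda>y. 1 / I * \<rho>0 y)" for k
      by (intro Ck_on_mult Ck_on_const smooth)
    show "0 \<le> 1 / I * \<rho>0 y" for y using Ipos by (simp add: \<rho>0_def)
    show "norm y < \<delta>" if "1 / I * \<rho>0 y \<noteq> 0" for y using that supp by simp
  qed
qed

text \<open>The convolution averages the values w (x - y) with weights of total mass 1 carried by
  norm y < \<delta>.\<close>

lemma mollifier_approx:
  fixes \<rho> w :: "real^'d::finite \<Rightarrow> real"
  assumes \<rho>: "mollifier \<delta> \<rho>" and w: "continuous_on UNIV w"
    and e: "\<And>y. norm y < \<delta> \<Longrightarrow> \<bar>w (x - y) - w x\<bar> \<le> e"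
  shows "\<bar>integral (cbox (- \<delta> *\<^sub>R One) (\<delta> *\<^sub>R One)) (\<lambda>y. \<rho> y * w (x - y)) - w x\<bar> \<le> e"
proof -
  let ?B = "cbox (- \<delta> *\<^sub>R One) (\<delta> *\<^sub>R One) :: (real^'d) set"
  have "Ck_on 0 UNIV \<rho>" using \<rho> unfolding mollifier_def by blast
  then have c: "continuous_on ?B \<rho>" by (auto intro: continuous_on_subset)
  have cw: "continuous_on ?B (\<lambda>y. w (x - y))"
    by (intro continuous_on_compose2[OF w] continuous_intros) auto
  have int: "\<rho> integrable_on ?B" "(\<lambda>y. \<rho> y * w (x - y)) integrable_on ?B" "(\<lambda>y. \<rho> y * (w (x - y) - w x)) integrable_on ?B"
    by (intro integrable_continuous continuous_intros c cw)+
  have "integral ?B (\<lambda>y. \<rho> y * w (x - y)) - w x = integral ?B (\<lambda>y. \<rho> y * w (x - y)) - integral ?B (\<lambda>y. \<rho> y * w x)"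
    using \<rho> by (simp add: mollifier_def)
  also have "\<dots> = integral ?B (\<lambda>y. \<rho> y * (w (x - y) - w x))"
    unfolding right_diff_distrib by (rule integral_diff[symmetric]) (use int integrable_on_mult_left[OF int(1)] in auto)
  also have "norm \<dots> \<le> integral ?B (\<lambda>y. \<rho> y * e)"
  proof (rule Henstock_Kurzweil_Integration.integral_norm_bound_integral[OF int(3) integrable_on_mult_left[OF int(1)]])
    fix y
    have "0 \<le> \<rho> y" using \<rho> by (simp add: mollifier_def)
    moreover have "\<bar>w (x - y) - w x\<bar> \<le> e" if "\<rho> y \<noteq> 0"
      using \<rho> that by (intro e) (simp add: mollifier_def)
    ultimately show "norm (\<rho> y * (w (x - y) - w x)) \<le> \<rho> y * e"
      by (cases "\<rho> y = 0") (auto simp: abs_mult intro!: mult_left_mono)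
  qed
  also have "\<dots> = e" using \<rho> by (simp add: mollifier_def)
  finally show ?thesis by simp
qed

lemma partial_deriv_zero_outside_support:
  assumes "x \<notin> closure {x. \<zeta> x \<noteq> 0}"
  shows "partial_deriv i \<zeta> x = 0"
proof -
  have "partial_deriv i (\<lambda>x. 0) x = partial_deriv i \<zeta> x"
    by (rule partial_deriv_transform[of "- closure {x. \<zeta> x \<noteq> 0}"])
      (use assms closure_subset[of "{x. \<zeta> x \<noteq> 0}"] in \<open>auto intro!: differentiable_const\<close>)
  then show ?thesis by (simp add: partial_deriv_def)
qed

text \<open>The radius of the mollifier respects the moduli of continuity of \<zeta> and of its
  finitely many partial derivatives, and is small enough for the support to stay in \<Omega>.
  \<open>\<eta>0\<close> provides the bump that is rescaled.\<close>

lemma test_function_approx: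
  fixes \<zeta> \<eta>0 :: "real^'d::finite \<Rightarrow> real"
  assumes \<Omega>: "open \<Omega>" and \<eta>0: "test_function \<Omega> \<eta>0" "\<eta>0 x0 \<noteq> 0"
    and \<zeta>: "Ck_on (Suc 0) UNIV \<zeta>"
    and supp: "compact (closure {x. \<zeta> x \<noteq> 0})" "closure {x. \<zeta> x \<noteq> 0} \<subseteq> \<Omega>" and e: "0 < e"
  obtains \<eta> where "test_function \<Omega> \<eta>" "\<And>x. \<bar>\<eta> x - \<zeta> x\<bar> \<le> e" "\<And>i x. \<bar>partial_deriv i \<eta> x - partial_deriv i \<zeta> x\<bar> \<le> e"
proof -
  let ?K = "closure {x. \<zeta> x \<noteq> 0}"
  have \<zeta>0: "\<zeta> x = 0" if "x \<notin> ?K" for x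
    using that closure_subset[of "{x. \<zeta> x \<noteq> 0}"] by blast
  have c\<zeta>: "continuous_on UNIV \<zeta>" using Ck_on_Suc_imp[OF \<zeta>] by simp
  have cd: "continuous_on UNIV (partial_deriv i \<zeta>)" for i using \<zeta> by simp
  obtain \<delta>0 where \<delta>0: "0 < \<delta>0" "\<And>x y. dist x y < \<delta>0 \<Longrightarrow> \<bar>\<zeta> x - \<zeta> y\<bar> < e"
    using uniformly_continuous_compact_support[OF c\<zeta> supp(1) \<zeta>0 e] by blast
  have "\<exists>\<delta>>0. \<forall>x y. dist x y < \<delta> \<longrightarrow> \<bar>partial_deriv i \<zeta> x - partial_deriv i \<zeta> y\<bar> < e" for i
    using uniformly_continuous_compact_support[OF cd[of i] supp(1) partial_deriv_zero_outside_support e] by metis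
  then obtain \<delta>1 where \<delta>1: "\<And>i. 0 < \<delta>1 i" "\<And>i x y. dist x y < \<delta>1 i \<Longrightarrow> \<bar>partial_deriv i \<zeta> x - partial_deriv i \<zeta> y\<bar> < e"
    by metis
  obtain \<epsilon> where \<epsilon>: "0 < \<epsilon>" "(\<Union>x\<in>?K. ball x \<epsilon>) \<subseteq> \<Omega>"
    using compact_subset_open_imp_ball_epsilon_subset[OF supp(1) \<Omega> supp(2)] .
  define \<delta> where "\<delta> = min (Min (range \<delta>1)) (min \<delta>0 (\<epsilon> / 2))"
  have \<delta>: "0 < \<delta>" "\<delta> \<le> \<delta>1 i" "\<delta> \<le> \<delta>0" "\<delta> < \<epsilon>" for i
    using \<delta>0(1) \<delta>1(1) \<epsilon>(1) by (auto simp: \<delta>_def min_le_iff_disj)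
  obtain \<rho> :: "real^'d \<Rightarrow> real" where \<rho>: "mollifier \<delta> \<rho>"
    using mollifier_exists[OF \<eta>0 \<delta>(1)] .
  have smooth: "Ck_on k UNIV \<rho>" for k using \<rho> by (simp add: mollifier_def)
  have c\<rho>: "continuous_on UNIV \<rho>" using smooth[of 0] by simp
  obtain b where b: "?K \<subseteq> cbox (- b) b"
    using bounded_subset_cbox_symmetric[OF compact_imp_bounded[OF supp(1)]] by blast
  let ?B = "cbox (- \<delta> *\<^sub>R One) (\<delta> *\<^sub>R One) :: (real^'d) set"
  define \<eta> where "\<eta> = (\<lambda>x. integral (cbox (- b) b) (\<lambda>z. \<zeta> z * \<rho> (x - z)))"
  have flip: "\<eta> = (\<lambda>x. integral ?B (\<lambda>y. \<rho> y * \<zeta> (x - y)))"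
  proof
    fix x
    show "\<eta> x = integral ?B (\<lambda>y. \<rho> y * \<zeta> (x - y))"
      unfolding \<eta>_def
    proof (rule convolution_flip)
      show "\<zeta> z = 0" if "z \<notin> cbox (- b) b" for z using that b \<zeta>0 by blast
      show "\<rho> y = 0" if "y \<notin> ?B" for y
        using that \<rho> ball_subset_cbox_One[of y \<delta>] unfolding mollifier_def by blast
    qed
  qed
  have deriv: "partial_deriv i \<eta> x = integral ?B (\<lambda>y. \<rho> y * partial_deriv i \<zeta> (x - y))" for i x
    unfolding flip by (rule partial_deriv_convolution[OF c\<rho> \<zeta>])
  \<comment> \<open>The compact closed \<delta>-neighbourhood of the support of \<zeta>, which
    contains the support of the convolution.\<close>
  let ?K' = "\<Union>x\<in>?K. \<Union>y\<in>cball 0 \<delta>. {x + y}"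
  have K': "compact ?K'"
    by (rule compact_sums'[OF supp(1) compact_cball])
  have sub: "{x. \<eta> x \<noteq> 0} \<subseteq> ?K'"
  proof
    fix x assume "x \<in> {x. \<eta> x \<noteq> 0}"
    then have "(\<lambda>y. \<rho> y * \<zeta> (x - y)) \<noteq> (\<lambda>_. 0)"
      unfolding flip by auto
    then have "\<exists>y. \<rho> y * \<zeta> (x - y) \<noteq> 0"
      by (simp add: fun_eq_iff)
    then obtain y where "\<rho> y \<noteq> 0" "\<zeta> (x - y) \<noteq> 0" by auto
    then have "norm y < \<delta>" "x - y \<in> ?K"
      using \<rho> closure_subset[of "{x. \<zeta> x \<noteq> 0}"] by (auto simp: mollifier_def)
    then show "x \<in> ?K'"
      by (intro UN_I[of "x - y"] UN_I[of y]) auto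
  qed
  then have cl: "closure {x. \<eta> x \<noteq> 0} \<subseteq> ?K'"
    using compact_imp_closed[OF K'] by (rule closure_minimal)
  have "?K' \<subseteq> \<Omega>"
  proof
    fix x assume "x \<in> ?K'"
    then obtain z y where zy: "z \<in> ?K" "norm y \<le> \<delta>" "x = z + y" by auto
    then have "x \<in> ball z \<epsilon>" using \<delta>(4) by (auto simp: dist_norm)
    with \<epsilon>(2) zy(1) show "x \<in> \<Omega>" by blast
  qed
  moreover have "compact (closure {x. \<eta> x \<noteq> 0})"
    using bounded_subset[OF compact_imp_bounded[OF K'] sub] by (simp add: compact_closure)
  ultimately have test: "test_function \<Omega> \<eta>"
    unfolding test_function_def using Ck_on_convolution[OF c\<zeta> smooth] cl by (auto simp: \<eta>_def)
  show ?thesis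
  proof (rule that[OF test])
    show "\<bar>\<eta> x - \<zeta> x\<bar> \<le> e" for x
      unfolding flip using \<delta>(3) by (intro mollifier_approx[OF \<rho> c\<zeta>] less_imp_le[OF \<delta>0(2)]) (auto simp: dist_norm)
    show "\<bar>partial_deriv i \<eta> x - partial_deriv i \<zeta> x\<bar> \<le> e" for i x
      unfolding deriv using \<delta>(2)[of i] by (intro mollifier_approx[OF \<rho> cd] less_imp_le[OF \<delta>1(2)]) (auto simp: dist_norm)
  qed
qed


section \<open>\<open>L\<^sup>2\<close> and weak derivatives on a bounded domain\<close>

locale bounded_domain =
  fixes \<Omega> :: "(real^'d::finite) set"
  assumes \<Omega>: "open \<Omega>" "bounded \<Omega>"
begin

abbreviation (input) "\<mu> \<equiv> lebesgue_on \<Omega>"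
abbreviation (input) "L2 \<equiv> L2_space \<Omega>"
abbreviation (input) "ip \<equiv> L2_inner \<Omega>"
abbreviation (input) "nrm \<equiv> L2_norm \<Omega>"
abbreviation (input) "has_wp \<equiv> has_weak_partial \<Omega>"
abbreviation (input) "test_fn \<equiv> test_function \<Omega>"

section \<open>The L2 inner product and completeness\<close>

lemma lmeasurable_domain: "\<Omega> \<in> lmeasurable"
  using \<Omega> by (simp add: lmeasurable_open)

lemma sets_lebesgue_domain: "\<Omega> \<in> sets lebesgue"
  using \<Omega> by (simp add: borel_open)

lemma L2_spaceD:
  assumes "f \<in> L2"
  shows "f \<in> borel_measurable \<mu>" "integrable \<mu> (\<lambda>x. (f x)\<^sup>2)"
  using assms by (auto simp: L2_space_def)

lemma L2_integrable_mult:
  assumes f: "f \<in> L2" and g: "g \<in> L2"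
  shows "integrable \<mu> (\<lambda>x. f x * g x)"
proof (rule Bochner_Integration.integrable_bound)
  show "integrable \<mu> (\<lambda>x. (f x)\<^sup>2 + (g x)\<^sup>2)"
    by (intro Bochner_Integration.integrable_add L2_spaceD f g)
  show "(\<lambda>x. f x * g x) \<in> borel_measurable \<mu>"
    by (intro borel_measurable_times L2_spaceD f g)
  have "\<bar>f x * g x\<bar> \<le> (f x)\<^sup>2 + (g x)\<^sup>2" for x
  proof -
    have "0 \<le> (\<bar>f x\<bar> - \<bar>g x\<bar>)\<^sup>2" by simp
    then have "2 * (\<bar>f x\<bar> * \<bar>g x\<bar>) \<le> (f x)\<^sup>2 + (g x)\<^sup>2"
      by (simp add: power2_diff)
    moreover have "0 \<le> \<bar>f x\<bar> * \<bar>g x\<bar>" by simp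
    ultimately show ?thesis by (simp only: abs_mult)
  qed
  then show "AE x in \<mu>. norm (f x * g x) \<le> norm ((f x)\<^sup>2 + (g x)\<^sup>2)"
    by (intro AE_I2) (simp add: abs_of_nonneg)
qed

lemma L2_add [intro]:
  assumes f: "f \<in> L2" and g: "g \<in> L2"
  shows "(\<lambda>x. f x + g x) \<in> L2"
proof -
  have "integrable \<mu> (\<lambda>x. (f x)\<^sup>2 + (g x)\<^sup>2 + 2 * (f x * g x))"
    by (intro Bochner_Integration.integrable_add integrable_mult_right L2_integrable_mult L2_spaceD f g)
  then show ?thesis
    using L2_spaceD(1)[OF f] L2_spaceD(1)[OF g] by (auto simp: L2_space_def power2_sum mult.assoc)
qed

lemma L2_cmult [intro]: "f \<in> L2 \<Longrightarrow> (\<lambda>x. c * f x) \<in> L2"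
  by (auto simp: L2_space_def power_mult_distrib)

lemma L2_zero [simp, intro]: "(\<lambda>x. 0) \<in> L2"
  by (simp add: L2_space_def)

lemma L2_diff [intro]:
  assumes "f \<in> L2" "g \<in> L2"
  shows "(\<lambda>x. f x - g x) \<in> L2"
  using L2_add[OF assms(1) L2_cmult[OF assms(2), of "-1"]] by simp

lemma L2_sum [intro]:
  "(\<And>i. i \<in> I \<Longrightarrow> f i \<in> L2) \<Longrightarrow> (\<lambda>x. \<Sum>i\<in>I. f i x) \<in> L2"
  by (induction I rule: infinite_finite_induct) auto

lemma L2_bounded_mult:
  assumes f: "f \<in> L2" and h: "h \<in> borel_measurable \<mu>"
    and B: "\<And>x. x \<in> \<Omega> \<Longrightarrow> \<bar>h x\<bar> \<le> B"
  shows "(\<lambda>x. h x * f x) \<in> L2"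
proof -
  have "integrable \<mu> (\<lambda>x. (h x * f x)\<^sup>2)"
  proof (rule Bochner_Integration.integrable_bound)
    show "integrable \<mu> (\<lambda>x. B\<^sup>2 * (f x)\<^sup>2)"
      by (intro integrable_mult_right L2_spaceD f)
    show "AE x in \<mu>. norm ((h x * f x)\<^sup>2) \<le> norm (B\<^sup>2 * (f x)\<^sup>2)"
    proof (rule AE_I2)
      fix x assume "x \<in> space \<mu>"
      then have "\<bar>h x\<bar>\<^sup>2 \<le> B\<^sup>2" by (intro power_mono B) auto
      then show "norm ((h x * f x)\<^sup>2) \<le> norm (B\<^sup>2 * (f x)\<^sup>2)"
        by (simp add: power_mult_distrib mult_right_mono)
    qed
  qed (use h L2_spaceD(1)[OF f] in measurable)
  then show ?thesis
    using h L2_spaceD(1)[OF f] by (simp add: L2_space_def)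
qed

lemma L2_AE_cong:
  assumes "f \<in> L2" "g \<in> L2" "AE x in \<mu>. f x = g x" "h \<in> L2"
  shows "ip f h = ip g h"
  unfolding L2_inner_def
proof (rule integral_cong_AE)
  show "AE x in \<mu>. f x * h x = g x * h x" using assms(3) by eventually_elim simp
qed (use L2_spaceD(1)[OF assms(1)] L2_spaceD(1)[OF assms(2)] L2_spaceD(1)[OF assms(4)] in measurable)

lemma L2_inner_commute: "ip f g = ip g f"
  by (simp add: L2_inner_def mult.commute)

lemma L2_inner_add_left:
  assumes "f \<in> L2" "g \<in> L2" "h \<in> L2"
  shows "ip (\<lambda>x. f x + g x) h = ip f h + ip g h"
  using Bochner_Integration.integral_add[OF L2_integrable_mult[OF assms(1,3)] L2_integrable_mult[OF assms(2,3)]]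
  by (simp add: L2_inner_def distrib_right)

lemma L2_inner_cmult_left: "ip (\<lambda>x. c * f x) h = c * ip f h"
  by (simp add: L2_inner_def mult.assoc)

lemma L2_inner_diff_left:
  assumes "f \<in> L2" "g \<in> L2" "h \<in> L2"
  shows "ip (\<lambda>x. f x - g x) h = ip f h - ip g h"
  using L2_inner_add_left[OF assms(1) L2_cmult[OF assms(2), of "-1"] assms(3)] L2_inner_cmult_left[of "-1" g h]
  by simp

lemma L2_inner_sum_left:
  assumes "\<And>i. i \<in> I \<Longrightarrow> f i \<in> L2" "h \<in> L2"
  shows "ip (\<lambda>x. \<Sum>i\<in>I. f i x) h = (\<Sum>i\<in>I. ip (f i) h)"
  using assms
proof (induction I rule: infinite_finite_induct)
  case (insert i I)
  then show ?case by (simp add: L2_inner_add_left L2_sum)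
qed (simp_all add: L2_inner_def)

lemma L2_inner_add_right:
  assumes "f \<in> L2" "g \<in> L2" "h \<in> L2"
  shows "ip h (\<lambda>x. f x + g x) = ip h f + ip h g"
  using L2_inner_add_left[OF assms] by (simp add: L2_inner_commute)

lemma L2_inner_cmult_right: "ip h (\<lambda>x. c * f x) = c * ip h f"
  using L2_inner_cmult_left[of c f h] by (simp add: L2_inner_commute)

lemma L2_inner_diff_right:
  assumes "f \<in> L2" "g \<in> L2" "h \<in> L2"
  shows "ip h (\<lambda>x. f x - g x) = ip h f - ip h g"
  using L2_inner_diff_left[OF assms] by (simp add: L2_inner_commute)

lemma L2_inner_sum_right:
  assumes "\<And>i. i \<in> I \<Longrightarrow> f i \<in> L2" "h \<in> L2"
  shows "ip h (\<lambda>x. \<Sum>i\<in>I. f i x) = (\<Sum>i\<in>I. ip h (f i))"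
  using L2_inner_sum_left[OF assms] by (simp add: L2_inner_commute)

lemma L2_inner_self_nonneg [simp]: "0 \<le> ip f f"
  by (simp add: L2_inner_def)

lemma L2_norm_nonneg [simp]: "0 \<le> nrm f"
  by (simp add: L2_norm_def)

lemma L2_norm_power2: "(nrm f)\<^sup>2 = ip f f"
  by (simp add: L2_norm_def)

lemma L2_norm_power2_integral: "(nrm f)\<^sup>2 = (LINT x|\<mu>. (f x)\<^sup>2)"
  unfolding L2_norm_power2 L2_inner_def by (simp add: power2_eq_square)

lemma L2_norm_cmult: "nrm (\<lambda>x. c * f x) = \<bar>c\<bar> * nrm f"
proof -
  have "ip (\<lambda>x. c * f x) (\<lambda>x. c * f x) = c\<^sup>2 * ip f f"
    by (simp only: L2_inner_cmult_left L2_inner_cmult_right power2_eq_square mult.assoc)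
  then show ?thesis
    by (simp add: L2_norm_def real_sqrt_mult)
qed

lemma L2_norm_minus_commute: "nrm (\<lambda>x. f x - g x) = nrm (\<lambda>x. g x - f x)"
  using L2_norm_cmult[of "-1" "\<lambda>x. f x - g x"] by simp

lemma L2_Cauchy_Schwarz:
  assumes f: "f \<in> L2" and g: "g \<in> L2"
  shows "\<bar>ip f g\<bar> \<le> nrm f * nrm g"
proof -
  have quad: "0 \<le> ip f f - 2 * r * ip f g + r\<^sup>2 * ip g g" for r
  proof -
    have rg: "(\<lambda>x. r * g x) \<in> L2" using g by blast
    have "0 \<le> ip (\<lambda>x. f x - r * g x) (\<lambda>x. f x - r * g x)" by simp
    also have "\<dots> = ip f f - 2 * r * ip f g + r\<^sup>2 * ip g g"
      by (simp add: L2_inner_diff_left L2_inner_diff_right L2_diff f g rg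
          L2_inner_cmult_left L2_inner_cmult_right power2_eq_square algebra_simps L2_inner_commute[of g f])
    finally show ?thesis .
  qed
  have "(ip f g)\<^sup>2 \<le> ip f f * ip g g"
  proof (cases "ip g g = 0")
    case True
    \<comment> \<open>\<open>ip g g = 0\<close> does not make g the zero function, so this case is
      argued from the quadratic, now affine in r: the r inserted below would give it the value
      -1.\<close>
    have "ip f g = 0"
    proof (rule ccontr)
      assume nz: "ip f g \<noteq> 0"
      have "0 \<le> ip f f - 2 * ((ip f f + 1) / (2 * ip f g)) * ip f g"
        using quad[of "(ip f f + 1) / (2 * ip f g)"] True by simp
      then show False using nz by simp
    qed
    then show ?thesis by simp
  next
    case False
    then have pos: "0 < ip g g"
      using L2_inner_self_nonneg[of g] by linarith
    show ?thesis
      using quad[of "ip f g / ip g g"] pos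
      by (simp add: field_simps power2_eq_square)
  qed
  also have "\<dots> = (nrm f * nrm g)\<^sup>2"
    by (simp add: power_mult_distrib L2_norm_power2)
  finally show ?thesis
    by (metis abs_le_square_iff abs_of_nonneg mult_nonneg_nonneg L2_norm_nonneg)
qed

lemma L2_norm_triangle:
  assumes f: "f \<in> L2" and g: "g \<in> L2"
  shows "nrm (\<lambda>x. f x + g x) \<le> nrm f + nrm g"
proof (rule power2_le_imp_le)
  have "(nrm (\<lambda>x. f x + g x))\<^sup>2 = (nrm f)\<^sup>2 + 2 * ip f g + (nrm g)\<^sup>2"
    by (simp add: L2_norm_power2 L2_inner_add_left L2_inner_add_right L2_add f g L2_inner_commute[of g f])
  also have "\<dots> \<le> (nrm f)\<^sup>2 + 2 * (nrm f * nrm g) + (nrm g)\<^sup>2"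
    using L2_Cauchy_Schwarz[OF f g] by (simp add: abs_le_iff)
  also have "\<dots> = (nrm f + nrm g)\<^sup>2"
    by (simp add: power2_sum)
  finally show "(nrm (\<lambda>x. f x + g x))\<^sup>2 \<le> (nrm f + nrm g)\<^sup>2" .
qed simp

lemma L2_norm_diff_triangle:
  assumes "f \<in> L2" "g \<in> L2" "h \<in> L2"
  shows "nrm (\<lambda>x. f x - h x) \<le> nrm (\<lambda>x. f x - g x) + nrm (\<lambda>x. g x - h x)"
  using L2_norm_triangle[OF L2_diff[OF assms(1,2)] L2_diff[OF assms(2,3)]] by simp

lemma L2_norm_le_add_diff:
  assumes "f \<in> L2" "g \<in> L2"
  shows "nrm f \<le> nrm g + nrm (\<lambda>x. f x - g x)"
  using L2_norm_triangle[OF assms(2) L2_diff[OF assms]] by simp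

lemma L2_norm_eq_0_imp_AE:
  assumes f: "f \<in> L2" and "nrm f = 0"
  shows "AE x in \<mu>. f x = 0"
proof -
  have "(LINT x|\<mu>. (f x)\<^sup>2) = 0"
    using assms(2) by (simp add: L2_norm_def L2_inner_def power2_eq_square)
  then have "AE x in \<mu>. (f x)\<^sup>2 = 0"
    by (subst (asm) integral_nonneg_eq_0_iff_AE[OF L2_spaceD(2)[OF f]]) auto
  then show ?thesis by simp
qed

lemma L2_norm_AE_cong:
  assumes "f \<in> L2" "g \<in> L2" "AE x in \<mu>. f x = g x"
  shows "nrm f = nrm g"
  using L2_AE_cong[OF assms assms(1)] L2_AE_cong[OF assms assms(2)]
  by (simp add: L2_norm_def L2_inner_commute)

lemma tendsto_L2_inner:
  assumes f: "\<And>k. f k \<in> L2" and g: "g \<in> L2" and h: "h \<in> L2"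
    and lim: "(\<lambda>k. nrm (\<lambda>x. f k x - g x)) \<longlonglongrightarrow> 0"
  shows "(\<lambda>k. ip (f k) h) \<longlonglongrightarrow> ip g h"
proof (rule Lim_null[THEN iffD2], rule Lim_null_comparison)
  show "\<forall>\<^sub>F k in sequentially. norm (ip (f k) h - ip g h) \<le> nrm (\<lambda>x. f k x - g x) * nrm h"
    using L2_Cauchy_Schwarz[OF L2_diff[OF f g] h] by (simp add: L2_inner_diff_left f g h)
  show "(\<lambda>k. nrm (\<lambda>x. f k x - g x) * nrm h) \<longlonglongrightarrow> 0"
    using tendsto_mult_right[OF lim, of "nrm h"] by simp
qed

lemma tendsto_L2_norm:
  assumes f: "\<And>k. f k \<in> L2" and g: "g \<in> L2"
    and lim: "(\<lambda>k. nrm (\<lambda>x. f k x - g x)) \<longlonglongrightarrow> 0"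
  shows "(\<lambda>k. nrm (f k)) \<longlonglongrightarrow> nrm g"
proof (rule Lim_null[THEN iffD2], rule Lim_null_comparison[OF _ lim], rule always_eventually, rule allI)
  fix k
  show "norm (nrm (f k) - nrm g) \<le> nrm (\<lambda>x. f k x - g x)"
    using L2_norm_le_add_diff[OF f g, of k] L2_norm_le_add_diff[OF g f, of k] L2_norm_minus_commute[of "f k" g]
    by (simp add: abs_le_iff)
qed

text \<open>Riesz--Fischer. Finiteness of the measure turns \<open>L\<^sup>2\<close> convergence of a fast subsequence into \<open>L\<^sup>1\<close>, hence
  almost everywhere, convergence.\<close>

lemma L2_complete:
  fixes f :: "nat \<Rightarrow> real^'d \<Rightarrow> real"
  assumes f: "\<And>k. f k \<in> L2"
    and Cauchy: "\<And>e. 0 < e \<Longrightarrow> \<exists>N. \<forall>m\<ge>N. \<forall>n\<ge>N. nrm (\<lambda>x. f m x - f n x) < e"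
  obtains g where "g \<in> L2" "(\<lambda>k. nrm (\<lambda>x. f k x - g x)) \<longlonglongrightarrow> 0"
proof -
  let ?M = "\<mu>"
  interpret finite_measure ?M
    by (rule finite_measure_lebesgue_on[OF lmeasurable_domain])
  note [measurable] = L2_spaceD(1)[OF f]
  have one: "(\<lambda>x. 1) \<in> L2"
    by (simp add: L2_space_def)
  have "\<exists>N. \<forall>m\<ge>N. \<forall>n\<ge>N. nrm (\<lambda>x. f m x - f n x) < (1 / 2) ^ k" for k :: nat
    by (rule Cauchy) simp
  then obtain N where N: "\<And>k m n. N k \<le> m \<Longrightarrow> N k \<le> n \<Longrightarrow> nrm (\<lambda>x. f m x - f n x) < (1 / 2) ^ k"
    by metis
  \<comment> \<open>The sum makes r monotone and at least N k although N need not be monotone; the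
    summand k gives k \<le> r k.\<close>
  define r where "r = (\<lambda>k. k + (\<Sum>i\<le>k. N i))"
  have r: "N k \<le> r k" and r_mono: "r k \<le> r (Suc k)" and r_ge: "k \<le> r k" for k
    unfolding r_def by (auto simp: lessThan_Suc_atMost[symmetric])
  define d where "d = (\<lambda>k x. f (r (Suc k)) x - f (r k) x)"
  have d: "d k \<in> L2" for k
    unfolding d_def by (intro L2_diff f)
  have dm [measurable]: "d k \<in> borel_measurable ?M" for k
    by (rule L2_spaceD(1)[OF d])
  have d_abs: "(\<lambda>x. \<bar>d k x\<bar>) \<in> L2" for k
    using d[of k] by (simp add: L2_space_def)
  have d_int: "integrable ?M (\<lambda>x. \<bar>d k x\<bar>)" for k
    using L2_integrable_mult[OF one d_abs, of k] by simp
  have d_norm: "(LINT x|?M. \<bar>d k x\<bar>) \<le> nrm (\<lambda>x. 1) * (1 / 2) ^ k" for k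
  proof -
    have "(LINT x|?M. \<bar>d k x\<bar>) = ip (\<lambda>x. 1) (\<lambda>x. \<bar>d k x\<bar>)"
      by (simp add: L2_inner_def)
    also have "\<dots> \<le> nrm (\<lambda>x. 1) * nrm (\<lambda>x. \<bar>d k x\<bar>)"
      using L2_Cauchy_Schwarz[OF one d_abs, of k] by (simp add: abs_le_iff)
    also have "nrm (\<lambda>x. \<bar>d k x\<bar>) = nrm (d k)"
      by (simp add: L2_norm_def L2_inner_def)
    also have "\<dots> \<le> (1 / 2) ^ k"
      unfolding d_def using r_mono r by (intro less_imp_le[OF N]) (auto intro: order_trans[OF r])
    finally show ?thesis by (simp add: mult_left_mono)
  qed
  have "(\<integral>\<^sup>+x. (\<Sum>k. ennreal \<bar>d k x\<bar>) \<partial>?M) = (\<Sum>k. \<integral>\<^sup>+x. ennreal \<bar>d k x\<bar> \<partial>?M)"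
    by (rule nn_integral_suminf) simp
  also have "\<dots> = (\<Sum>k. ennreal (LINT x|?M. \<bar>d k x\<bar>))"
    using d_int by (simp add: nn_integral_eq_integral)
  also have "\<dots> \<le> (\<Sum>k. ennreal (nrm (\<lambda>x. 1) * (1 / 2) ^ k))"
    by (intro suminf_le ennreal_leI d_norm) auto
  also have "\<dots> = ennreal (\<Sum>k. nrm (\<lambda>x. 1) * (1 / 2) ^ k)"
    by (intro suminf_ennreal2 summable_mult summable_geometric) auto
  also have "\<dots> < \<infinity>" by simp
  finally have "(\<integral>\<^sup>+x. (\<Sum>k. ennreal \<bar>d k x\<bar>) \<partial>?M) \<noteq> \<infinity>" by simp
  then have "AE x in ?M. (\<Sum>k. ennreal \<bar>d k x\<bar>) \<noteq> \<infinity>"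
    by (intro nn_integral_noteq_infinite) auto
  then have AE_conv: "AE x in ?M. convergent (\<lambda>k. f (r k) x)"
  proof eventually_elim
    case (elim x)
    have "summable (\<lambda>k. \<bar>d k x\<bar>)"
      using elim by (intro summable_suminf_not_top) (auto simp: top_ennreal_def[symmetric])
    then have "summable (\<lambda>k. d k x)" by (rule summable_rabs_cancel)
    then have "convergent (\<lambda>n. \<Sum>k<n. d k x)" by (simp add: summable_iff_convergent)
    moreover have "(\<Sum>k<n. d k x) = f (r n) x - f (r 0) x" for n
      unfolding d_def by (rule sum_lessThan_telescope[of "\<lambda>k. f (r k) x"])
    ultimately show "convergent (\<lambda>k. f (r k) x)"
      using convergent_add[OF _ convergent_const[of "f (r 0) x"], of "\<lambda>n. f (r n) x - f (r 0) x"] by simp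
  qed
  \<comment> \<open>Where the subsequence diverges, a null set, \<open>lim\<close> is an arbitrary
    value.\<close>
  define g where "g = (\<lambda>x. lim (\<lambda>k. f (r k) x))"
  have g [measurable]: "g \<in> borel_measurable ?M"
    unfolding g_def by measurable
  have AE_lim: "AE x in ?M. (\<lambda>k. f (r k) x) \<longlonglongrightarrow> g x"
    using AE_conv by eventually_elim (simp add: g_def convergent_LIMSEQ_iff)
  have nn: "(\<integral>\<^sup>+x. ennreal ((f n x - f m x)\<^sup>2) \<partial>?M) = ennreal ((nrm (\<lambda>x. f n x - f m x))\<^sup>2)" for n m
    using nn_integral_eq_integral[OF L2_spaceD(2)[OF L2_diff[OF f f]], of n m]
    by (simp add: L2_norm_power2_integral)
  \<comment> \<open>Fatou's lemma turns the Cauchy bound between f n and f (r k) into one between f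
    n and the pointwise limit.\<close>
  have bound: "(\<integral>\<^sup>+x. ennreal ((f n x - g x)\<^sup>2) \<partial>?M) \<le> ennreal (e\<^sup>2)"
    if e: "0 < e" and n: "\<And>m. N' \<le> m \<Longrightarrow> nrm (\<lambda>x. f n x - f m x) \<le> e" for n N' e
  proof -
    have "(\<integral>\<^sup>+x. ennreal ((f n x - g x)\<^sup>2) \<partial>?M) = (\<integral>\<^sup>+x. liminf (\<lambda>k. ennreal ((f n x - f (r k) x)\<^sup>2)) \<partial>?M)"
    proof (rule nn_integral_cong_AE)
      show "AE x in ?M. ennreal ((f n x - g x)\<^sup>2) = liminf (\<lambda>k. ennreal ((f n x - f (r k) x)\<^sup>2))"
        using AE_lim
      proof eventually_elim
        case (elim x)
        have "(\<lambda>k. ennreal ((f n x - f (r k) x)\<^sup>2)) \<longlonglongrightarrow> ennreal ((f n x - g x)\<^sup>2)"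
          by (intro tendsto_ennrealI tendsto_intros elim)
        then show ?case
          by (intro lim_imp_Liminf[symmetric]) auto
      qed
    qed
    also have "\<dots> \<le> liminf (\<lambda>k. \<integral>\<^sup>+x. ennreal ((f n x - f (r k) x)\<^sup>2) \<partial>?M)"
      by (rule nn_integral_liminf) measurable
    also have "\<dots> \<le> limsup (\<lambda>k. \<integral>\<^sup>+x. ennreal ((f n x - f (r k) x)\<^sup>2) \<partial>?M)"
      by (rule Liminf_le_Limsup) simp
    also have "\<dots> \<le> ennreal (e\<^sup>2)"
    proof (rule Limsup_bounded)
      show "\<forall>\<^sub>F k in sequentially. (\<integral>\<^sup>+x. ennreal ((f n x - f (r k) x)\<^sup>2) \<partial>?M) \<le> ennreal (e\<^sup>2)"
        unfolding nn using eventually_ge_at_top[of N']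
        by eventually_elim (auto intro!: ennreal_leI power_mono n order_trans[OF _ r_ge])
    qed
    finally show ?thesis .
  qed
  have fg: "(\<lambda>x. f n x - g x) \<in> L2 \<and> nrm (\<lambda>x. f n x - g x) \<le> e"
    if e: "0 < e" and n: "\<And>m. N' \<le> m \<Longrightarrow> nrm (\<lambda>x. f n x - f m x) \<le> e" for n N' e
  proof
    have "(\<integral>\<^sup>+x. ennreal ((f n x - g x)\<^sup>2) \<partial>?M) < \<infinity>"
      using bound[OF e n] by (rule order.strict_trans1) auto
    then have int: "integrable ?M (\<lambda>x. (f n x - g x)\<^sup>2)"
      by (intro integrableI_bounded) auto
    then show "(\<lambda>x. f n x - g x) \<in> L2"
      by (simp add: L2_space_def)
    have "ennreal ((nrm (\<lambda>x. f n x - g x))\<^sup>2) = (\<integral>\<^sup>+x. ennreal ((f n x - g x)\<^sup>2) \<partial>?M)"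
      using nn_integral_eq_integral[OF int] by (simp add: L2_norm_power2_integral)
    also have "\<dots> \<le> ennreal (e\<^sup>2)" by (rule bound[OF e n])
    finally have "(nrm (\<lambda>x. f n x - g x))\<^sup>2 \<le> e\<^sup>2"
      by simp
    then show "nrm (\<lambda>x. f n x - g x) \<le> e"
      using e by (simp add: power2_le_iff_abs_le)
  qed
  obtain N1 where N1: "\<And>m n. N1 \<le> m \<Longrightarrow> N1 \<le> n \<Longrightarrow> nrm (\<lambda>x. f m x - f n x) < 1"
    using Cauchy[of 1] by auto
  have "(\<lambda>x. f N1 x - g x) \<in> L2"
    using fg[of 1 N1 N1] N1[of N1] by (auto intro: less_imp_le)
  from L2_diff[OF f[of N1] this] have gL2: "g \<in> L2" by simp
  have "(\<lambda>k. nrm (\<lambda>x. f k x - g x)) \<longlonglongrightarrow> 0"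
  proof (rule LIMSEQ_I)
    fix e :: real assume e: "0 < e"
    then obtain N1 where N1: "\<And>m n. N1 \<le> m \<Longrightarrow> N1 \<le> n \<Longrightarrow> nrm (\<lambda>x. f m x - f n x) < e / 2"
      using Cauchy[of "e / 2"] by auto
    have fg_le: "nrm (\<lambda>x. f k x - g x) \<le> e / 2" if "N1 \<le> k" for k
      using fg[of "e / 2" N1 k] N1[OF that] e by (auto intro: less_imp_le)
    show "\<exists>N. \<forall>k\<ge>N. norm (nrm (\<lambda>x. f k x - g x) - 0) < e"
    proof (intro exI[of _ N1] allI impI)
      fix k assume "N1 \<le> k"
      then show "norm (nrm (\<lambda>x. f k x - g x) - 0) < e"
        using fg_le[of k] e by simp
    qed
  qed
  with gL2 show ?thesis by (rule that)
qed

lemma L2_bounded: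
  assumes h: "h \<in> borel_measurable \<mu>"
    and B: "\<And>x. x \<in> \<Omega> \<Longrightarrow> \<bar>h x\<bar> \<le> B"
  shows "h \<in> L2"
proof -
  have "finite_measure \<mu>"
    by (rule finite_measure_lebesgue_on[OF lmeasurable_domain])
  then have "(\<lambda>x. 1) \<in> L2"
    by (simp add: L2_space_def finite_measure.integrable_const)
  from L2_bounded_mult[OF this h B] show ?thesis by simp
qed

lemma L2_continuous:
  assumes h: "continuous_on UNIV h"
  shows "h \<in> L2"
proof -
  have "bounded (h ` closure \<Omega>)"
    using \<Omega> by (intro compact_imp_bounded compact_continuous_image continuous_on_subset[OF h]) auto
  then obtain B where B: "\<forall>y\<in>h ` closure \<Omega>. norm y \<le> B"
    unfolding bounded_iff by blast
  show ?thesis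
  proof (rule L2_bounded[where B = B])
    show "h \<in> borel_measurable \<mu>"
      by (intro continuous_imp_measurable_on_sets_lebesgue continuous_on_subset[OF h] sets_lebesgue_domain) simp
    show "\<bar>h x\<bar> \<le> B" if "x \<in> \<Omega>" for x
      using B that closure_subset[of \<Omega>] by auto
  qed
qed

lemma test_function_L2:
  assumes \<eta>: "test_fn \<eta>"
  shows "\<eta> \<in> L2" "partial_deriv i \<eta> \<in> L2"
proof -
  have "Ck_on 0 UNIV \<eta>" "Ck_on (Suc 0) UNIV \<eta>" using \<eta> unfolding test_function_def by blast+
  then show "\<eta> \<in> L2" "partial_deriv i \<eta> \<in> L2"
    using assms by (auto intro!: L2_continuous)
qed

lemma L2_norm_le_const:
  assumes h: "h \<in> L2" and e: "\<And>x. \<bar>h x\<bar> \<le> e"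
  shows "nrm h \<le> e * nrm (\<lambda>x. 1)"
proof (rule power2_le_imp_le)
  have "e \<ge> 0" using order_trans[OF abs_ge_zero e] .
  interpret finite_measure "\<mu>"
    by (rule finite_measure_lebesgue_on[OF lmeasurable_domain])
  have "(nrm h)\<^sup>2 \<le> (LINT x|\<mu>. e\<^sup>2)"
    unfolding L2_norm_power2_integral
  proof (rule integral_mono)
    show "(h x)\<^sup>2 \<le> e\<^sup>2" for x
      using power_mono[OF e[of x], of 2] by simp
  qed (use L2_spaceD(2)[OF h] in auto)
  also have "\<dots> = (e * nrm (\<lambda>x. 1))\<^sup>2"
    unfolding power_mult_distrib L2_norm_power2_integral by simp
  finally show "(nrm h)\<^sup>2 \<le> (e * nrm (\<lambda>x. 1))\<^sup>2" .
  show "0 \<le> e * nrm (\<lambda>x. 1)" using \<open>e \<ge> 0\<close> by simp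
qed

text \<open>The continuous extension lives on the closure of a bounded set, which is
  compact.\<close>

lemma Ck_closure_bounded:
  assumes f: "Ck_closure k \<Omega> f"
  shows "continuous_on \<Omega> f" and "\<exists>B. \<forall>x\<in>\<Omega>. \<bar>f x\<bar> \<le> B"
proof -
  obtain g where g: "continuous_on (closure \<Omega>) g" "\<And>x. x \<in> \<Omega> \<Longrightarrow> g x = f x"
    using f by (cases k) auto
  show "continuous_on \<Omega> f"
    using continuous_on_subset[OF g(1) closure_subset] by (rule continuous_on_eq) (rule g(2))
  have "bounded (g ` closure \<Omega>)"
    using \<Omega>(2) g(1) by (intro compact_imp_bounded compact_continuous_image) auto
  then obtain B where "\<forall>y\<in>g ` closure \<Omega>. norm y \<le> B" unfolding bounded_iff by blast
  then have "\<forall>x\<in>\<Omega>. \<bar>f x\<bar> \<le> B"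
    using g(2) closure_subset[of \<Omega>] by force
  then show "\<exists>B. \<forall>x\<in>\<Omega>. \<bar>f x\<bar> \<le> B" ..
qed

lemma L2_Ck_closure_mult:
  assumes A: "Ck_closure k \<Omega> A" and f: "f \<in> L2"
  shows "(\<lambda>x. A x * f x) \<in> L2"
proof -
  obtain B where "\<forall>x\<in>\<Omega>. \<bar>A x\<bar> \<le> B" using Ck_closure_bounded(2)[OF A] ..
  then show ?thesis
    by (intro L2_bounded_mult[OF f, where B = B] continuous_imp_measurable_on_sets_lebesgue
        Ck_closure_bounded(1)[OF A] sets_lebesgue_domain) auto
qed

section \<open>Weak derivatives: C^1 test functions and products\<close>

text \<open>\<open>test_function_approx\<close> approximates \<zeta> and its derivative uniformly,
  hence in L2 on the bounded domain, by the smooth functions that the definition of weak derivatives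
  admits; both sides pass to the limit.\<close>

lemma has_weak_partial_C1_test:
  assumes \<eta>0: "test_fn \<eta>0" "\<eta>0 x0 \<noteq> 0"
    and fg: "has_wp j f g"
    and \<zeta>: "Ck_on (Suc 0) UNIV \<zeta>" "compact (closure {x. \<zeta> x \<noteq> 0})" "closure {x. \<zeta> x \<noteq> 0} \<subseteq> \<Omega>"
  shows "ip f (partial_deriv j \<zeta>) = - ip g \<zeta>"
proof -
  have f: "f \<in> L2" and g: "g \<in> L2" using fg by (auto simp: has_weak_partial_def)
  have \<zeta>L: "\<zeta> \<in> L2" "partial_deriv j \<zeta> \<in> L2"
    using \<zeta>(1) Ck_on_Suc_imp[OF \<zeta>(1)] by (auto intro!: L2_continuous \<Omega>)
  have "\<exists>\<eta>. test_fn \<eta> \<and> (\<forall>x. \<bar>\<eta> x - \<zeta> x\<bar> \<le> inverse (Suc k)) \<and> (\<forall>x. \<bar>partial_deriv j \<eta> x - partial_deriv j \<zeta> x\<bar> \<le> inverse (Suc k))" for k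
    using test_function_approx[OF \<Omega>(1) \<eta>0 \<zeta>, of "inverse (Suc k)"]
    by (metis inverse_positive_iff_positive of_nat_0_less_iff zero_less_Suc)
  then obtain \<eta> where \<eta>: "\<And>k. test_fn (\<eta> k)" "\<And>k x. \<bar>\<eta> k x - \<zeta> x\<bar> \<le> inverse (Suc k)"
    "\<And>k x. \<bar>partial_deriv j (\<eta> k) x - partial_deriv j \<zeta> x\<bar> \<le> inverse (Suc k)" by metis
  note \<eta>L = test_function_L2[OF \<eta>(1)]
  have z: "(\<lambda>k. inverse (real (Suc k)) * nrm (\<lambda>x. 1)) \<longlonglongrightarrow> 0"
    using tendsto_mult_right[OF LIMSEQ_inverse_real_of_nat, of "nrm (\<lambda>x. 1)"] by simp
  have "nrm (\<lambda>x. \<eta> k x - \<zeta> x) \<le> inverse (real (Suc k)) * nrm (\<lambda>x. 1)" for k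
    by (intro L2_norm_le_const L2_diff \<eta>L \<zeta>L \<eta>)
  then have "(\<lambda>k. nrm (\<lambda>x. \<eta> k x - \<zeta> x)) \<longlonglongrightarrow> 0"
    by (intro Lim_null_comparison[OF always_eventually z]) (simp del: of_nat_Suc)
  from tendsto_L2_inner[OF \<eta>L(1) \<zeta>L(1) g this]
  have 1: "(\<lambda>k. - ip g (\<eta> k)) \<longlonglongrightarrow> - ip g \<zeta>"
    by (intro tendsto_minus) (simp add: L2_inner_commute)
  have "nrm (\<lambda>x. partial_deriv j (\<eta> k) x - partial_deriv j \<zeta> x) \<le> inverse (real (Suc k)) * nrm (\<lambda>x. 1)" for k
    by (intro L2_norm_le_const L2_diff \<eta>L \<zeta>L \<eta>)
  then have "(\<lambda>k. nrm (\<lambda>x. partial_deriv j (\<eta> k) x - partial_deriv j \<zeta> x)) \<longlonglongrightarrow> 0"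
    by (intro Lim_null_comparison[OF always_eventually z]) (simp del: of_nat_Suc)
  from tendsto_L2_inner[OF \<eta>L(2) \<zeta>L(2) f this]
  have 2: "(\<lambda>k. ip f (partial_deriv j (\<eta> k))) \<longlonglongrightarrow> ip f (partial_deriv j \<zeta>)"
    by (simp add: L2_inner_commute)
  have "ip f (partial_deriv j (\<eta> k)) = - ip g (\<eta> k)" for k
    using fg \<eta>(1) by (simp add: has_weak_partial_def)
  then show ?thesis
    using LIMSEQ_unique[OF 2] 1 by simp
qed

text \<open>The product of a \<open>C\<^sup>2\<close> coefficient and a test function is not a test function, hence the mollification.\<close>

lemma has_weak_partial_mult:
  assumes \<eta>0: "test_fn \<eta>0" "\<eta>0 x0 \<noteq> 0"
    and fg: "has_wp j f g" and A: "Ck_closure (Suc k) \<Omega> A"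
  shows "has_wp j (\<lambda>x. A x * f x) (\<lambda>x. partial_deriv j A x * f x + A x * g x)"
  unfolding has_weak_partial_def
proof (intro conjI allI impI)
  have f: "f \<in> L2" and g: "g \<in> L2" using fg by (auto simp: has_weak_partial_def)
  have dA: "Ck_closure k \<Omega> (partial_deriv i A)" "\<And>x. x \<in> \<Omega> \<Longrightarrow> A differentiable (at x)" for i
    using A by auto
  show "(\<lambda>x. A x * f x) \<in> L2"
    by (rule L2_Ck_closure_mult[OF A f])
  show "(\<lambda>x. partial_deriv j A x * f x + A x * g x) \<in> L2"
    by (intro L2_add L2_Ck_closure_mult[OF A g] L2_Ck_closure_mult[OF dA(1) f])
  fix \<eta> assume \<eta>: "test_fn \<eta>"
  let ?K = "closure {x. \<eta> x \<noteq> 0}"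
  have K: "compact ?K" "?K \<subseteq> \<Omega>" and \<eta>1: "Ck_on (Suc 0) UNIV \<eta>"
    using \<eta> unfolding test_function_def by blast+
  have \<eta>c: "continuous_on UNIV \<eta>" using Ck_on_Suc_imp[OF \<eta>1] by simp
  \<comment> \<open>The values of A outside \<Omega> are arbitrary, but \<eta> vanishes off the
    compact set \<open>?K\<close> inside \<Omega>; regularity is checked on \<Omega> and on the
    complement of \<open>?K\<close>, which together cover the space.\<close>
  define \<zeta> where "\<zeta> = (\<lambda>x. A x * \<eta> x)"
  have \<zeta>0: "\<zeta> x = 0" "\<eta> x = 0" if "x \<in> - ?K" for x
    using that closure_subset[of "{x. \<eta> x \<noteq> 0}"] by (auto simp: \<zeta>_def)
  have "open (- ?K)" by (rule open_Compl[OF closed_closure])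
  have cover: "UNIV = \<Omega> \<union> - ?K" using K by auto
  have diff: "\<zeta> differentiable (at x)" for x
  proof (cases "x \<in> \<Omega>")
    case True
    then show ?thesis unfolding \<zeta>_def using dA \<eta>1 by (intro differentiable_mult) auto
  next
    case False
    then have "x \<in> - ?K" using K by auto
    have "(\<zeta> has_derivative (\<lambda>h. 0)) (at x)"
    proof (rule has_derivative_transform_within_open[where f = "\<lambda>x. 0" and s = "- ?K"])
      show "0 = \<zeta> y" if "y \<in> - ?K" for y using \<zeta>0(1)[OF that] by simp
    qed (use \<open>x \<in> - ?K\<close> in auto)
    then show ?thesis by (rule differentiableI)
  qed
  have d\<zeta>: "partial_deriv i \<zeta> x = partial_deriv i A x * \<eta> x + A x * partial_deriv i \<eta> x" if "x \<in> \<Omega>" for i x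
    unfolding \<zeta>_def using that dA \<eta>1 by (intro partial_deriv_mult) auto
  have sub: "{x. \<zeta> x \<noteq> 0} \<subseteq> {x. \<eta> x \<noteq> 0}" by (auto simp: \<zeta>_def)
  have cl: "closure {x. \<zeta> x \<noteq> 0} \<subseteq> ?K" by (rule closure_mono[OF sub])
  have d\<zeta>0: "partial_deriv i \<zeta> x = 0" if "x \<in> - ?K" for i x
    using that cl by (intro partial_deriv_zero_outside_support) auto
  have "continuous_on UNIV (partial_deriv i \<zeta>)" for i
    unfolding cover
  proof (rule continuous_on_open_Un[OF \<Omega>(1) \<open>open (- ?K)\<close>])
    have "continuous_on \<Omega> (\<lambda>x. partial_deriv i A x * \<eta> x + A x * partial_deriv i \<eta> x)"
      using \<eta>1 by (intro continuous_intros Ck_closure_bounded(1)[OF A] Ck_closure_bounded(1)[OF dA(1)]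
        continuous_on_subset[OF \<eta>c]) (auto intro: continuous_on_subset)
    then show "continuous_on \<Omega> (partial_deriv i \<zeta>)"
      by (rule continuous_on_eq) (simp add: d\<zeta>)
    have "continuous_on (- ?K) (\<lambda>x. 0::real)" by simp
    then show "continuous_on (- ?K) (partial_deriv i \<zeta>)"
      by (rule continuous_on_eq) (simp add: d\<zeta>0)
  qed
  then have \<zeta>1: "Ck_on (Suc 0) UNIV \<zeta>" using diff by simp
  have \<zeta>K: "compact (closure {x. \<zeta> x \<noteq> 0})"
    using bounded_subset[OF compact_imp_bounded[OF K(1)] order_trans[OF closure_subset cl]] by (simp add: compact_closure)
  have main: "ip f (partial_deriv j \<zeta>) = - ip g \<zeta>"
    by (rule has_weak_partial_C1_test[OF \<eta>0 fg \<zeta>1 \<zeta>K order_trans[OF cl K(2)]])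
  note \<eta>L = test_function_L2[OF \<eta>]
  have L: "(\<lambda>x. partial_deriv j A x * \<eta> x) \<in> L2" "(\<lambda>x. A x * partial_deriv j \<eta> x) \<in> L2"
    by (intro L2_Ck_closure_mult[OF A \<eta>L(2)] L2_Ck_closure_mult[OF dA(1) \<eta>L(1)])+
  have "ip f (partial_deriv j \<zeta>) = ip f (\<lambda>x. partial_deriv j A x * \<eta> x + A x * partial_deriv j \<eta> x)"
    unfolding L2_inner_def by (rule Bochner_Integration.integral_cong) (simp_all add: d\<zeta>)
  also have "\<dots> = ip f (\<lambda>x. partial_deriv j A x * \<eta> x) + ip f (\<lambda>x. A x * partial_deriv j \<eta> x)"
    by (rule L2_inner_add_right[OF L f])
  also have "ip f (\<lambda>x. A x * partial_deriv j \<eta> x) = ip (\<lambda>x. A x * f x) (partial_deriv j \<eta>)"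
    by (simp add: L2_inner_def mult_ac)
  also have "ip f (\<lambda>x. partial_deriv j A x * \<eta> x) = ip (\<lambda>x. partial_deriv j A x * f x) \<eta>"
    by (simp add: L2_inner_def mult_ac)
  also have "ip g \<zeta> = ip (\<lambda>x. A x * g x) \<eta>"
    by (simp add: L2_inner_def \<zeta>_def mult_ac)
  moreover have "ip (\<lambda>x. partial_deriv j A x * f x + A x * g x) \<eta> =
      ip (\<lambda>x. partial_deriv j A x * f x) \<eta> + ip (\<lambda>x. A x * g x) \<eta>"
    by (intro L2_inner_add_left \<eta>L L2_Ck_closure_mult[OF A g] L2_Ck_closure_mult[OF dA(1) f])
  ultimately show "ip (\<lambda>x. A x * f x) (partial_deriv j \<eta>) = - ip (\<lambda>x. partial_deriv j A x * f x + A x * g x) \<eta>"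
    using main by (simp add: L2_inner_def \<zeta>_def mult_ac)
qed

lemma has_weak_partial_AE_cong:
  assumes fg: "has_wp i f g" and f': "f' \<in> L2" "AE x in \<mu>. f x = f' x"
  shows "has_wp i f' g"
proof -
  have "f \<in> L2" using fg by (simp add: has_weak_partial_def)
  then have "ip f (partial_deriv i \<eta>) = ip f' (partial_deriv i \<eta>)" if "test_fn \<eta>" for \<eta>
    by (intro L2_AE_cong f' test_function_L2[OF that])
  then show ?thesis using fg f'(1) by (simp add: has_weak_partial_def)
qed

lemma has_weak_partial_add:
  assumes "has_wp i f g" "has_wp i f' g'"
  shows "has_wp i (\<lambda>x. f x + f' x) (\<lambda>x. g x + g' x)"
  using assms test_function_L2
  by (auto simp: has_weak_partial_def L2_inner_add_left)

lemma has_weak_partial_cmult: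
  assumes "has_wp i f g"
  shows "has_wp i (\<lambda>x. r * f x) (\<lambda>x. r * g x)"
  using assms by (auto simp: has_weak_partial_def L2_inner_cmult_left)

lemma test_function_add:
  assumes "test_fn \<eta>" "test_fn \<xi>"
  shows "test_fn (\<lambda>x. \<eta> x + \<xi> x)"
proof -
  have "{x. \<eta> x + \<xi> x \<noteq> 0} \<subseteq> {x. \<eta> x \<noteq> 0} \<union> {x. \<xi> x \<noteq> 0}" by auto
  from closure_mono[OF this]
  have sub: "closure {x. \<eta> x + \<xi> x \<noteq> 0} \<subseteq> closure {x. \<eta> x \<noteq> 0} \<union> closure {x. \<xi> x \<noteq> 0}" by simp
  have "compact (closure {x. \<eta> x \<noteq> 0} \<union> closure {x. \<xi> x \<noteq> 0})"
    using assms by (auto simp: test_function_def)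
  then have "compact ((closure {x. \<eta> x \<noteq> 0} \<union> closure {x. \<xi> x \<noteq> 0}) \<inter> closure {x. \<eta> x + \<xi> x \<noteq> 0})"
    by (rule compact_Int_closed) simp
  then have "compact (closure {x. \<eta> x + \<xi> x \<noteq> 0})"
    using sub by (simp add: Int_absorb1)
  then show ?thesis
    using assms sub by (auto simp: test_function_def intro!: Ck_on_add)
qed

lemma test_function_cmult:
  assumes "test_fn \<eta>"
  shows "test_fn (\<lambda>x. r * \<eta> x)"
proof -
  have "{x. r * \<eta> x \<noteq> 0} \<subseteq> {x. \<eta> x \<noteq> 0}" by auto
  from closure_mono[OF this]
  have sub: "closure {x. r * \<eta> x \<noteq> 0} \<subseteq> closure {x. \<eta> x \<noteq> 0}" .
  have "compact (closure {x. \<eta> x \<noteq> 0} \<inter> closure {x. r * \<eta> x \<noteq> 0})"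
    using assms by (intro compact_Int_closed) (auto simp: test_function_def)
  then have "compact (closure {x. r * \<eta> x \<noteq> 0})"
    using sub by (simp add: Int_absorb1)
  then show ?thesis
    using assms sub by (auto simp: test_function_def intro!: Ck_on_mult Ck_on_const)
qed

lemma test_function_differentiable: "test_fn \<eta> \<Longrightarrow> \<eta> differentiable (at x)"
  unfolding test_function_def by (metis Ck_on.simps(2) UNIV_I)

lemma partial_deriv_cmult:
  fixes f :: "real^'d \<Rightarrow> real"
  assumes f: "f differentiable (at x)"
  shows "partial_deriv i (\<lambda>x. r * f x) x = r * partial_deriv i f x"
  using partial_deriv_mult[of "\<lambda>_. r" x f i] f by (simp add: partial_deriv_def)

lemma continuous_into_L2_inner:
  assumes F: "continuous_into_L2 T \<Omega> F" and g: "g \<in> L2"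
  shows "continuous_on {0..T} (\<lambda>t. ip (F t) g)"
  unfolding continuous_on_def
proof
  fix t assume t: "t \<in> {0..T}"
  have L: "F s \<in> L2" if "s \<in> {0..T}" for s using F that by (simp add: continuous_into_L2_def)
  show "((\<lambda>t. ip (F t) g) \<longlongrightarrow> ip (F t) g) (at t within {0..T})"
  proof (rule Lim_null[THEN iffD2], rule Lim_null_comparison)
    show "\<forall>\<^sub>F s in at t within {0..T}. norm (ip (F s) g - ip (F t) g) \<le> nrm (\<lambda>x. F s x - F t x) * nrm g"
      unfolding eventually_at_filter
    proof (intro always_eventually allI impI)
      fix s assume s: "s \<in> {0..T}"
      show "norm (ip (F s) g - ip (F t) g) \<le> nrm (\<lambda>x. F s x - F t x) * nrm g"
        using L2_Cauchy_Schwarz[OF L2_diff[OF L[OF s] L[OF t]] g] by (simp add: L2_inner_diff_left[OF L[OF s] L[OF t] g])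
    qed
    have "((\<lambda>s. nrm (\<lambda>x. F s x - F t x)) \<longlongrightarrow> 0) (at t within {0..T})"
      using F t by (simp add: continuous_into_L2_def)
    from tendsto_mult_right[OF this, of "nrm g"]
    show "((\<lambda>s. nrm (\<lambda>x. F s x - F t x) * nrm g) \<longlongrightarrow> 0) (at t within {0..T})" by simp
  qed
qed

lemma continuous_into_L2_norm:
  assumes F: "continuous_into_L2 T \<Omega> F"
  shows "continuous_on {0..T} (\<lambda>t. nrm (F t))"
  unfolding continuous_on_def
proof
  fix t assume t: "t \<in> {0..T}"
  have L: "F s \<in> L2" if "s \<in> {0..T}" for s using F that by (simp add: continuous_into_L2_def)
  show "((\<lambda>t. nrm (F t)) \<longlongrightarrow> nrm (F t)) (at t within {0..T})"
  proof (rule Lim_null[THEN iffD2], rule Lim_null_comparison)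
    show "\<forall>\<^sub>F s in at t within {0..T}. norm (nrm (F s) - nrm (F t)) \<le> nrm (\<lambda>x. F s x - F t x)"
      unfolding eventually_at_filter
    proof (intro always_eventually allI impI)
      fix s assume s: "s \<in> {0..T}"
      show "norm (nrm (F s) - nrm (F t)) \<le> nrm (\<lambda>x. F s x - F t x)"
        using L2_norm_le_add_diff[OF L[OF s] L[OF t]] L2_norm_le_add_diff[OF L[OF t] L[OF s]]
          L2_norm_minus_commute[of "F s" "F t"] by (simp add: abs_le_iff)
    qed
    show "((\<lambda>s. nrm (\<lambda>x. F s x - F t x)) \<longlongrightarrow> 0) (at t within {0..T})"
      using F t by (simp add: continuous_into_L2_def)
  qed
qed

end


section \<open>The eigensystem\<close>

locale elliptic_eigensystem = bounded_domain \<Omega> for \<Omega> :: "(real^'d::finite) set" +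
  fixes A :: "'d \<Rightarrow> 'd \<Rightarrow> real^'d \<Rightarrow> real" and c :: "real^'d \<Rightarrow> real"
    and lam :: "nat \<Rightarrow> real" and \<phi> :: "nat \<Rightarrow> real^'d \<Rightarrow> real"
  assumes A: "\<And>i j. Ck_closure 2 \<Omega> (A i j)" and c: "Ck_closure 2 \<Omega> c"
    and elliptic: "symmetric_uniformly_elliptic \<Omega> A"
    and eigen: "eigensystem \<Omega> A c lam \<phi>"
begin

abbreviation (input) "H1 \<equiv> H_space 1 \<Omega>"
abbreviation (input) "H2 \<equiv> H_space 2 \<Omega>"
abbreviation (input) "H10 \<equiv> H1_0 \<Omega>"
abbreviation (input) "wp \<equiv> weak_partial \<Omega>"
abbreviation (input) "\<L> \<equiv> elliptic_op \<Omega> A c"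
abbreviation (input) "pairing \<equiv> elliptic_pairing \<Omega> A c"

lemma \<phi>_L2: "1 \<le> n \<Longrightarrow> \<phi> n \<in> L2"
  and \<phi>_H1_0: "1 \<le> n \<Longrightarrow> \<phi> n \<in> H10"
  and \<phi>_H2: "1 \<le> n \<Longrightarrow> \<phi> n \<in> H2"
  and \<phi>_orthonormal: "1 \<le> n \<Longrightarrow> 1 \<le> m \<Longrightarrow> ip (\<phi> n) (\<phi> m) = (if n = m then 1 else 0)"
  and \<phi>_basis: "f \<in> L2 \<Longrightarrow> L2_sums \<Omega> (\<lambda>n x. ip f (\<phi> n) * \<phi> n x) f"
  and \<phi>_eigen: "1 \<le> n \<Longrightarrow> AE x in \<mu>. - \<L> (\<phi> n) x = lam n * \<phi> n x"
  using eigen by (auto simp: eigensystem_def L2_orthonormal_basis_def)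

lemma lam_ge: "1 \<le> n \<Longrightarrow> lam 1 \<le> lam n"
proof (induction n rule: dec_induct)
  case (step n)
  then show ?case using eigen by (auto simp: eigensystem_def intro: order_trans)
qed simp

lemma lam_pos: "1 \<le> n \<Longrightarrow> 0 < lam n"
  using lam_ge[of n] eigen by (simp add: eigensystem_def)

lemma L2_A_mult: "f \<in> L2 \<Longrightarrow> (\<lambda>x. A i j x * f x) \<in> L2"
  by (rule L2_Ck_closure_mult[OF A])

lemma L2_c_mult: "f \<in> L2 \<Longrightarrow> (\<lambda>x. c x * f x) \<in> L2"
  by (rule L2_Ck_closure_mult[OF c])

lemma H1_0_D:
  assumes "f \<in> H10"
  shows "f \<in> H1" "f \<in> L2"
  using assms by (auto simp: H1_0_def)

text \<open>The difference has zero coefficients, so its partial sums vanish, yet they converge to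
  it in L2.\<close>

lemma coefficients_eq_imp_AE:
  assumes f: "f \<in> L2" and g: "g \<in> L2"
    and eq: "\<And>n. 1 \<le> n \<Longrightarrow> ip f (\<phi> n) = ip g (\<phi> n)"
  shows "AE x in \<mu>. f x = g x"
proof -
  have fg: "(\<lambda>x. f x - g x) \<in> L2" by (intro L2_diff f g)
  have "(\<Sum>n=1..N. ip (\<lambda>x. f x - g x) (\<phi> n) * \<phi> n x) = 0" for N x
    using eq by (intro sum.neutral) (auto simp: L2_inner_diff_left f g \<phi>_L2)
  then have "nrm (\<lambda>x. f x - g x) = 0"
    using \<phi>_basis[OF fg] by (simp add: L2_sums_def LIMSEQ_const_iff)
  then have "AE x in \<mu>. f x - g x = 0"
    by (rule L2_norm_eq_0_imp_AE[OF fg])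
  then show ?thesis by simp
qed

text \<open>The eigenfunctions are a basis and are limits of test functions, so no density theorem is needed.\<close>

lemma test_function_orthogonal_imp_0:
  assumes g: "g \<in> L2" and orth: "\<And>\<eta>. test_fn \<eta> \<Longrightarrow> ip g \<eta> = 0"
  shows "AE x in \<mu>. g x = 0"
proof (rule coefficients_eq_imp_AE[OF g L2_zero])
  fix n :: nat assume n: "1 \<le> n"
  obtain \<eta> where \<eta>: "\<And>k. test_fn (\<eta> k)" "(\<lambda>k. nrm (\<lambda>x. \<eta> k x - \<phi> n x)) \<longlonglongrightarrow> 0"
    using \<phi>_H1_0[OF n] by (auto simp: H1_0_def)
  have "(\<lambda>k. ip (\<eta> k) g) \<longlonglongrightarrow> ip (\<phi> n) g"
    by (intro tendsto_L2_inner \<eta> g \<phi>_L2 n test_function_L2)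
  moreover have "ip (\<eta> k) g = 0" for k
    using orth[OF \<eta>(1)] by (simp add: L2_inner_commute)
  ultimately have "ip (\<phi> n) g = 0"
    by (simp add: LIMSEQ_const_iff)
  moreover have "ip (\<lambda>x. 0) (\<phi> n) = 0"
    by (simp add: L2_inner_def)
  ultimately show "ip g (\<phi> n) = ip (\<lambda>x. 0) (\<phi> n)"
    by (simp only: L2_inner_commute[of g])
qed

text \<open>Makes the choice in \<open>weak_partial\<close> harmless: two candidates pair equally
  with every test function.\<close>

lemma weak_partial_unique:
  assumes "has_wp i f g" "has_wp i f h"
  shows "AE x in \<mu>. g x = h x"
proof -
  have L: "g \<in> L2" "h \<in> L2"
    using assms by (auto simp: has_weak_partial_def)
  have "AE x in \<mu>. g x - h x = 0"
  proof (rule test_function_orthogonal_imp_0)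
    fix \<eta> assume \<eta>: "test_fn \<eta>"
    then show "ip (\<lambda>x. g x - h x) \<eta> = 0"
      using assms L test_function_L2[OF \<eta>] by (simp add: L2_inner_diff_left has_weak_partial_def)
  qed (intro L2_diff L)
  then show ?thesis by simp
qed

lemma has_weak_partial_weak_partial:
  assumes "has_wp i f g"
  shows "has_wp i f (wp i f)"
  unfolding weak_partial_def by (rule someI[of "has_wp i f", OF assms])

lemma weak_partial_AE:
  assumes "has_wp i f g"
  shows "AE x in \<mu>. wp i f x = g x"
  using weak_partial_unique[OF has_weak_partial_weak_partial[OF assms] assms] .

lemma H1_weak_partial:
  assumes "f \<in> H1"
  shows "f \<in> L2" "has_wp i f (wp i f)" "wp i f \<in> L2"
proof -
  show "f \<in> L2" using assms by simp
  show *: "has_wp i f (wp i f)"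
    using assms by (auto intro: has_weak_partial_weak_partial)
  then show "wp i f \<in> L2" by (simp add: has_weak_partial_def)
qed

lemma H1_I:
  assumes "\<And>i. has_wp i f (g i)"
  shows "f \<in> H1"
  using assms by (auto simp: has_weak_partial_def)

lemma H2_D:
  assumes "f \<in> H2"
  shows "\<exists>g\<in>H1. has_wp i f g"
proof -
  have "f \<in> H_space (Suc 1) \<Omega>" using assms by (simp add: numeral_2_eq_2)
  then show ?thesis unfolding H_space.simps(2)[of 1 \<Omega>] by blast
qed

lemma H2_imp_H1:
  assumes "f \<in> H2"
  shows "f \<in> H1"
proof (rule H1_I)
  fix i
  show "has_wp i f (wp i f)"
    using H2_D[OF assms, of i] by (auto intro: has_weak_partial_weak_partial)
qed

text \<open>\<phi> 1 has norm 1 and is an L2 limit of test functions, so these cannot all vanish.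
  The function found becomes the bump for mollification.\<close>

lemma nonzero_test_function:
  obtains \<eta> x where "test_fn \<eta>" "\<eta> x \<noteq> 0"
proof (rule ccontr)
  assume *: "\<not> thesis"
  obtain \<eta> where \<eta>: "\<And>k. test_fn (\<eta> k)" "(\<lambda>k. nrm (\<lambda>x. \<eta> k x - \<phi> 1 x)) \<longlonglongrightarrow> 0"
    using \<phi>_H1_0[of 1] by (auto simp: H1_0_def)
  have "\<eta> k x = 0" for k x using * that \<eta>(1) by blast
  then have "nrm (\<lambda>x. (-1) * \<phi> 1 x) = 0"
    using \<eta>(2) by (simp add: LIMSEQ_const_iff)
  then show False
    unfolding L2_norm_cmult using \<phi>_orthonormal[of 1 1] by (simp add: L2_norm_def)
qed

section \<open>The elliptic operator and its bilinear form\<close>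

text \<open>\<open>wp i \<psi>\<close> may differ on a null set from the H1 derivative that
  membership in H2 supplies. Weak differentiability is first transferred to it and then passes to
  the product with \<open>A i j\<close>.\<close>

lemma has_weak_partial_flux:
  assumes \<psi>: "\<psi> \<in> H2"
  shows "has_wp j (\<lambda>y. A i j y * wp i \<psi> y) (wp j (\<lambda>y. A i j y * wp i \<psi> y))"
proof -
  obtain g where g: "g \<in> H1" "has_wp i \<psi> g"
    using H2_D[OF \<psi>] by blast
  then obtain h where h: "has_wp j g h" by auto
  have "wp i \<psi> \<in> L2"
    using has_weak_partial_weak_partial[OF g(2)] by (simp add: has_weak_partial_def)
  moreover have "AE x in \<mu>. g x = wp i \<psi> x"
    by (rule weak_partial_unique[OF g(2) has_weak_partial_weak_partial[OF g(2)]])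
  ultimately have 1: "has_wp j (wp i \<psi>) h"
    by (rule has_weak_partial_AE_cong[OF h])
  obtain \<eta> x0 where \<eta>: "test_fn \<eta>" "\<eta> x0 \<noteq> 0" by (rule nonzero_test_function)
  have "Ck_closure (Suc (Suc 0)) \<Omega> (A i j)" using A[of i j] by (simp add: numeral_2_eq_2)
  from has_weak_partial_mult[OF \<eta> 1 this]
  show ?thesis by (rule has_weak_partial_weak_partial)
qed

lemma elliptic_op_L2:
  assumes \<psi>: "\<psi> \<in> H2"
  shows "\<L> \<psi> \<in> L2"
  unfolding elliptic_op_def[abs_def]
  using has_weak_partial_flux[OF \<psi>] H1_weak_partial(1)[OF H2_imp_H1[OF \<psi>]]
  by (intro L2_diff L2_sum L2_c_mult) (auto simp: has_weak_partial_def)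

text \<open>The pairing is defined through chosen representatives; this form accepts any weak
  derivatives, such as sums of them, and so gives bilinearity.\<close>

lemma elliptic_pairing_eq:
  assumes u: "u \<in> L2" "\<And>i. has_wp i u (g i)"
    and \<psi>: "\<psi> \<in> L2" "\<And>i. has_wp i \<psi> (h i)"
  shows "pairing u \<psi> =
    - ((\<Sum>i\<in>UNIV. \<Sum>j\<in>UNIV. ip (g i) (\<lambda>x. A i j x * h j x)) + ip u (\<lambda>x. c x * \<psi> x))"
proof -
  let ?u = "\<lambda>i. wp i u" and ?\<psi> = "\<lambda>i. wp i \<psi>"
  have L: "?u i \<in> L2" "?\<psi> i \<in> L2" "g i \<in> L2" "h i \<in> L2" for i
    using has_weak_partial_weak_partial[OF u(2)] has_weak_partial_weak_partial[OF \<psi>(2)] u(2) \<psi>(2)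
    by (auto simp: has_weak_partial_def)
  have int: "integrable \<mu> (\<lambda>x. A i j x * ?u i x * ?\<psi> j x)" for i j
    using L2_integrable_mult[OF L(1)[of i] L2_A_mult[OF L(2)[of j], of i j]] by (simp add: mult_ac)
  have intc: "integrable \<mu> (\<lambda>x. c x * u x * \<psi> x)"
    using L2_integrable_mult[OF u(1) L2_c_mult[OF \<psi>(1)]] by (simp add: mult_ac)
  have eq: "(LINT x|\<mu>. A i j x * ?u i x * ?\<psi> j x) = ip (g i) (\<lambda>x. A i j x * h j x)" for i j
  proof -
    have "(LINT x|\<mu>. A i j x * ?u i x * ?\<psi> j x) = ip (?u i) (\<lambda>x. A i j x * ?\<psi> j x)"
      by (simp add: L2_inner_def mult_ac)
    also have "\<dots> = ip (g i) (\<lambda>x. A i j x * ?\<psi> j x)"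
      by (intro L2_AE_cong L L2_A_mult weak_partial_AE u)
    also have "\<dots> = ip (\<lambda>x. A i j x * ?\<psi> j x) (g i)"
      by (rule L2_inner_commute)
    also have "\<dots> = ip (\<lambda>x. A i j x * h j x) (g i)"
    proof (intro L2_AE_cong L L2_A_mult)
      show "AE x in \<mu>. A i j x * ?\<psi> j x = A i j x * h j x"
        using weak_partial_AE[OF \<psi>(2)[of j]] by eventually_elim simp
    qed
    finally show ?thesis by (simp add: L2_inner_commute)
  qed
  have "(LINT x|\<mu>. (\<Sum>i\<in>UNIV. \<Sum>j\<in>UNIV. A i j x * ?u i x * ?\<psi> j x) + c x * u x * \<psi> x) =
      (\<Sum>i\<in>UNIV. \<Sum>j\<in>UNIV. ip (g i) (\<lambda>x. A i j x * h j x)) + (LINT x|\<mu>. c x * u x * \<psi> x)"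
    using int intc by (simp add: eq)
  also have "(LINT x|\<mu>. c x * u x * \<psi> x) = ip u (\<lambda>x. c x * \<psi> x)"
    by (simp add: L2_inner_def mult_ac)
  finally show ?thesis by (simp add: elliptic_pairing_def)
qed

lemma L2_inner_A_swap: "ip f (\<lambda>x. A i j x * g x) = ip g (\<lambda>x. A j i x * f x)"
  unfolding L2_inner_def
  by (rule Bochner_Integration.integral_cong) (use elliptic in \<open>auto simp: symmetric_uniformly_elliptic_def mult_ac\<close>)

lemma elliptic_pairing_commute:
  assumes u: "u \<in> H1" and \<psi>: "\<psi> \<in> H1"
  shows "pairing u \<psi> = pairing \<psi> u"
proof -
  have "(\<Sum>i\<in>UNIV. \<Sum>j\<in>UNIV. ip (wp i u) (\<lambda>x. A i j x * wp j \<psi> x)) =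
      (\<Sum>j\<in>UNIV. \<Sum>i\<in>UNIV. ip (wp j \<psi>) (\<lambda>x. A j i x * wp i u x))"
    by (subst sum.swap) (intro sum.cong refl L2_inner_A_swap)
  moreover have "ip u (\<lambda>x. c x * \<psi> x) = ip \<psi> (\<lambda>x. c x * u x)"
    by (simp add: L2_inner_def mult_ac)
  ultimately show ?thesis
    using elliptic_pairing_eq[OF H1_weak_partial(1,2)[OF u] H1_weak_partial(1,2)[OF \<psi>]]
      elliptic_pairing_eq[OF H1_weak_partial(1,2)[OF \<psi>] H1_weak_partial(1,2)[OF u]] by simp
qed

lemma elliptic_pairing_add_left:
  assumes u: "u \<in> H1" and v: "v \<in> H1" and \<psi>: "\<psi> \<in> H1"
  shows "pairing (\<lambda>x. u x + v x) \<psi> = pairing u \<psi> + pairing v \<psi>"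
proof -
  note U = H1_weak_partial[OF u] and V = H1_weak_partial[OF v] and P = H1_weak_partial[OF \<psi>]
  have "ip (\<lambda>x. wp i u x + wp i v x) (\<lambda>x. A i j x * wp j \<psi> x) =
      ip (wp i u) (\<lambda>x. A i j x * wp j \<psi> x) + ip (wp i v) (\<lambda>x. A i j x * wp j \<psi> x)" for i j
    by (intro L2_inner_add_left L2_A_mult U V P)
  moreover have "ip (\<lambda>x. u x + v x) (\<lambda>x. c x * \<psi> x) = ip u (\<lambda>x. c x * \<psi> x) + ip v (\<lambda>x. c x * \<psi> x)"
    by (intro L2_inner_add_left L2_c_mult U V P)
  ultimately show ?thesis
    by (simp add: elliptic_pairing_eq[OF L2_add[OF U(1) V(1)] has_weak_partial_add[OF U(2) V(2)] P(1,2)]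
        elliptic_pairing_eq[OF U(1,2) P(1,2)] elliptic_pairing_eq[OF V(1,2) P(1,2)] sum.distrib)
qed

lemma elliptic_pairing_cmult_left:
  assumes u: "u \<in> H1" and \<psi>: "\<psi> \<in> H1"
  shows "pairing (\<lambda>x. r * u x) \<psi> = r * pairing u \<psi>"
proof -
  note U = H1_weak_partial[OF u] and P = H1_weak_partial[OF \<psi>]
  show ?thesis
    by (simp add: elliptic_pairing_eq[OF L2_cmult[OF U(1)] has_weak_partial_cmult[OF U(2)] P(1,2)]
        elliptic_pairing_eq[OF U(1,2) P(1,2)] L2_inner_cmult_left sum_distrib_left right_diff_distrib)
qed

text \<open>With a test function in place of u, integration by parts is the definition of the weak
  derivative of the flux \<open>?G i j\<close>. H1 convergence carries it to u in H10, so only first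
  derivatives of u occur. Symmetry then exchanges the arguments of the form.\<close>

lemma Green_identity:
  assumes u: "u \<in> H10" and \<psi>: "\<psi> \<in> H2"
  shows "pairing u \<psi> = ip u (\<L> \<psi>)"
proof -
  note U = H1_weak_partial[OF H1_0_D(1)[OF u]] and P = H1_weak_partial[OF H2_imp_H1[OF \<psi>]]
  let ?G = "\<lambda>i j y. A i j y * wp i \<psi> y"
  let ?W = "\<lambda>i j. wp j (?G i j)"
  have G: "has_wp j (?G i j) (?W i j)" for i j
    by (rule has_weak_partial_flux[OF \<psi>])
  then have WL: "?W i j \<in> L2" and GL: "?G i j \<in> L2" for i j
    by (auto simp: has_weak_partial_def)
  obtain \<eta> where \<eta>: "\<And>k. test_fn (\<eta> k)" "(\<lambda>k. nrm (\<lambda>x. \<eta> k x - u x)) \<longlonglongrightarrow> 0"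
    "\<And>i. (\<lambda>k. nrm (\<lambda>x. partial_deriv i (\<eta> k) x - wp i u x)) \<longlonglongrightarrow> 0"
    using u by (auto simp: H1_0_def)
  note \<eta>L = test_function_L2[OF \<eta>(1)]
  have parts: "ip u (?W i j) = - ip (wp j u) (?G i j)" for i j
  proof (rule LIMSEQ_unique)
    show "(\<lambda>k. ip (\<eta> k) (?W i j)) \<longlonglongrightarrow> ip u (?W i j)"
      by (intro tendsto_L2_inner \<eta>L U WL \<eta>)
    have "(\<lambda>k. - ip (partial_deriv j (\<eta> k)) (?G i j)) \<longlonglongrightarrow> - ip (wp j u) (?G i j)"
      by (intro tendsto_minus tendsto_L2_inner \<eta>L U GL \<eta>)
    moreover have "ip (\<eta> k) (?W i j) = - ip (partial_deriv j (\<eta> k)) (?G i j)" for k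
      using G[of j i] \<eta>(1)[of k] by (simp add: has_weak_partial_def L2_inner_commute)
    ultimately show "(\<lambda>k. ip (\<eta> k) (?W i j)) \<longlonglongrightarrow> - ip (wp j u) (?G i j)"
      by simp
  qed
  have "ip u (\<L> \<psi>) =
      (\<Sum>i\<in>UNIV. \<Sum>j\<in>UNIV. ip u (?W i j)) - ip u (\<lambda>x. c x * \<psi> x)"
    unfolding elliptic_op_def[abs_def]
    by (simp add: L2_inner_diff_right L2_inner_sum_right L2_sum WL U L2_c_mult P)
  also have "(\<Sum>i\<in>UNIV. \<Sum>j\<in>UNIV. ip u (?W i j)) =
      - (\<Sum>i\<in>UNIV. \<Sum>j\<in>UNIV. ip (wp i \<psi>) (\<lambda>x. A i j x * wp j u x))"
    unfolding parts sum_negf[symmetric]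
    by (intro sum.cong refl) (simp add: L2_inner_def mult_ac)
  finally have "ip u (\<L> \<psi>) = pairing \<psi> u"
    using elliptic_pairing_eq[OF P(1,2) U(1,2)] by (simp add: L2_inner_def mult_ac)
  then show ?thesis
    using elliptic_pairing_commute[OF H1_0_D(1)[OF u] H2_imp_H1[OF \<psi>]] by simp
qed

lemma elliptic_pairing_\<phi>:
  assumes u: "u \<in> H10" and n: "1 \<le> n"
  shows "pairing u (\<phi> n) = - lam n * ip u (\<phi> n)"
proof -
  have "ip (\<L> (\<phi> n)) u = ip (\<lambda>x. - lam n * \<phi> n x) u"
  proof (rule L2_AE_cong)
    show "AE x in \<mu>. \<L> (\<phi> n) x = - lam n * \<phi> n x"
      using \<phi>_eigen[OF n] by eventually_elim simp
    show "(\<lambda>x. - lam n * \<phi> n x) \<in> L2" by (rule L2_cmult[OF \<phi>_L2[OF n]])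
  qed (intro elliptic_op_L2 \<phi>_H2 n H1_0_D(2) u)+
  then have "ip u (\<L> (\<phi> n)) = - lam n * ip u (\<phi> n)"
    unfolding L2_inner_cmult_left by (simp add: L2_inner_commute)
  then show ?thesis using Green_identity[OF u \<phi>_H2[OF n]] by simp
qed

text \<open>Green's identity and the symmetry of the form move \<open>\<L>\<close> from \<psi> to
  \<phi> n, where it acts as - lam n.\<close>

lemma elliptic_op_coefficient:
  assumes "\<psi> \<in> H2" "\<psi> \<in> H10" and n: "1 \<le> n"
  shows "ip (\<L> \<psi>) (\<phi> n) = - lam n * ip \<psi> (\<phi> n)"
  using Green_identity[OF \<phi>_H1_0[OF n] assms(1)] elliptic_pairing_\<phi>[OF assms(2) n]
    elliptic_pairing_commute[OF H1_0_D(1)[OF \<phi>_H1_0[OF n]] H1_0_D(1)[OF assms(2)]]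
  by (simp add: L2_inner_commute)

text \<open>Ellipticity, with \<xi> the weak gradient at x, bounds the leading part pointwise. The
  zero-order term has no sign, so a bound for |c| times the squared L2 norm is added.\<close>

lemma Garding:
  obtains \<theta> C where "0 < \<theta>" "0 \<le> C"
    "\<And>w. w \<in> H1 \<Longrightarrow> \<theta> * (\<Sum>i\<in>UNIV. (nrm (wp i w))\<^sup>2) \<le> - pairing w w + C * (nrm w)\<^sup>2"
proof -
  obtain \<theta> where \<theta>: "0 < \<theta>"
    "\<And>x \<xi>. x \<in> \<Omega> \<Longrightarrow> \<theta> * (norm \<xi>)\<^sup>2 \<le> (\<Sum>i\<in>UNIV. \<Sum>j\<in>UNIV. A i j x * \<xi> $ i * \<xi> $ j)"
    using elliptic by (auto simp: symmetric_uniformly_elliptic_def)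
  obtain C where C: "\<forall>x\<in>\<Omega>. \<bar>c x\<bar> \<le> C" using Ck_closure_bounded(2)[OF c] ..
  show ?thesis
  proof (rule that[of \<theta> "\<bar>C\<bar>"])
    fix w assume w: "w \<in> H1"
    note W = H1_weak_partial[OF w]
    let ?w = "\<lambda>i. wp i w"
    have int1: "integrable \<mu> (\<lambda>x. A i j x * ?w i x * ?w j x)" for i j
      using L2_integrable_mult[OF W(3)[of i] L2_A_mult[OF W(3)[of j], of i j]] by (simp add: mult_ac)
    have int2: "integrable \<mu> (\<lambda>x. c x * w x * w x)"
      using L2_integrable_mult[OF W(1) L2_c_mult[OF W(1)]] by (simp add: mult_ac)
    have "\<theta> * (\<Sum>i\<in>UNIV. (nrm (?w i))\<^sup>2) = (LINT x|\<mu>. \<theta> * (\<Sum>i\<in>UNIV. (?w i x)\<^sup>2))"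
      unfolding L2_norm_power2_integral using L2_spaceD(2)[OF W(3)] by simp
    also have "\<dots> \<le> (LINT x|\<mu>. ((\<Sum>i\<in>UNIV. \<Sum>j\<in>UNIV. A i j x * ?w i x * ?w j x) + c x * w x * w x) + \<bar>C\<bar> * (w x)\<^sup>2)"
    proof (rule integral_mono)
      fix x assume "x \<in> space \<mu>"
      then have x: "x \<in> \<Omega>" by simp
      have "(norm (\<chi> i. ?w i x))\<^sup>2 = (\<Sum>i\<in>UNIV. (?w i x)\<^sup>2)"
        by (simp add: norm_vec_def L2_set_def sum_nonneg)
      then have "\<theta> * (\<Sum>i\<in>UNIV. (?w i x)\<^sup>2) \<le> (\<Sum>i\<in>UNIV. \<Sum>j\<in>UNIV. A i j x * ?w i x * ?w j x)"
        using \<theta>(2)[OF x, of "\<chi> i. ?w i x"] by simp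
      moreover have "- (\<bar>C\<bar> * (w x)\<^sup>2) \<le> c x * w x * w x"
      proof -
        have "- \<bar>C\<bar> \<le> c x" using C x by (auto simp: abs_le_iff)
        from mult_right_mono[OF this, of "(w x)\<^sup>2"] show ?thesis by (simp add: power2_eq_square mult.assoc)
      qed
      ultimately show "\<theta> * (\<Sum>i\<in>UNIV. (?w i x)\<^sup>2) \<le> ((\<Sum>i\<in>UNIV. \<Sum>j\<in>UNIV. A i j x * ?w i x * ?w j x) + c x * w x * w x) + \<bar>C\<bar> * (w x)\<^sup>2"
        by linarith
    qed (use int1 int2 L2_spaceD(2)[OF W(3)] L2_spaceD(2)[OF W(1)] in \<open>auto\<close>)
    also have "\<dots> = - pairing w w + \<bar>C\<bar> * (nrm w)\<^sup>2"
      unfolding elliptic_pairing_def L2_norm_power2_integral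
      using int1 int2 L2_spaceD(2)[OF W(1)] by simp
    finally show "\<theta> * (\<Sum>i\<in>UNIV. (nrm (?w i))\<^sup>2) \<le> - pairing w w + \<bar>C\<bar> * (nrm w)\<^sup>2" .
  qed (use \<theta> in auto)
qed

end


context elliptic_eigensystem
begin

section \<open>H10 as a linear space\<close>

text \<open>The definition of \<open>H1_0\<close> refers to the chosen \<open>weak_partial\<close>;
  this rule accepts any weak derivative.\<close>

lemma H1_0_I:
  assumes f: "f \<in> L2" and g: "\<And>i. has_wp i f (g i)"
    and \<eta>: "\<And>k. test_fn (\<eta> k)" "(\<lambda>k. nrm (\<lambda>x. \<eta> k x - f x)) \<longlonglongrightarrow> 0"
      "\<And>i. (\<lambda>k. nrm (\<lambda>x. partial_deriv i (\<eta> k) x - g i x)) \<longlonglongrightarrow> 0"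
  shows "f \<in> H10"
proof -
  note wp = has_weak_partial_weak_partial[OF g]
  have L: "g i \<in> L2" "wp i f \<in> L2" for i
    using g[of i] wp[of i] by (auto simp: has_weak_partial_def)
  have "nrm (\<lambda>x. partial_deriv i (\<eta> k) x - wp i f x) = nrm (\<lambda>x. partial_deriv i (\<eta> k) x - g i x)" for i k
  proof (intro L2_norm_AE_cong L2_diff L test_function_L2[OF \<eta>(1)])
    show "AE x in \<mu>. partial_deriv i (\<eta> k) x - wp i f x = partial_deriv i (\<eta> k) x - g i x"
      using weak_partial_AE[OF g[of i]] by eventually_elim simp
  qed
  then show ?thesis
    using \<eta> H1_I[OF g] by (auto simp: H1_0_def intro!: exI[of _ \<eta>])
qed

lemma H1_0_approx:
  assumes "f \<in> H10"
  obtains \<eta> where "\<And>k. test_fn (\<eta> k)" "(\<lambda>k. nrm (\<lambda>x. \<eta> k x - f x)) \<longlonglongrightarrow> 0"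
    "\<And>i. (\<lambda>k. nrm (\<lambda>x. partial_deriv i (\<eta> k) x - wp i f x)) \<longlonglongrightarrow> 0"
  using assms by (auto simp: H1_0_def)

lemma H1_0_add:
  assumes f: "f \<in> H10" and g: "g \<in> H10"
  shows "(\<lambda>x. f x + g x) \<in> H10"
proof -
  note Fd = H1_weak_partial[OF H1_0_D(1)[OF f]] and Gd = H1_weak_partial[OF H1_0_D(1)[OF g]]
  obtain \<eta> where \<eta>: "\<And>k. test_fn (\<eta> k)" "(\<lambda>k. nrm (\<lambda>x. \<eta> k x - f x)) \<longlonglongrightarrow> 0"
    "\<And>i. (\<lambda>k. nrm (\<lambda>x. partial_deriv i (\<eta> k) x - wp i f x)) \<longlonglongrightarrow> 0"
    using H1_0_approx[OF f] by blast
  obtain \<xi> where \<xi>: "\<And>k. test_fn (\<xi> k)" "(\<lambda>k. nrm (\<lambda>x. \<xi> k x - g x)) \<longlonglongrightarrow> 0"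
    "\<And>i. (\<lambda>k. nrm (\<lambda>x. partial_deriv i (\<xi> k) x - wp i g x)) \<longlonglongrightarrow> 0"
    using H1_0_approx[OF g] by blast
  note \<eta>L = test_function_L2[OF \<eta>(1)] and \<xi>L = test_function_L2[OF \<xi>(1)]
  have lim: "(\<lambda>k. nrm (\<lambda>x. (p k x + r k x) - (p' x + r' x))) \<longlonglongrightarrow> 0"
    if "\<And>k. p k \<in> L2" "\<And>k. r k \<in> L2" "p' \<in> L2" "r' \<in> L2"
      "(\<lambda>k. nrm (\<lambda>x. p k x - p' x)) \<longlonglongrightarrow> 0" "(\<lambda>k. nrm (\<lambda>x. r k x - r' x)) \<longlonglongrightarrow> 0"
    for p r :: "nat \<Rightarrow> real^'d \<Rightarrow> real" and p' r'
  proof (rule Lim_null_comparison[OF always_eventually])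
    show "\<forall>k. norm (nrm (\<lambda>x. (p k x + r k x) - (p' x + r' x))) \<le> nrm (\<lambda>x. p k x - p' x) + nrm (\<lambda>x. r k x - r' x)"
      using L2_norm_triangle[OF L2_diff[OF that(1,3)] L2_diff[OF that(2,4)]] by (simp add: algebra_simps)
    show "(\<lambda>k. nrm (\<lambda>x. p k x - p' x) + nrm (\<lambda>x. r k x - r' x)) \<longlonglongrightarrow> 0"
      using tendsto_add[OF that(5,6)] by simp
  qed
  show ?thesis
  proof (rule H1_0_I)
    show "test_fn (\<lambda>x. \<eta> k x + \<xi> k x)" for k
      by (intro test_function_add \<eta> \<xi>)
    show "has_wp i (\<lambda>x. f x + g x) (\<lambda>x. wp i f x + wp i g x)" for i
      by (intro has_weak_partial_add \<Omega> Fd Gd)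
    show "(\<lambda>k. nrm (\<lambda>x. \<eta> k x + \<xi> k x - (f x + g x))) \<longlonglongrightarrow> 0"
      by (intro lim \<eta>L \<xi>L Fd Gd \<eta> \<xi>)
    have "partial_deriv i (\<lambda>x. \<eta> k x + \<xi> k x) x = partial_deriv i (\<eta> k) x + partial_deriv i (\<xi> k) x" for i k x
      by (intro partial_deriv_add test_function_differentiable[OF \<eta>(1)] test_function_differentiable[OF \<xi>(1)])
    then show "(\<lambda>k. nrm (\<lambda>x. partial_deriv i (\<lambda>x. \<eta> k x + \<xi> k x) x - (wp i f x + wp i g x))) \<longlonglongrightarrow> 0" for i
      using lim[OF \<eta>L(2) \<xi>L(2) Fd(3) Gd(3) \<eta>(3) \<xi>(3), of i] by simp
  qed (intro L2_add Fd Gd)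
qed

lemma H1_0_cmult:
  assumes f: "f \<in> H10"
  shows "(\<lambda>x. r * f x) \<in> H10"
proof -
  note Fd = H1_weak_partial[OF H1_0_D(1)[OF f]]
  obtain \<eta> where \<eta>: "\<And>k. test_fn (\<eta> k)" "(\<lambda>k. nrm (\<lambda>x. \<eta> k x - f x)) \<longlonglongrightarrow> 0"
    "\<And>i. (\<lambda>k. nrm (\<lambda>x. partial_deriv i (\<eta> k) x - wp i f x)) \<longlonglongrightarrow> 0"
    using H1_0_approx[OF f] by blast
  have lim: "(\<lambda>k. nrm (\<lambda>x. r * p k x - r * p' x)) \<longlonglongrightarrow> 0"
    if "(\<lambda>k. nrm (\<lambda>x. p k x - p' x)) \<longlonglongrightarrow> 0" for p :: "nat \<Rightarrow> real^'d \<Rightarrow> real" and p'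
    using tendsto_mult_left[OF that, of "\<bar>r\<bar>"] by (simp add: right_diff_distrib[symmetric] L2_norm_cmult)
  show ?thesis
  proof (rule H1_0_I)
    show "test_fn (\<lambda>x. r * \<eta> k x)" for k
      by (intro test_function_cmult \<eta>)
    show "has_wp i (\<lambda>x. r * f x) (\<lambda>x. r * wp i f x)" for i
      by (intro has_weak_partial_cmult Fd)
    show "(\<lambda>k. nrm (\<lambda>x. r * \<eta> k x - r * f x)) \<longlonglongrightarrow> 0"
      by (intro lim \<eta>)
    show "(\<lambda>k. nrm (\<lambda>x. partial_deriv i (\<lambda>x. r * \<eta> k x) x - r * wp i f x)) \<longlonglongrightarrow> 0" for i
      using lim[OF \<eta>(3), of i] by (simp add: partial_deriv_cmult test_function_differentiable[OF \<eta>(1)])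
  qed (intro L2_cmult Fd)
qed

section \<open>Finite eigenfunction sums, Bessel and Parseval\<close>

text \<open>The index set is arbitrary because both partial sums over {1..N} and blocks over {M<..N}
  occur.\<close>

definition eigen_sum :: "(nat \<Rightarrow> real) \<Rightarrow> nat set \<Rightarrow> real^'d \<Rightarrow> real" where
  "eigen_sum b I = (\<lambda>x. \<Sum>n\<in>I. b n * \<phi> n x)"

lemma eigen_sum_in_H1_0:
  assumes "finite I" "\<And>n. n \<in> I \<Longrightarrow> 1 \<le> n"
  shows "eigen_sum b I \<in> H10"
  using assms
proof (induction I)
  case empty
  show ?case using H1_0_cmult[OF \<phi>_H1_0[of 1], of 0] by (simp add: eigen_sum_def)
next
  case (insert n I)
  then have "(\<lambda>x. b n * \<phi> n x + eigen_sum b I x) \<in> H10"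
    by (intro H1_0_add H1_0_cmult \<phi>_H1_0) auto
  then show ?case using insert by (simp add: eigen_sum_def)
qed

lemma eigen_sum_L2:
  assumes "\<And>n. n \<in> I \<Longrightarrow> 1 \<le> n"
  shows "eigen_sum b I \<in> L2"
  unfolding eigen_sum_def by (intro L2_sum L2_cmult \<phi>_L2 assms)

lemma eigen_sum_inner:
  assumes "\<And>n. n \<in> I \<Longrightarrow> 1 \<le> n" and h: "h \<in> L2"
  shows "ip h (eigen_sum b I) = (\<Sum>n\<in>I. b n * ip h (\<phi> n))"
  unfolding eigen_sum_def using assms by (simp add: L2_inner_sum_right L2_cmult \<phi>_L2 L2_inner_cmult_right)

lemma eigen_sum_coefficient:
  assumes I: "finite I" "\<And>n. n \<in> I \<Longrightarrow> 1 \<le> n" and m: "1 \<le> m"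
  shows "ip (eigen_sum b I) (\<phi> m) = (if m \<in> I then b m else 0)"
proof -
  have "ip (eigen_sum b I) (\<phi> m) = (\<Sum>n\<in>I. b n * ip (\<phi> m) (\<phi> n))"
    using eigen_sum_inner[OF I(2) \<phi>_L2[OF m]] by (simp add: L2_inner_commute)
  also have "\<dots> = (\<Sum>n\<in>I. if n = m then b n else 0)"
    using \<phi>_orthonormal[OF m] I(2) by (intro sum.cong) auto
  finally show ?thesis using I(1) by (simp add: sum.delta')
qed

lemma eigen_sum_norm:
  assumes I: "finite I" "\<And>n. n \<in> I \<Longrightarrow> 1 \<le> n"
  shows "(nrm (eigen_sum b I))\<^sup>2 = (\<Sum>n\<in>I. (b n)\<^sup>2)"
proof -
  have "(nrm (eigen_sum b I))\<^sup>2 = (\<Sum>n\<in>I. b n * ip (eigen_sum b I) (\<phi> n))"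
    unfolding L2_norm_power2 by (intro eigen_sum_inner eigen_sum_L2 I)
  also have "\<dots> = (\<Sum>n\<in>I. (b n)\<^sup>2)"
    using I by (intro sum.cong) (auto simp: eigen_sum_coefficient power2_eq_square)
  finally show ?thesis .
qed

lemma eigen_sum_pairing:
  assumes "finite I" "\<And>n. n \<in> I \<Longrightarrow> 1 \<le> n" and u: "u \<in> H10"
  shows "pairing (eigen_sum b I) u = - (\<Sum>n\<in>I. lam n * b n * ip u (\<phi> n))"
  using assms(1,2)
proof (induction I)
  case empty
  have "pairing (\<lambda>x. 0 * u x) u = 0"
    by (subst elliptic_pairing_cmult_left[OF H1_0_D(1)[OF u] H1_0_D(1)[OF u]]) simp
  then show ?case by (simp add: eigen_sum_def)
next
  case (insert n I)
  have n: "1 \<le> n" using insert by auto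
  have S: "eigen_sum b I \<in> H1"
    using insert by (intro H1_0_D(1) eigen_sum_in_H1_0) auto
  have P: "\<phi> n \<in> H1" "(\<lambda>x. b n * \<phi> n x) \<in> H1"
    by (intro H1_0_D(1) H1_0_cmult \<phi>_H1_0 n)+
  have "pairing (eigen_sum b (insert n I)) u =
      pairing (\<lambda>x. b n * \<phi> n x + eigen_sum b I x) u"
    using insert by (simp add: eigen_sum_def)
  also have "\<dots> = b n * pairing (\<phi> n) u + pairing (eigen_sum b I) u"
    using elliptic_pairing_add_left[OF P(2) S H1_0_D(1)[OF u]] elliptic_pairing_cmult_left[OF P(1) H1_0_D(1)[OF u]] by simp
  also have "pairing (\<phi> n) u = - lam n * ip u (\<phi> n)"
    using elliptic_pairing_commute[OF P(1) H1_0_D(1)[OF u]] elliptic_pairing_\<phi>[OF u n] by simp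
  finally show ?case using insert by simp
qed

lemma eigen_sum_energy:
  assumes "finite I" "\<And>n. n \<in> I \<Longrightarrow> 1 \<le> n"
  shows "- pairing (eigen_sum b I) (eigen_sum b I) = (\<Sum>n\<in>I. lam n * (b n)\<^sup>2)"
  using eigen_sum_pairing[OF assms eigen_sum_in_H1_0[OF assms]] assms
  by (simp add: eigen_sum_coefficient power2_eq_square mult.assoc)

lemma partial_sum_eq: "(\<Sum>n=1..N. b n * \<phi> n x) = eigen_sum b {1..N} x"
  by (simp add: eigen_sum_def)

lemma L2_diff_eigen_sum_norm:
  assumes f: "f \<in> L2"
  shows "(nrm (\<lambda>x. f x - eigen_sum (\<lambda>n. ip f (\<phi> n)) {1..N} x))\<^sup>2 =
    (nrm f)\<^sup>2 - (\<Sum>n=1..N. (ip f (\<phi> n))\<^sup>2)"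
proof -
  let ?S = "eigen_sum (\<lambda>n. ip f (\<phi> n)) {1..N}"
  have S: "?S \<in> L2" by (intro eigen_sum_L2) auto
  have fS: "ip f ?S = (\<Sum>n=1..N. (ip f (\<phi> n))\<^sup>2)"
    by (subst eigen_sum_inner[OF _ f]) (auto simp: power2_eq_square)
  have SS: "ip ?S ?S = (\<Sum>n=1..N. (ip f (\<phi> n))\<^sup>2)"
    unfolding L2_norm_power2[symmetric] by (intro eigen_sum_norm) auto
  show ?thesis
    unfolding L2_norm_power2
    by (simp add: L2_inner_diff_left L2_inner_diff_right L2_diff f S L2_inner_commute[of ?S f] fS SS del: One_nat_def)
qed

lemma Bessel:
  assumes f: "f \<in> L2"
  shows "(\<Sum>n=1..N. (ip f (\<phi> n))\<^sup>2) \<le> (nrm f)\<^sup>2"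
  using L2_diff_eigen_sum_norm[OF f, of N]
    zero_le_power2[of "nrm (\<lambda>x. f x - eigen_sum (\<lambda>n. ip f (\<phi> n)) {1..N} x)"] by linarith

text \<open>Cauchy-Schwarz for f and the tail of g. The tail does not depend on f, so over a bounded
  family of f the convergence is uniform.\<close>

lemma Parseval_remainder:
  assumes f: "f \<in> L2" and g: "g \<in> L2"
  shows "\<bar>ip f g - (\<Sum>n=1..N. ip g (\<phi> n) * ip f (\<phi> n))\<bar> \<le>
    nrm f * nrm (\<lambda>x. g x - (\<Sum>n=1..N. ip g (\<phi> n) * \<phi> n x))"
proof -
  let ?S = "eigen_sum (\<lambda>n. ip g (\<phi> n)) {1..N}"
  have S: "?S \<in> L2" by (intro eigen_sum_L2) auto
  have "ip f g - (\<Sum>n=1..N. ip g (\<phi> n) * ip f (\<phi> n)) = ip f (\<lambda>x. g x - ?S x)"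
    by (subst eigen_sum_inner[OF _ f, symmetric]) (auto simp: L2_inner_diff_right f g S simp del: One_nat_def)
  also have "\<bar>\<dots>\<bar> \<le> nrm f * nrm (\<lambda>x. g x - ?S x)"
    by (intro L2_Cauchy_Schwarz f L2_diff g S)
  finally show ?thesis by (simp add: partial_sum_eq del: One_nat_def)
qed

lemma Parseval:
  assumes f: "f \<in> L2" and g: "g \<in> L2"
  shows "(\<lambda>N. \<Sum>n=1..N. ip g (\<phi> n) * ip f (\<phi> n)) \<longlonglongrightarrow> ip f g"
proof (rule Lim_null[THEN iffD2], rule Lim_null_comparison[OF always_eventually])
  show "\<forall>N. norm ((\<Sum>n=1..N. ip g (\<phi> n) * ip f (\<phi> n)) - ip f g) \<le>
      nrm f * nrm (\<lambda>x. g x - (\<Sum>n=1..N. ip g (\<phi> n) * \<phi> n x))"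
    using Parseval_remainder[OF f g] by (simp add: abs_minus_commute)
  show "(\<lambda>N. nrm f * nrm (\<lambda>x. g x - (\<Sum>n=1..N. ip g (\<phi> n) * \<phi> n x))) \<longlonglongrightarrow> 0"
    using tendsto_mult_left[OF \<phi>_basis[OF g, unfolded L2_sums_def], of "nrm f"] by simp
qed

text \<open>Bessel's inequality for the energy form, which need not be nonnegative but is bounded below by Garding's inequality.\<close>

lemma H1_0_energy_bound:
  assumes u: "u \<in> H10"
  obtains K where "\<And>N. (\<Sum>n=1..N. lam n * (ip u (\<phi> n))\<^sup>2) \<le> K"
proof -
  obtain \<theta> C where C: "0 < \<theta>" "0 \<le> C" "\<And>w. w \<in> H1 \<Longrightarrow>
      \<theta> * (\<Sum>i\<in>UNIV. (nrm (wp i w))\<^sup>2) \<le> - pairing w w + C * (nrm w)\<^sup>2"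
    using Garding by blast
  let ?B = "pairing"
  note uL = H1_0_D(2)[OF u]
  have "(\<Sum>n=1..N. lam n * (ip u (\<phi> n))\<^sup>2) \<le> - ?B u u + C * (nrm u)\<^sup>2" for N
  proof -
    define b where "b = (\<lambda>n. ip u (\<phi> n))"
    let ?S = "eigen_sum b {1..N}" and ?E = "\<Sum>n=1..N. lam n * (b n)\<^sup>2"
    define mS where "mS = (\<lambda>x. (-1) * ?S x)"
    define w where "w = (\<lambda>x. u x + mS x)"
    have S: "?S \<in> H10" by (rule eigen_sum_in_H1_0) auto
    have mS: "mS \<in> H10" unfolding mS_def by (rule H1_0_cmult[OF S])
    have w: "w \<in> H10" unfolding w_def by (rule H1_0_add[OF u mS])
    have Bw: "?B w h = ?B u h - ?B ?S h" if h: "h \<in> H10" for h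
      unfolding w_def mS_def
      using elliptic_pairing_add_left[OF H1_0_D(1)[OF u] H1_0_D(1)[OF mS] H1_0_D(1)[OF h]]
        elliptic_pairing_cmult_left[OF H1_0_D(1)[OF S] H1_0_D(1)[OF h], of "-1"] by (simp add: mS_def)
    have BSu: "?B ?S u = - ?E"
      by (subst eigen_sum_pairing[OF _ _ u]) (auto simp: b_def power2_eq_square mult.assoc)
    have BSS: "?B ?S ?S = - ?E"
      using eigen_sum_energy[of "{1..N}" b] by simp
    \<comment> \<open>B(S, u) = B(S, S) = -E, so expanding leaves -B(w, w) = -B(u, u) - E, which
      Garding's inequality bounds from below.\<close>
    have "?B w w = ?B u w - ?B ?S w" by (rule Bw[OF w])
    also have "?B u w = ?B u u - ?B ?S u"
      using Bw[OF u] elliptic_pairing_commute[OF H1_0_D(1)[OF w] H1_0_D(1)[OF u]] by simp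
    also have "?B ?S w = ?B ?S u - ?B ?S ?S"
      using Bw[OF S] elliptic_pairing_commute[OF H1_0_D(1)[OF w] H1_0_D(1)[OF S]]
        elliptic_pairing_commute[OF H1_0_D(1)[OF u] H1_0_D(1)[OF S]] by simp
    finally have Bww: "- ?B w w = - ?B u u - ?E" by (simp add: BSu BSS del: One_nat_def)
    have "(nrm w)\<^sup>2 \<le> (nrm u)\<^sup>2"
    proof -
      have "w = (\<lambda>x. u x - ?S x)" by (simp add: w_def mS_def)
      then have "(nrm w)\<^sup>2 = (nrm u)\<^sup>2 - (\<Sum>n=1..N. (b n)\<^sup>2)"
        using L2_diff_eigen_sum_norm[OF uL, of N] by (simp add: b_def)
      then show ?thesis by (simp add: sum_nonneg)
    qed
    then have "C * (nrm w)\<^sup>2 \<le> C * (nrm u)\<^sup>2"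
      using C(2) by (rule mult_left_mono)
    moreover have "0 \<le> \<theta> * (\<Sum>i\<in>UNIV. (nrm (wp i w))\<^sup>2)"
      using C(1) by (simp add: sum_nonneg)
    ultimately show ?thesis
      using C(3)[OF H1_0_D(1)[OF w]] Bww unfolding b_def by linarith
  qed
  then show ?thesis by (rule that)
qed

section \<open>Convergence of eigenfunction series in H10\<close>

text \<open>Against a fixed test function the weak derivative passes to the limit. For the
  approximation of g, each f k is replaced by a test function within 1/(k + 1) of it in L2, together
  with all first derivatives.\<close>

lemma H1_0_closed:
  assumes f: "\<And>k. f k \<in> H10" and g: "g \<in> L2" "(\<lambda>k. nrm (\<lambda>x. f k x - g x)) \<longlonglongrightarrow> 0"
    and h: "\<And>i. h i \<in> L2" "\<And>i. (\<lambda>k. nrm (\<lambda>x. wp i (f k) x - h i x)) \<longlonglongrightarrow> 0"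
  shows "g \<in> H10"
proof -
  note Fd = H1_weak_partial[OF H1_0_D(1)[OF f]]
  have wp: "has_wp i g (h i)" for i
    unfolding has_weak_partial_def
  proof (intro conjI allI impI g h)
    fix \<eta> assume \<eta>: "test_fn \<eta>"
    note \<eta>L = test_function_L2[OF \<eta>]
    have "(\<lambda>k. ip (f k) (partial_deriv i \<eta>)) \<longlonglongrightarrow> ip g (partial_deriv i \<eta>)"
      by (intro tendsto_L2_inner Fd g \<eta>L)
    moreover have "(\<lambda>k. - ip (wp i (f k)) \<eta>) \<longlonglongrightarrow> - ip (h i) \<eta>"
      by (intro tendsto_minus tendsto_L2_inner Fd h \<eta>L)
    moreover have "ip (f k) (partial_deriv i \<eta>) = - ip (wp i (f k)) \<eta>" for k
      using Fd(2)[of i k] \<eta> by (simp add: has_weak_partial_def)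
    ultimately show "ip g (partial_deriv i \<eta>) = - ip (h i) \<eta>"
      by (simp add: LIMSEQ_unique)
  qed
  have "\<exists>\<eta>. test_fn \<eta> \<and> nrm (\<lambda>x. \<eta> x - f k x) < inverse (Suc k) \<and>
      (\<forall>i. nrm (\<lambda>x. partial_deriv i \<eta> x - wp i (f k) x) < inverse (Suc k))" for k
  proof -
    obtain \<eta> where \<eta>: "\<And>m. test_fn (\<eta> m)" "(\<lambda>m. nrm (\<lambda>x. \<eta> m x - f k x)) \<longlonglongrightarrow> 0"
      "\<And>i. (\<lambda>m. nrm (\<lambda>x. partial_deriv i (\<eta> m) x - wp i (f k) x)) \<longlonglongrightarrow> 0"
      using H1_0_approx[OF f] by blast
    have pos: "0 < inverse (real (Suc k))" by simp
    have "\<forall>\<^sub>F m in sequentially. nrm (\<lambda>x. \<eta> m x - f k x) < inverse (Suc k) \<and>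
      (\<forall>i. nrm (\<lambda>x. partial_deriv i (\<eta> m) x - wp i (f k) x) < inverse (Suc k))"
      by (intro eventually_conj eventually_all_finite order_tendstoD(2)[OF \<eta>(2) pos] order_tendstoD(2)[OF \<eta>(3) pos])
    then obtain m where "nrm (\<lambda>x. \<eta> m x - f k x) < inverse (Suc k) \<and>
      (\<forall>i. nrm (\<lambda>x. partial_deriv i (\<eta> m) x - wp i (f k) x) < inverse (Suc k))"
      by (auto simp: eventually_sequentially)
    then show ?thesis using \<eta>(1) by blast
  qed
  then obtain \<eta> where \<eta>: "\<And>k. test_fn (\<eta> k)" "\<And>k. nrm (\<lambda>x. \<eta> k x - f k x) < inverse (Suc k)"
    "\<And>k i. nrm (\<lambda>x. partial_deriv i (\<eta> k) x - wp i (f k) x) < inverse (Suc k)"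
    by metis
  note \<eta>L = test_function_L2[OF \<eta>(1)]
  have lim: "(\<lambda>k. nrm (\<lambda>x. p k x - r x)) \<longlonglongrightarrow> 0"
    if "\<And>k. p k \<in> L2" "\<And>k. p' k \<in> L2" "r \<in> L2"
      "\<And>k. nrm (\<lambda>x. p k x - p' k x) < inverse (Suc k)" "(\<lambda>k. nrm (\<lambda>x. p' k x - r x)) \<longlonglongrightarrow> 0"
    for p p' :: "nat \<Rightarrow> real^'d \<Rightarrow> real" and r
  proof (rule Lim_null_comparison[OF always_eventually])
    show "\<forall>k. norm (nrm (\<lambda>x. p k x - r x)) \<le> inverse (real (Suc k)) + nrm (\<lambda>x. p' k x - r x)"
    proof
      fix k
      show "norm (nrm (\<lambda>x. p k x - r x)) \<le> inverse (real (Suc k)) + nrm (\<lambda>x. p' k x - r x)"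
        using L2_norm_diff_triangle[OF that(1)[of k] that(2)[of k] that(3)] that(4)[of k]
        unfolding real_norm_def abs_of_nonneg[OF L2_norm_nonneg] by linarith
    qed
    show "(\<lambda>k. inverse (real (Suc k)) + nrm (\<lambda>x. p' k x - r x)) \<longlonglongrightarrow> 0"
      using tendsto_add[OF LIMSEQ_inverse_real_of_nat that(5)] by simp
  qed
  show ?thesis
    by (rule H1_0_I[where \<eta> = \<eta>, OF g(1) wp \<eta>(1)]) (intro lim[OF \<eta>L(1) Fd(1) g(1) \<eta>(2) g(2)] lim[OF \<eta>L(2) Fd(3) h(1) \<eta>(3) h(2)])+
qed

text \<open>The energy E of the partial sums increases and is bounded, hence Cauchy. The energy of a
  block controls its L2 norm through \<open>lam 1\<close> and its gradient through Garding's
  inequality, so the partial sums are Cauchy in H1 and \<open>H1_0_closed\<close> applies.\<close>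

lemma eigen_series_in_H1_0:
  assumes K: "\<And>N. (\<Sum>n=1..N. lam n * (b n)\<^sup>2) \<le> K"
  obtains f where "f \<in> H10" "L2_sums \<Omega> (\<lambda>n x. b n * \<phi> n x) f"
    "\<And>n. 1 \<le> n \<Longrightarrow> ip f (\<phi> n) = b n" "(nrm f)\<^sup>2 \<le> K / lam 1"
proof -
  obtain \<theta> C where C: "0 < \<theta>" "0 \<le> C" "\<And>w. w \<in> H1 \<Longrightarrow>
      \<theta> * (\<Sum>i\<in>UNIV. (nrm (wp i w))\<^sup>2) \<le> - pairing w w + C * (nrm w)\<^sup>2"
    using Garding by blast
  have l1: "0 < lam 1" by (rule lam_pos) simp
  define S where "S = (\<lambda>N. eigen_sum b {1..N})"
  define E where "E = (\<lambda>N. \<Sum>n=1..N. lam n * (b n)\<^sup>2)"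
  have S: "S N \<in> H10" for N unfolding S_def by (rule eigen_sum_in_H1_0) auto
  note Sd = H1_weak_partial[OF H1_0_D(1)[OF S]]
  have "incseq E"
    unfolding E_def using lam_pos by (intro incseq_SucI) (simp add: less_imp_le)
  then have "convergent E"
    by (rule incseq_convergent[of E K]) (use K in \<open>auto simp: E_def convergent_def\<close>)
  then have CauchyE: "Cauchy E" by (rule convergent_Cauchy)
  have norm_le: "(\<Sum>n\<in>I. (b n)\<^sup>2) \<le> (\<Sum>n\<in>I. lam n * (b n)\<^sup>2) / lam 1" if "\<And>n. n \<in> I \<Longrightarrow> 1 \<le> n" for I
    unfolding sum_divide_distrib
  proof (rule sum_mono)
    fix n assume "n \<in> I"
    then have "lam 1 * (b n)\<^sup>2 \<le> lam n * (b n)\<^sup>2" by (intro mult_right_mono lam_ge that) auto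
    then show "(b n)\<^sup>2 \<le> lam n * (b n)\<^sup>2 / lam 1" using l1 by (simp add: field_simps)
  qed
  \<comment> \<open>The constants come from \<open>lam 1 \<le> lam n\<close> and from \<theta> |grad
    w|^2 \<le> e + C |w|^2 \<le> (1 + C / lam 1) e, where w is the block, e its energy and |.| the
    L2 norm.\<close>
  have diff: "(nrm (\<lambda>x. S N x - S M x))\<^sup>2 \<le> 1 / lam 1 * (E N - E M) \<and>
      (nrm (\<lambda>x. wp i (S N) x - wp i (S M) x))\<^sup>2 \<le> (1 + C / lam 1) / \<theta> * (E N - E M)"
    if MN: "M \<le> N" for M N i
  proof -
    let ?w = "eigen_sum b {M<..N}"
    have split: "{1..N} = {1..M} \<union> {M<..N}" "{1..M} \<inter> {M<..N} = {}" using MN by auto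
    have EE: "(\<Sum>n\<in>{M<..N}. lam n * (b n)\<^sup>2) = E N - E M"
      unfolding E_def split(1) by (subst sum.union_disjoint[OF _ _ split(2)]) auto
    have SS: "S N x = S M x + ?w x" for x
      unfolding S_def eigen_sum_def split(1) by (rule sum.union_disjoint[OF _ _ split(2)]) auto
    have w: "?w \<in> H10" by (rule eigen_sum_in_H1_0) auto
    note wd = H1_weak_partial[OF H1_0_D(1)[OF w]]
    have wn: "(nrm ?w)\<^sup>2 \<le> (E N - E M) / lam 1"
      using eigen_sum_norm[of "{M<..N}" b] norm_le[of "{M<..N}"] EE by simp
    have "S N = (\<lambda>x. S M x + ?w x)" using SS by (rule ext)
    \<comment> \<open>\<open>wp\<close> is chosen separately for each function and is therefore
      additive only almost everywhere.\<close>
    then have "has_wp i (S N) (\<lambda>x. wp i (S M) x + wp i ?w x)"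
      using has_weak_partial_add[OF Sd(2)[of i M] wd(2)[of i]] by simp
    from weak_partial_AE[OF this]
    have "AE x in \<mu>. wp i (S N) x - wp i (S M) x = wp i ?w x"
      by eventually_elim simp
    then have "nrm (\<lambda>x. wp i (S N) x - wp i (S M) x) = nrm (wp i ?w)"
      by (intro L2_norm_AE_cong L2_diff Sd wd)
    moreover have "(nrm (wp i ?w))\<^sup>2 \<le> (1 + C / lam 1) / \<theta> * (E N - E M)"
    proof -
      have "\<theta> * (nrm (wp i ?w))\<^sup>2 \<le> \<theta> * (\<Sum>i\<in>UNIV. (nrm (wp i ?w))\<^sup>2)"
        using C(1) by (intro mult_left_mono member_le_sum) auto
      also have "\<dots> \<le> - pairing ?w ?w + C * (nrm ?w)\<^sup>2"
        by (rule C(3)[OF H1_0_D(1)[OF w]])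
      also have "- pairing ?w ?w = E N - E M"
        using eigen_sum_energy[of "{M<..N}" b] EE by simp
      also have "C * (nrm ?w)\<^sup>2 \<le> C * ((E N - E M) / lam 1)"
        by (rule mult_left_mono[OF wn C(2)])
      finally have "\<theta> * (nrm (wp i ?w))\<^sup>2 \<le> (1 + C / lam 1) * (E N - E M)"
        by (simp add: algebra_simps)
      then show ?thesis using C(1) by (simp add: pos_le_divide_eq mult.commute)
    qed
    moreover have "(\<lambda>x. S N x - S M x) = ?w" using SS by (simp add: fun_eq_iff)
    ultimately show ?thesis using wn by simp
  qed
  have cauchy: "\<exists>N. \<forall>m\<ge>N. \<forall>n\<ge>N. nrm (\<lambda>x. p m x - p n x) < e"
    if p: "\<And>M N. M \<le> N \<Longrightarrow> (nrm (\<lambda>x. p N x - p M x))\<^sup>2 \<le> Q * (E N - E M)" and Q: "0 < Q" and e: "0 < e"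
    for p :: "nat \<Rightarrow> real^'d \<Rightarrow> real" and Q e
  proof -
    obtain N where N: "\<And>m n. N \<le> m \<Longrightarrow> N \<le> n \<Longrightarrow> \<bar>E m - E n\<bar> < e\<^sup>2 / Q"
      using CauchyE e Q unfolding Cauchy_def dist_real_def by (metis divide_pos_pos zero_less_power)
    have *: "nrm (\<lambda>x. p n x - p m x) < e" if "N \<le> m" "m \<le> n" for m n
    proof (rule power2_less_imp_less)
      have "(nrm (\<lambda>x. p n x - p m x))\<^sup>2 \<le> Q * (E n - E m)" by (rule p[OF that(2)])
      also have "\<dots> < Q * (e\<^sup>2 / Q)"
        using N[of n m] that Q by (intro mult_strict_left_mono) auto
      finally show "(nrm (\<lambda>x. p n x - p m x))\<^sup>2 < e\<^sup>2" using Q by simp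
    qed (use e in simp)
    show ?thesis
    proof (intro exI[of _ N] allI impI)
      fix m n assume "N \<le> m" "N \<le> n"
      then show "nrm (\<lambda>x. p m x - p n x) < e"
        using *[of m n] *[of n m] L2_norm_minus_commute[of "p m" "p n"] by (cases "m \<le> n") auto
    qed
  qed
  have Q: "0 < 1 / lam 1" "0 < (1 + C / lam 1) / \<theta>"
    using l1 C by (auto intro!: divide_pos_pos add_pos_nonneg)
  obtain f where f: "f \<in> L2" "(\<lambda>k. nrm (\<lambda>x. S k x - f x)) \<longlonglongrightarrow> 0"
    by (rule L2_complete[OF Sd(1) cauchy[OF conjunct1[OF diff] Q(1)]])
  have "\<exists>h. h \<in> L2 \<and> (\<lambda>k. nrm (\<lambda>x. wp i (S k) x - h x)) \<longlonglongrightarrow> 0" for i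
  proof -
    obtain h where "h \<in> L2" "(\<lambda>k. nrm (\<lambda>x. wp i (S k) x - h x)) \<longlonglongrightarrow> 0"
      by (rule L2_complete[OF Sd(3)[of i] cauchy[OF conjunct2[OF diff[where i = i]] Q(2)]])
    then show ?thesis by (intro exI[of _ h] conjI)
  qed
  then have "\<exists>h. \<forall>i. h i \<in> L2 \<and> (\<lambda>k. nrm (\<lambda>x. wp i (S k) x - h i x)) \<longlonglongrightarrow> 0"
    by (intro choice allI)
  then obtain h where h: "\<And>i. h i \<in> L2" "\<And>i. (\<lambda>k. nrm (\<lambda>x. wp i (S k) x - h i x)) \<longlonglongrightarrow> 0"
    by blast
  show ?thesis
  proof (rule that)
    show "f \<in> H10" by (rule H1_0_closed[OF S f h])
    show "L2_sums \<Omega> (\<lambda>n x. b n * \<phi> n x) f"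
      using f(2) by (simp add: L2_sums_def partial_sum_eq S_def L2_norm_minus_commute[of f] del: One_nat_def)
    show "ip f (\<phi> n) = b n" if n: "1 \<le> n" for n
    proof (rule LIMSEQ_unique)
      show "(\<lambda>N. ip (S N) (\<phi> n)) \<longlonglongrightarrow> ip f (\<phi> n)"
        by (intro tendsto_L2_inner Sd f \<phi>_L2 n)
      have "\<forall>\<^sub>F N in sequentially. b n = ip (S N) (\<phi> n)"
        using eventually_ge_at_top[of n]
        by eventually_elim (unfold S_def, subst eigen_sum_coefficient, use n in auto)
      then show "(\<lambda>N. ip (S N) (\<phi> n)) \<longlonglongrightarrow> b n"
        by (rule Lim_transform_eventually[OF tendsto_const])
    qed
    show "(nrm f)\<^sup>2 \<le> K / lam 1"
    proof (rule LIMSEQ_le_const2)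
      show "(\<lambda>N. (nrm (S N))\<^sup>2) \<longlonglongrightarrow> (nrm f)\<^sup>2"
        by (intro tendsto_power tendsto_L2_norm Sd f)
      have "(nrm (S N))\<^sup>2 \<le> K / lam 1" for N
      proof -
        have "(nrm (S N))\<^sup>2 = (\<Sum>n=1..N. (b n)\<^sup>2)" unfolding S_def by (rule eigen_sum_norm) auto
        also have "\<dots> \<le> E N / lam 1" unfolding E_def by (rule norm_le) auto
        also have "\<dots> \<le> K / lam 1" using K l1 by (simp add: E_def divide_right_mono)
        finally show ?thesis .
      qed
      then show "\<exists>N. \<forall>n\<ge>N. (nrm (S n))\<^sup>2 \<le> K / lam 1" by blast
    qed
  qed
qed

end


section \<open>Weak solutions\<close>

lemma uniform_limit_bound:
  fixes f :: "nat \<Rightarrow> 'a \<Rightarrow> real"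
  assumes "\<And>n x. x \<in> S \<Longrightarrow> \<bar>f n x - g x\<bar> \<le> r n" and r: "r \<longlonglongrightarrow> 0"
  shows "uniform_limit S f g sequentially"
proof (rule uniform_limitI)
  fix e :: real assume "0 < e"
  with r have "\<forall>\<^sub>F n in sequentially. r n < e" by (rule order_tendstoD(2))
  then show "\<forall>\<^sub>F n in sequentially. \<forall>x\<in>S. dist (f n x) (g x) < e"
    by eventually_elim (auto simp: dist_real_def intro: order.strict_trans1[OF assms(1)])
qed

context elliptic_eigensystem
begin

context
  fixes \<alpha> T :: real and a :: "real \<Rightarrow> real" and F :: "real \<Rightarrow> real^'d \<Rightarrow> real" and u0 :: "real^'d \<Rightarrow> real"
  assumes T: "0 < T" and \<alpha>: "0 < \<alpha>" "\<alpha> < 1"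
    and a: "continuous_on {0..T} a" "\<And>t. t \<in> {0..T} \<Longrightarrow> 0 < a t"
    and F: "continuous_into_L2 T \<Omega> F" and u0: "u0 \<in> H10"
begin

section \<open>The modes and their sum\<close>

abbreviation mode :: "nat \<Rightarrow> (real \<Rightarrow> real) \<Rightarrow> bool" where
  "mode n \<equiv> frac_ode_solution \<alpha> T a (lam n) (\<lambda>t. ip (F t) (\<phi> n)) (ip u0 (\<phi> n))"

lemma F_L2: "t \<in> {0..T} \<Longrightarrow> F t \<in> L2"
  using F by (simp add: continuous_into_L2_def)

lemma F_coefficient_continuous: "1 \<le> n \<Longrightarrow> continuous_on {0..T} (\<lambda>t. ip (F t) (\<phi> n))"
  by (rule continuous_into_L2_inner[OF F \<phi>_L2])

lemma mode_iff:
  assumes "1 \<le> n"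
  shows "mode n y \<longleftrightarrow> continuous_on {0..T} y \<and>
    (\<forall>t\<in>{0..T}. y t = ip u0 (\<phi> n) + frac_int \<alpha> (\<lambda>s. ip (F s) (\<phi> n) - lam n * a s * y s) t)"
  by (rule frac_ode_solution_iff[OF \<alpha> T a(1) F_coefficient_continuous[OF assms]])

lemma modes_energy_bound:
  assumes U: "\<And>n. 1 \<le> n \<Longrightarrow> mode n (U n)"
  obtains K where "\<And>t N. t \<in> {0..T} \<Longrightarrow> (\<Sum>n=1..N. lam n * (U n t)\<^sup>2) \<le> K"
proof -
  obtain K0 where K0: "\<And>N. (\<Sum>n=1..N. lam n * (ip u0 (\<phi> n))\<^sup>2) \<le> K0"
    using H1_0_energy_bound[OF u0] by blast
  obtain t0 where t0: "t0 \<in> {0..T}" "\<And>t. t \<in> {0..T} \<Longrightarrow> a t0 \<le> a t"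
    using continuous_attains_inf[OF compact_Icc _ a(1)] T by auto
  \<comment> \<open>The minimum of a, positive because it is attained.\<close>
  define q where "q = a t0"
  have q: "0 < q" "\<And>t. t \<in> {0..T} \<Longrightarrow> q \<le> a t" using a(2) t0 by (auto simp: q_def)
  obtain B where B: "0 \<le> B" "\<And>s. s \<in> {0..T} \<Longrightarrow> \<bar>nrm (F s)\<bar> \<le> B"
    using continuous_on_Icc_bounded[OF continuous_into_L2_norm[OF F]] by blast
  let ?f = "\<lambda>n s. ip (F s) (\<phi> n)"
  have "(\<Sum>n=1..N. lam n * (U n t)\<^sup>2) \<le> K0 + 1 / (2 * q) * (B\<^sup>2 * (T powr \<alpha> / Gamma (\<alpha> + 1)))"
    if t: "t \<in> {0..T}" for t N
  proof -
    have fc: "continuous_on {0..T} (\<lambda>s. (?f n s)\<^sup>2)" if "1 \<le> n" for n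
      by (intro continuous_intros F_coefficient_continuous that)
    have "(\<Sum>n=1..N. lam n * (U n t)\<^sup>2) \<le>
        (\<Sum>n=1..N. lam n * (ip u0 (\<phi> n))\<^sup>2 + 1 / (2 * q) * frac_int \<alpha> (\<lambda>s. (?f n s)\<^sup>2) t)"
    proof (rule sum_mono)
      fix n assume "n \<in> {1..N}"
      then have n: "1 \<le> n" by simp
      show "lam n * (U n t)\<^sup>2 \<le> lam n * (ip u0 (\<phi> n))\<^sup>2 + 1 / (2 * q) * frac_int \<alpha> (\<lambda>s. (?f n s)\<^sup>2) t"
        using U[OF n] unfolding mode_iff[OF n]
        by (intro frac_volterra_square_le[OF \<alpha> a(1) q(2) q(1) lam_pos[OF n] F_coefficient_continuous[OF n] _ _ t]) blast+
    qed
    also have "\<dots> = (\<Sum>n=1..N. lam n * (ip u0 (\<phi> n))\<^sup>2) + 1 / (2 * q) * (\<Sum>n=1..N. frac_int \<alpha> (\<lambda>s. (?f n s)\<^sup>2) t)"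
      by (simp add: sum.distrib sum_distrib_left)
    also have "(\<Sum>n=1..N. frac_int \<alpha> (\<lambda>s. (?f n s)\<^sup>2) t) = frac_int \<alpha> (\<lambda>s. \<Sum>n=1..N. (?f n s)\<^sup>2) t"
    proof (rule conjunct2[OF frac_int_sum, symmetric])
      fix n assume "n \<in> {1..N}"
      then show "frac_integrable \<alpha> (\<lambda>s. (?f n s)\<^sup>2) t"
        using t by (intro frac_integrable_continuous \<alpha> continuous_on_subset[OF fc]) auto
    qed simp
    \<comment> \<open>Bessel's inequality for F s bounds the integrand independently of N.\<close>
    also have "\<dots> \<le> B\<^sup>2 * (T powr \<alpha> / Gamma (\<alpha> + 1))"
    proof (rule order_trans[OF abs_ge_self frac_int_abs_le[OF \<alpha>(1) t]])
      show "continuous_on {0..T} (\<lambda>s. \<Sum>n=1..N. (?f n s)\<^sup>2)"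
        by (intro continuous_on_sum fc) simp
      fix s assume s: "s \<in> {0..T}"
      have "(\<Sum>n=1..N. (?f n s)\<^sup>2) \<le> (nrm (F s))\<^sup>2" by (rule Bessel[OF F_L2[OF s]])
      also have "\<dots> \<le> B\<^sup>2" using B(2)[OF s] by (intro power_mono) auto
      finally show "\<bar>\<Sum>n=1..N. (?f n s)\<^sup>2\<bar> \<le> B\<^sup>2" by (simp add: sum_nonneg)
    qed
    finally show ?thesis using K0[of N] q(1) by (simp add: mult_left_mono divide_right_mono)
  qed
  then show ?thesis by (rule that)
qed

text \<open>The Volterra equations are summed with the weights (\<psi>, \<phi>_n). Only the
  coefficients of u t and a bound on its norm are given; continuity of (u(t), \<psi>) in t comes out
  of the uniform limit.\<close>

lemma weak_solution_of_modes:
  assumes U: "\<And>n. 1 \<le> n \<Longrightarrow> mode n (U n)"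
    and u: "\<And>t. t \<in> {0..T} \<Longrightarrow> u t \<in> H10"
    and coeff: "\<And>t n. t \<in> {0..T} \<Longrightarrow> 1 \<le> n \<Longrightarrow> ip (u t) (\<phi> n) = U n t"
    and M: "\<And>t. t \<in> {0..T} \<Longrightarrow> nrm (u t) \<le> M"
  shows "weak_solution \<alpha> T \<Omega> A c a F u0 u"
  unfolding weak_solution_def
proof (intro conjI ballI)
  have 0: "0 \<in> {0..T}" using T by simp
  have uL: "u t \<in> L2" if "t \<in> {0..T}" for t by (rule H1_0_D(2)[OF u[OF that]])
  show "u 0 \<in> L2" by (rule uL[OF 0])
  show "u t \<in> H10" if "t \<in> {0<..T}" for t using u that by simp
  note u0L = H1_0_D(2)[OF u0]
  have U0: "U n 0 = ip u0 (\<phi> n)" if "1 \<le> n" for n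
    using U[OF that] by (simp add: frac_ode_solution_def)
  fix \<psi> assume "\<psi> \<in> H2 \<inter> H10"
  then have \<psi>: "\<psi> \<in> H2" "\<psi> \<in> H10" by auto
  note \<psi>L = H1_0_D(2)[OF \<psi>(2)]
  have "AE x in \<mu>. u 0 x = u0 x"
    by (rule coefficients_eq_imp_AE[OF uL[OF 0] u0L]) (simp add: coeff[OF 0] U0)
  then show init: "ip (u 0) \<psi> = ip u0 \<psi>"
    by (rule L2_AE_cong[OF uL[OF 0] u0L _ \<psi>L])
  define g where "g = \<L> \<psi>"
  have g: "g \<in> L2" unfolding g_def by (rule elliptic_op_L2[OF \<psi>(1)])
  have g_coeff: "ip g (\<phi> n) = - lam n * ip \<psi> (\<phi> n)" if "1 \<le> n" for n
    unfolding g_def by (rule elliptic_op_coefficient[OF \<psi> that])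
  define p where "p = (\<lambda>n. ip \<psi> (\<phi> n))"
  define f where "f = (\<lambda>n s. ip (F s) (\<phi> n))"
  \<comment> \<open>The candidate for the Caputo derivative of (u(t), \<psi>), with
    \<open>\<L>\<close> moved onto \<psi>.\<close>
  define d where "d = (\<lambda>t. a t * ip (u t) g + ip (F t) \<psi>)"
  define D where "D = (\<lambda>n s. f n s - lam n * a s * U n s)"
  define dN where "dN = (\<lambda>N t. \<Sum>n=1..N. p n * D n t)"
  have Uc: "continuous_on {0..T} (U n)" if "1 \<le> n" for n
    using U[OF that] by (simp add: frac_ode_solution_def)
  have Dc: "continuous_on {0..T} (D n)" if "1 \<le> n" for n
    unfolding D_def f_def by (intro continuous_intros a(1) Uc that F_coefficient_continuous)
  have dNc: "continuous_on {0..T} (dN N)" for N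
    unfolding dN_def by (intro continuous_intros Dc) simp
  obtain B where B: "0 \<le> B" "\<And>s. s \<in> {0..T} \<Longrightarrow> \<bar>nrm (F s)\<bar> \<le> B"
    using continuous_on_Icc_bounded[OF continuous_into_L2_norm[OF F]] by blast
  obtain Ba where Ba: "0 \<le> Ba" "\<And>s. s \<in> {0..T} \<Longrightarrow> \<bar>a s\<bar> \<le> Ba"
    using continuous_on_Icc_bounded[OF a(1)] by blast
  let ?rg = "\<lambda>N. nrm (\<lambda>x. g x - (\<Sum>n=1..N. ip g (\<phi> n) * \<phi> n x))"
  let ?r\<psi> = "\<lambda>N. nrm (\<lambda>x. \<psi> x - (\<Sum>n=1..N. ip \<psi> (\<phi> n) * \<phi> n x))"
  have M0: "0 \<le> M" using order_trans[OF L2_norm_nonneg M[OF 0]] .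
  have lim: "uniform_limit {0..T} dN d sequentially"
  proof (rule uniform_limit_bound)
    fix N t assume t: "t \<in> {0..T}"
    \<comment> \<open>The unbounded factor lam n is absorbed: - lam n (\<psi>, \<phi>_n) is a
      coefficient of the L2 function g = \<open>\<L> \<psi>\<close>.\<close>
    have "dN N t = a t * (\<Sum>n=1..N. ip g (\<phi> n) * ip (u t) (\<phi> n)) + (\<Sum>n=1..N. ip \<psi> (\<phi> n) * ip (F t) (\<phi> n))"
      unfolding dN_def sum_distrib_left sum.distrib[symmetric]
      by (intro sum.cong refl) (simp add: D_def p_def f_def g_coeff coeff[OF t] algebra_simps)
    moreover define X Y where "X = ip (u t) g - (\<Sum>n=1..N. ip g (\<phi> n) * ip (u t) (\<phi> n))"
      and "Y = ip (F t) \<psi> - (\<Sum>n=1..N. ip \<psi> (\<phi> n) * ip (F t) (\<phi> n))"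
    ultimately have "d t - dN N t = a t * X + Y"
      by (simp add: d_def right_diff_distrib)
    then have "\<bar>d t - dN N t\<bar> \<le> \<bar>a t\<bar> * \<bar>X\<bar> + \<bar>Y\<bar>"
      using abs_triangle_ineq[of "a t * X" Y] by (simp add: abs_mult)
    also have "\<dots> \<le> Ba * (nrm (u t) * ?rg N) + nrm (F t) * ?r\<psi> N"
      unfolding X_def Y_def
      by (rule add_mono[OF mult_mono[OF Ba(2)[OF t] Parseval_remainder[OF uL[OF t] g] Ba(1) abs_ge_zero]
          Parseval_remainder[OF F_L2[OF t] \<psi>L]])
    also have "\<dots> \<le> Ba * (M * ?rg N) + B * ?r\<psi> N"
      by (rule add_mono[OF mult_left_mono[OF mult_right_mono[OF M[OF t] L2_norm_nonneg] Ba(1)] mult_right_mono[OF _ L2_norm_nonneg]])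
        (use B(2)[OF t] in simp)
    finally show "\<bar>dN N t - d t\<bar> \<le> Ba * (M * ?rg N) + B * ?r\<psi> N" by (simp add: abs_minus_commute)
  next
    have "(\<lambda>N. Ba * (M * ?rg N) + B * ?r\<psi> N) \<longlonglongrightarrow> Ba * (M * 0) + B * 0"
      using \<phi>_basis[OF g] \<phi>_basis[OF \<psi>L] unfolding L2_sums_def by (intro tendsto_intros)
    then show "(\<lambda>N. Ba * (M * ?rg N) + B * ?r\<psi> N) \<longlonglongrightarrow> 0" by simp
  qed
  have dc: "continuous_on {0..T} d"
    by (rule uniform_limit_theorem[OF _ lim]) (auto simp: dNc)
  have y: "ip (u t) \<psi> = ip u0 \<psi> + frac_int \<alpha> d t" if t: "t \<in> {0..T}" for t
  proof (rule LIMSEQ_unique)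
    show "(\<lambda>N. \<Sum>n=1..N. ip \<psi> (\<phi> n) * ip (u t) (\<phi> n)) \<longlonglongrightarrow> ip (u t) \<psi>"
      by (rule Parseval[OF uL[OF t] \<psi>L])
    have "(\<Sum>n=1..N. ip \<psi> (\<phi> n) * ip (u t) (\<phi> n)) =
        (\<Sum>n=1..N. ip \<psi> (\<phi> n) * ip u0 (\<phi> n)) + frac_int \<alpha> (dN N) t" for N
    proof -
      have "frac_int \<alpha> (dN N) t = (\<Sum>n=1..N. frac_int \<alpha> (\<lambda>s. p n * D n s) t)"
        unfolding dN_def using t
        by (intro conjunct2[OF frac_int_sum] frac_integrable_cmult frac_integrable_continuous \<alpha> continuous_on_subset[OF Dc]) auto
      moreover have "ip (u t) (\<phi> n) = ip u0 (\<phi> n) + frac_int \<alpha> (D n) t" if n: "n \<in> {1..N}" for n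
      proof -
        have n: "1 \<le> n" using n by simp
        show ?thesis using U[OF n] t unfolding mode_iff[OF n] by (simp add: coeff[OF t n] D_def f_def)
      qed
      ultimately show ?thesis
        unfolding frac_int_cmult by (simp add: sum.distrib[symmetric] p_def distrib_left)
    qed
    moreover have "(\<lambda>N. (\<Sum>n=1..N. ip \<psi> (\<phi> n) * ip u0 (\<phi> n)) + frac_int \<alpha> (dN N) t) \<longlonglongrightarrow>
        ip u0 \<psi> + frac_int \<alpha> d t"
      by (intro tendsto_add Parseval u0L \<psi>L tendsto_uniform_limitI[OF uniform_limit_frac_int[OF \<alpha>(1) dNc dc lim] t])
    ultimately show "(\<lambda>N. \<Sum>n=1..N. ip \<psi> (\<phi> n) * ip (u t) (\<phi> n)) \<longlonglongrightarrow> ip u0 \<psi> + frac_int \<alpha> d t"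
      by simp
  qed
  have "has_caputo_deriv \<alpha> T (\<lambda>t. ip (u t) \<psi>) d {0..T}"
    by (rule has_caputo_deriv_frac_int[OF \<alpha> dc y])
  then have "has_caputo_deriv \<alpha> T (\<lambda>t. ip (u t) \<psi>) d {0<..T}"
    by (auto simp: has_caputo_deriv_def)
  moreover have "d t - a t * pairing (u t) \<psi> = ip (F t) \<psi>" if t: "t \<in> {0<..T}" for t
  proof -
    have "pairing (u t) \<psi> = ip (u t) g"
      unfolding g_def by (rule Green_identity[OF u \<psi>(1)]) (use t in simp)
    then show ?thesis by (simp add: d_def)
  qed
  ultimately show "\<exists>D. has_caputo_deriv \<alpha> T (\<lambda>t. ip (u t) \<psi>) D {0<..T} \<and>
      (\<forall>t\<in>{0<..T}. D t - a t * pairing (u t) \<psi> = ip (F t) \<psi>)"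
    by blast
qed

text \<open>The D of the weak formulation is given on (0,T] only. There it equals \<open>D'\<close>,
  which is continuous up to 0, so Abel inversion yields the Volterra equation and with it the ODE at
  t = 0 as well.\<close>

lemma weak_solution_mode:
  assumes v: "weak_solution \<alpha> T \<Omega> A c a F u0 v" and n: "1 \<le> n"
  shows "mode n (\<lambda>t. ip (v t) (\<phi> n))"
proof -
  let ?y = "\<lambda>t. ip (v t) (\<phi> n)"
  have "\<phi> n \<in> H2 \<inter> H10" using \<phi>_H2[OF n] \<phi>_H1_0[OF n] by simp
  with v obtain D where D: "has_caputo_deriv \<alpha> T ?y D {0<..T}"
      "\<And>t. t \<in> {0<..T} \<Longrightarrow> D t - a t * pairing (v t) (\<phi> n) = ip (F t) (\<phi> n)"
    and init: "?y 0 = ip u0 (\<phi> n)"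
    unfolding weak_solution_def by blast
  define D' where "D' = (\<lambda>s. ip (F s) (\<phi> n) - lam n * a s * ?y s)"
  have yc: "continuous_on {0..T} ?y" using D(1) by (simp add: has_caputo_deriv_def)
  have D'c: "continuous_on {0..T} D'"
    unfolding D'_def by (intro continuous_intros a(1) yc F_coefficient_continuous n)
  have "D t = D' t" if t: "t \<in> {0<..T}" for t
  proof -
    have "v t \<in> H10" using v t by (simp add: weak_solution_def)
    from elliptic_pairing_\<phi>[OF this n] D(2)[OF t] show ?thesis by (simp add: D'_def algebra_simps)
  qed
  then have "has_caputo_deriv \<alpha> T ?y D' {0<..T}" using D(1) by (simp add: has_caputo_deriv_def)
  from caputo_deriv_imp_frac_int[OF \<alpha> T D'c this]
  show ?thesis
    unfolding mode_iff[OF n] using yc init by (simp add: D'_def)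
qed

theorem weak_solution_spectral:
  "\<exists>u. weak_solution \<alpha> T \<Omega> A c a F u0 u \<and>
    (\<forall>v. weak_solution \<alpha> T \<Omega> A c a F u0 v \<longrightarrow> (\<forall>t\<in>{0..T}. AE x in \<mu>. v t x = u t x)) \<and>
    (\<exists>U. (\<forall>t\<in>{0..T}. L2_sums \<Omega> (\<lambda>n x. U n t * \<phi> n x) (u t)) \<and>
      (\<forall>n\<ge>1. mode n (U n) \<and> (\<forall>w. mode n w \<longrightarrow> (\<forall>t\<in>{0..T}. w t = U n t))))"
proof -
  have unique: "w t = y t" if "1 \<le> n" "mode n w" "mode n y" "t \<in> {0..T}" for n w y t
    by (rule frac_ode_solution_unique[OF \<alpha> T a(1) F_coefficient_continuous[OF that(1)] that(2-4)])
  have "\<exists>y. 1 \<le> n \<longrightarrow> mode n y" for n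
    using frac_ode_solution_exists[OF \<alpha> T a(1) F_coefficient_continuous] by metis
  then obtain U where U: "\<And>n. 1 \<le> n \<Longrightarrow> mode n (U n)" by metis
  obtain K where K: "\<And>t N. t \<in> {0..T} \<Longrightarrow> (\<Sum>n=1..N. lam n * (U n t)\<^sup>2) \<le> K"
    using modes_energy_bound[OF U] by blast
  \<comment> \<open>As an implication, so that choice over all real t yields u.\<close>
  have "\<exists>f. t \<in> {0..T} \<longrightarrow> f \<in> H10 \<and> L2_sums \<Omega> (\<lambda>n x. U n t * \<phi> n x) f \<and>
      (\<forall>n\<ge>1. ip f (\<phi> n) = U n t) \<and> (nrm f)\<^sup>2 \<le> K / lam 1" for t
  proof (cases "t \<in> {0..T}")
    case True
    obtain f where "f \<in> H10" "L2_sums \<Omega> (\<lambda>n x. U n t * \<phi> n x) f"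
      "\<And>n. 1 \<le> n \<Longrightarrow> ip f (\<phi> n) = U n t" "(nrm f)\<^sup>2 \<le> K / lam 1"
      using eigen_series_in_H1_0[of "\<lambda>n. U n t" K, OF K[OF True]] by blast
    then show ?thesis by (intro exI[of _ f]) simp
  qed blast
  then have "\<exists>u. \<forall>t. t \<in> {0..T} \<longrightarrow> u t \<in> H10 \<and> L2_sums \<Omega> (\<lambda>n x. U n t * \<phi> n x) (u t) \<and>
      (\<forall>n\<ge>1. ip (u t) (\<phi> n) = U n t) \<and> (nrm (u t))\<^sup>2 \<le> K / lam 1"
    by (intro choice allI)
  then obtain u where u: "\<And>t. t \<in> {0..T} \<Longrightarrow> u t \<in> H10"
    "\<And>t. t \<in> {0..T} \<Longrightarrow> L2_sums \<Omega> (\<lambda>n x. U n t * \<phi> n x) (u t)"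
    "\<And>t n. t \<in> {0..T} \<Longrightarrow> 1 \<le> n \<Longrightarrow> ip (u t) (\<phi> n) = U n t"
    "\<And>t. t \<in> {0..T} \<Longrightarrow> (nrm (u t))\<^sup>2 \<le> K / lam 1"
    by blast
  have "nrm (u t) \<le> sqrt (K / lam 1)" if "t \<in> {0..T}" for t
    using u(4)[OF that] by (rule real_le_rsqrt)
  from weak_solution_of_modes[OF U u(1,3) this] have sol: "weak_solution \<alpha> T \<Omega> A c a F u0 u" .
  have "AE x in \<mu>. v t x = u t x"
    if v: "weak_solution \<alpha> T \<Omega> A c a F u0 v" and t: "t \<in> {0..T}" for v t
  proof (rule coefficients_eq_imp_AE)
    \<comment> \<open>At t = 0 a weak solution is only known to be in L2, hence the case
      split.\<close>
    show "v t \<in> L2"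
      using v t H1_0_D(2)[of "v t"] by (cases "t = 0") (auto simp: weak_solution_def)
    show "u t \<in> L2" by (rule H1_0_D(2)[OF u(1)[OF t]])
    fix n :: nat assume n: "1 \<le> n"
    show "ip (v t) (\<phi> n) = ip (u t) (\<phi> n)"
      unfolding u(3)[OF t n] by (rule unique[OF n weak_solution_mode[OF v n] U[OF n] t])
  qed
  with sol u(2) U unique show ?thesis by blast
qed

end

end

theorem theorem3p3:
  fixes \<alpha> T :: real
    and \<Omega> :: "(real^'d::finite) set"
    and A :: "'d \<Rightarrow> 'd \<Rightarrow> real^'d \<Rightarrow> real"
    and c u0 :: "real^'d \<Rightarrow> real"
    and lam :: "nat \<Rightarrow> real"
    and \<phi> :: "nat \<Rightarrow> real^'d \<Rightarrow> real"
    and a :: "real \<Rightarrow> real"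
    and F :: "real \<Rightarrow> real^'d \<Rightarrow> real"
  assumes "CARD('d) \<in> {1, 2, 3}"
    and "0 < T" and "0 < \<alpha>" and "\<alpha> < 1"
    and "open \<Omega>" and "bounded \<Omega>" and "Ck_boundary 3 \<Omega>"
    and "\<And>i j. Ck_closure 2 \<Omega> (A i j)" and "Ck_closure 2 \<Omega> c"
    and "symmetric_uniformly_elliptic \<Omega> A"
    and "eigensystem \<Omega> A c lam \<phi>"
    and "continuous_on {0..T} a" and "\<And>t. t \<in> {0..T} \<Longrightarrow> 0 < a t"
    and "continuous_into_L2 T \<Omega> F"
    and "u0 \<in> H1_0 \<Omega>"
  shows "\<exists>u. weak_solution \<alpha> T \<Omega> A c a F u0 u \<and>
      (\<forall>v. weak_solution \<alpha> T \<Omega> A c a F u0 v \<longrightarrow>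
           (\<forall>t\<in>{0..T}. AE x in lebesgue_on \<Omega>. v t x = u t x)) \<and>
      (\<exists>U :: nat \<Rightarrow> real \<Rightarrow> real.
         (\<forall>t\<in>{0..T}. L2_sums \<Omega> (\<lambda>n x. U n t * \<phi> n x) (u t)) \<and>
         (\<forall>n\<ge>1.
            let is_sol = frac_ode_solution \<alpha> T a (lam n)
                           (\<lambda>t. L2_inner \<Omega> (F t) (\<phi> n)) (L2_inner \<Omega> u0 (\<phi> n))
            in is_sol (U n) \<and> (\<forall>w. is_sol w \<longrightarrow> (\<forall>t\<in>{0..T}. w t = U n t))))"
proof -
  interpret elliptic_eigensystem \<Omega> A c lam \<phi>
    by unfold_locales (use assms in auto)
  show ?thesis
    using weak_solution_spectral[OF assms(2,3,4,12,13,14,15)] unfolding Let_def .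
qed

end
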